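(* Let $G$ be an undirected graph on the vertex set $[n]$ and let $d_1,\dots,d_n$ be positive integers. Then, for a generic $d_1\times\cdots\times d_n$ game $X$, the Spohn CI variety $\mathcal V_{X,G}$ is obtained by removing from $\mathcal M_G\cap\mathcal V_X$ the irreducible components lying in a hyperplane of the form $\{p_{+\cdots+a+\cdots+}=0\}$ (with $a\in[d_k]$ in the $k$-th position, for some $k\in[n]$); that is, $\mathcal V_{X,G}$ is the union of the irreducible components of $\mathcal M_G\cap\mathcal V_X$ that are not contained in any such hyperplane.
   Context: Write $[d]=\{1,\dots,d\}$ and $\mathcal R_C=\prod_{i\in C}[d_i]$ for $C\subseteq[n]$. A $d_1\times\cdots\times d_n$ game is a tuple $X=(X^{(1)},\dots,X^{(n)})$ of real tensors $X^{(k)}=(X^{(k)}_{j_1\cdots j_n})\in\mathbb R^{d_1\times\cdots\times d_n}$ (payoff tensor of player $k$). A statement holds for a generic game if it holds for all $X$ in a nonempty Zariski open subset of $(\mathbb R^{d_1\times\cdots\times d_n})^n$. Let $\mathbb P^{d_1\cdots d_n-1}$ be complex projective space with coordinates $p_{j_1\cdots j_n}$, $(j_1,\dots,j_n)\in\mathcal R_{[n]}$. An index replaced by $+$ means summation over that index; thus $p_{+\cdots+i+\cdots+}$, with $i$ in position $k$, is the sum of all $p_{j_1\cdots j_n}$ with $j_k=i$, and $p_{+\cdots+}$ is the sum of all coordinates. Spohn variety: $\mathcal V_X\subseteq\mathbb P^{d_1\cdots d_n-1}$ is the common vanishing set, over all $k\in[n]$, of the $2\times2$ minors of the $d_k\times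 2$ matrix $M^{(k)}$ whose $i$-th row ($i\in[d_k]$) is $\big(p_{+\cdots+i+\cdots+},\ \sum_{j:\,j_k=i}X^{(k)}_{j_1\cdots j_n}p_{j_1\cdots j_n}\big)$, with $i$ in position $k$. Parametrized undirected graphical model: let $\mathcal C(G)$ be the set of maximal cliques of $G$. $\mathcal M_G\subseteq\mathbb P^{d_1\cdots d_n-1}$ is the projective toric variety that is the Zariski closure of the image of the monomial parametrization $p_{j_1\cdots j_n}=\prod_{C\in\mathcal C(G)}\sigma^{(C)}_{j_C}$, with parameters $\sigma^{(C)}\in\mathbb C^{\mathcal R_C}$ and $j_C=(j_i)_{i\in C}$. Spohn CI variety: $\mathcal V_{X,G}$ is the Zariski closure of $(\mathcal V_X\cap\mathcal M_G)\setminus\mathcal W$, where $\mathcal W$ is the union of the hyperplanes $\{p_j=0\}$ for $j\in\mathcal R_{[n]}$ and the hyperplane $\{p_{+\cdots+}=0\}$. *)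

theory Defs
  imports "HOL-Analysis.Analysis" "HOL-Library.Poly_Mapping" "HOL-Library.Ramsey"
begin

section \<open>Multivariate polynomials\<close>

text \<open>
  A polynomial is a finitely supported map from monomials (finitely supported exponent
  vectors) to coefficients. For variables ranging over a set \<open>I\<close>, the ambient coordinate
  space is \<open>I \<rightarrow>\<^sub>E UNIV\<close>, so that points are determined by their coordinates in \<open>I\<close>.
\<close>

type_synonym ('i, 'a) mpoly = "('i \<Rightarrow>\<^sub>0 nat) \<Rightarrow>\<^sub>0 'a"

definition eval_mpoly :: "('i, 'a::comm_semiring_1) mpoly \<Rightarrow> ('i \<Rightarrow> 'a) \<Rightarrow> 'a" where
  "eval_mpoly f x =
     (\<Sum>m\<in>Poly_Mapping.keys f. Poly_Mapping.lookup f m *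
        (\<Prod>i\<in>Poly_Mapping.keys m. x i ^ Poly_Mapping.lookup m i))"

definition monom_degree :: "('i \<Rightarrow>\<^sub>0 nat) \<Rightarrow> nat" where
  "monom_degree m = (\<Sum>i\<in>Poly_Mapping.keys m. Poly_Mapping.lookup m i)"

definition mpolys :: "'i set \<Rightarrow> ('i, 'a::comm_semiring_1) mpoly set" where
  "mpolys I = {f. \<forall>m\<in>Poly_Mapping.keys f. Poly_Mapping.keys m \<subseteq> I}"

definition homogeneous_mpolys :: "'i set \<Rightarrow> ('i, 'a::comm_semiring_1) mpoly set" where
  "homogeneous_mpolys I =
     {f \<in> mpolys I. \<exists>r. \<forall>m\<in>Poly_Mapping.keys f. monom_degree m = r}"

lemma eval_mpoly_superset:
  assumes "finite A" "Poly_Mapping.keys f \<subseteq> A"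
  shows "eval_mpoly f x = (\<Sum>m\<in>A. Poly_Mapping.lookup f m *
        (\<Prod>i\<in>Poly_Mapping.keys m. x i ^ Poly_Mapping.lookup m i))"
  unfolding eval_mpoly_def using assms
  by (intro sum.mono_neutral_left) (auto simp: in_keys_iff)

lemma eval_mpoly_add: "eval_mpoly (f + g) x = eval_mpoly f x + eval_mpoly g x"
proof -
  let ?A = "Poly_Mapping.keys f \<union> Poly_Mapping.keys g"
  have "Poly_Mapping.keys (f + g) \<subseteq> ?A"
    by (rule Poly_Mapping.keys_add)
  then show ?thesis
    by (simp add: eval_mpoly_superset[of ?A] lookup_add distrib_right sum.distrib)
qed

lemma monom_eval_add:
  fixes x :: "'i \<Rightarrow> 'a::comm_semiring_1"
  shows "(\<Prod>i\<in>Poly_Mapping.keys (m + m'). x i ^ Poly_Mapping.lookup (m + m') i) =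
    (\<Prod>i\<in>Poly_Mapping.keys m. x i ^ Poly_Mapping.lookup m i) *
    (\<Prod>i\<in>Poly_Mapping.keys m'. x i ^ Poly_Mapping.lookup m' i)"
proof -
  let ?A = "Poly_Mapping.keys m \<union> Poly_Mapping.keys m'"
  have *: "(\<Prod>i\<in>Poly_Mapping.keys k. x i ^ Poly_Mapping.lookup k i) =
        (\<Prod>i\<in>?A. x i ^ Poly_Mapping.lookup k i)" if "Poly_Mapping.keys k \<subseteq> ?A" for k
    using that by (intro prod.mono_neutral_left) (auto simp: in_keys_iff)
  show ?thesis
    by (subst (1 2 3) *) (auto simp: Poly_Mapping.keys_add lookup_add power_add prod.distrib
        dest: subsetD[OF Poly_Mapping.keys_add])
qed

lemma eval_mpoly_single:
  "eval_mpoly (Poly_Mapping.single m c) x =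
     c * (\<Prod>i\<in>Poly_Mapping.keys m. x i ^ Poly_Mapping.lookup m i)"
  by (subst eval_mpoly_superset[of "{m}"]) (auto simp: lookup_single)

lemma mpoly_induct [case_names zero add]:
  fixes f :: "('i, 'a::comm_semiring_1) mpoly"
  assumes zero: "P 0" and add: "\<And>f m c. P f \<Longrightarrow> P (f + Poly_Mapping.single m c)"
  shows "P f"
proof (induction f rule: update_induct)
  case const
  then show ?case using zero by simp
next
  case (update f a b)
  have "Poly_Mapping.update a b f = f + Poly_Mapping.single a b"
    using update(1)
    by (intro poly_mapping_eqI) (auto simp: lookup_update lookup_add lookup_single in_keys_iff when_def)
  with add[OF update(3)] show ?case by simp
qed

lemma eval_mpoly_mult: "eval_mpoly (f * g) x = eval_mpoly f x * eval_mpoly g x"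
proof (induction f rule: mpoly_induct)
  case zero
  show ?case by (simp add: eval_mpoly_def)
next
  case (add f m c)
  have "eval_mpoly (Poly_Mapping.single m c * g) x =
      eval_mpoly (Poly_Mapping.single m c) x * eval_mpoly g x"
  proof (induction g rule: mpoly_induct)
    case zero
    show ?case by (simp add: eval_mpoly_def)
  next
    case (add g m' c')
    then show ?case
      by (simp add: distrib_left eval_mpoly_add mult_single eval_mpoly_single monom_eval_add mult_ac)
  qed
  with add show ?case
    by (simp add: distrib_right eval_mpoly_add)
qed

lemma keys_mult_mono:
  assumes "k \<in> Poly_Mapping.keys (f * g)"
  obtains a b where "k = a + b" "a \<in> Poly_Mapping.keys f" "b \<in> Poly_Mapping.keys g"
  using assms Poly_Mapping.keys_mult[of f g] by auto

lemma mpolys_mult: "f \<in> mpolys I \<Longrightarrow> g \<in> mpolys I \<Longrightarrow> f * g \<in> mpolys I"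
  unfolding mpolys_def
  by (auto elim!: keys_mult_mono dest!: subsetD[OF Poly_Mapping.keys_add])

lemma monom_degree_add: "monom_degree (m + m') = monom_degree m + monom_degree m'"
proof -
  let ?A = "Poly_Mapping.keys m \<union> Poly_Mapping.keys m'"
  have *: "monom_degree k = (\<Sum>i\<in>?A. Poly_Mapping.lookup k i)"
    if "Poly_Mapping.keys k \<subseteq> ?A" for k
    unfolding monom_degree_def using that
    by (intro sum.mono_neutral_left) (auto simp: in_keys_iff)
  show ?thesis
    by (subst (1 2 3) *) (auto simp: lookup_add sum.distrib dest: subsetD[OF Poly_Mapping.keys_add])
qed

lemma homogeneous_mpolys_mult:
  assumes "f \<in> homogeneous_mpolys I" "g \<in> homogeneous_mpolys I"
  shows "f * g \<in> homogeneous_mpolys I"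
proof -
  from assms obtain r s where "\<forall>m\<in>Poly_Mapping.keys f. monom_degree m = r"
      "\<forall>m\<in>Poly_Mapping.keys g. monom_degree m = s"
    by (auto simp: homogeneous_mpolys_def)
  then have "\<forall>m\<in>Poly_Mapping.keys (f * g). monom_degree m = r + s"
    by (auto elim!: keys_mult_mono simp: monom_degree_add)
  with assms show ?thesis
    by (auto simp: homogeneous_mpolys_def mpolys_mult)
qed

lemma eval_homogeneous_scale:
  assumes f: "f \<in> homogeneous_mpolys I" and q: "\<forall>i\<in>I. q i = c * p i"
  shows "\<exists>r. eval_mpoly f q = c ^ r * eval_mpoly f p"
proof -
  obtain r where r: "\<And>m. m \<in> Poly_Mapping.keys f \<Longrightarrow> monom_degree m = r"
    and I: "\<And>m. m \<in> Poly_Mapping.keys f \<Longrightarrow> Poly_Mapping.keys m \<subseteq> I"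
    using f by (auto simp: homogeneous_mpolys_def mpolys_def)
  have "(\<Prod>i\<in>Poly_Mapping.keys m. q i ^ Poly_Mapping.lookup m i) =
      c ^ r * (\<Prod>i\<in>Poly_Mapping.keys m. p i ^ Poly_Mapping.lookup m i)"
    if m: "m \<in> Poly_Mapping.keys f" for m
  proof -
    have "(\<Prod>i\<in>Poly_Mapping.keys m. q i ^ Poly_Mapping.lookup m i) =
        (\<Prod>i\<in>Poly_Mapping.keys m. c ^ Poly_Mapping.lookup m i * p i ^ Poly_Mapping.lookup m i)"
      using I[OF m] q by (intro prod.cong) (auto simp: power_mult_distrib)
    also have "\<dots> = c ^ r * (\<Prod>i\<in>Poly_Mapping.keys m. p i ^ Poly_Mapping.lookup m i)"
      using r[OF m] by (simp add: prod.distrib monom_degree_def flip: power_sum)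
    finally show ?thesis .
  qed
  then have "eval_mpoly f q = c ^ r * eval_mpoly f p"
    by (simp add: eval_mpoly_def sum_distrib_left mult.left_commute cong: sum.cong)
  then show ?thesis ..
qed


section \<open>Affine and projective Zariski topologies\<close>

definition affine_zeros :: "'i set \<Rightarrow> (('i \<Rightarrow> 'a) \<Rightarrow> 'a) set \<Rightarrow> ('i \<Rightarrow> 'a::field) set" where
  "affine_zeros I F = {x \<in> I \<rightarrow>\<^sub>E UNIV. \<forall>f\<in>F. f x = 0}"

definition affine_zariski :: "'i set \<Rightarrow> ('i \<Rightarrow> 'a::field) topology" where
  "affine_zariski I = topology (\<lambda>U. \<exists>F \<subseteq> mpolys I.
     U = (I \<rightarrow>\<^sub>E UNIV) - affine_zeros I (eval_mpoly ` F))"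

text \<open>A point of projective space is an equivalence class of nonzero coordinate vectors.\<close>

definition nonzero_vectors :: "'i set \<Rightarrow> ('i \<Rightarrow> 'a::field) set" where
  "nonzero_vectors I = {p \<in> I \<rightarrow>\<^sub>E UNIV. \<exists>i\<in>I. p i \<noteq> 0}"

definition proj_rel :: "'i set \<Rightarrow> (('i \<Rightarrow> 'a) \<times> ('i \<Rightarrow> 'a::field)) set" where
  "proj_rel I = {(p, q). p \<in> nonzero_vectors I \<and> q \<in> nonzero_vectors I \<and>
     (\<exists>c. c \<noteq> 0 \<and> (\<forall>i\<in>I. q i = c * p i))}"

definition proj_space :: "'i set \<Rightarrow> ('i \<Rightarrow> 'a::field) set set" where
  "proj_space I = nonzero_vectors I // proj_rel I"

definition proj_zeros :: "'i set \<Rightarrow> (('i \<Rightarrow> 'a) \<Rightarrow> 'a) set \<Rightarrow> ('i \<Rightarrow> 'a::field) set set" where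
  "proj_zeros I F = {P \<in> proj_space I. \<forall>f\<in>F. \<forall>p\<in>P. f p = 0}"

definition proj_zariski :: "'i set \<Rightarrow> ('i \<Rightarrow> 'a::field) set topology" where
  "proj_zariski I = topology (\<lambda>U. \<exists>F \<subseteq> homogeneous_mpolys I.
     U = proj_space I - proj_zeros I (eval_mpoly ` F))"

lemma istopology_zeros:
  fixes A :: "'p set" and Z :: "'f::times set \<Rightarrow> 'p set"
  assumes Z: "\<And>F. Z F = {x \<in> A. \<forall>f\<in>F. V f x}"
    and mult: "\<And>f g. f \<in> H \<Longrightarrow> g \<in> H \<Longrightarrow> f * g \<in> H"
    and V: "\<And>f g x. f \<in> H \<Longrightarrow> g \<in> H \<Longrightarrow> x \<in> A \<Longrightarrow> V (f * g) x \<longleftrightarrow> V f x \<or> V g x"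
  shows "istopology (\<lambda>U. \<exists>F \<subseteq> H. U = A - Z F)"
  unfolding istopology_def
proof (intro conjI allI impI)
  fix S T assume "\<exists>F \<subseteq> H. S = A - Z F" "\<exists>F \<subseteq> H. T = A - Z F"
  then obtain F G where FG: "F \<subseteq> H" "G \<subseteq> H" "S = A - Z F" "T = A - Z G" by blast
  let ?K = "{f * g | f g. f \<in> F \<and> g \<in> G}"
  have "?K \<subseteq> H" using FG mult by blast
  moreover have "S \<inter> T = A - Z ?K"
  proof (intro set_eqI iffI)
    fix x assume "x \<in> S \<inter> T"
    then obtain f g where "x \<in> A" "f \<in> F" "g \<in> G" "\<not> V f x" "\<not> V g x"
      using FG by (auto simp: Z)
    then show "x \<in> A - Z ?K"
      using V[of f g x] FG by (auto simp: Z)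
  next
    fix x assume "x \<in> A - Z ?K"
    then obtain f g where fg: "x \<in> A" "f \<in> F" "g \<in> G" "\<not> V (f * g) x"
      by (auto simp: Z)
    then have "\<not> V f x" "\<not> V g x"
      using V[of f g x] FG by blast+
    with fg show "x \<in> S \<inter> T" using FG by (auto simp: Z)
  qed
  ultimately show "\<exists>F \<subseteq> H. S \<inter> T = A - Z F" by blast
next
  fix \<U> assume "\<forall>U\<in>\<U>. \<exists>F \<subseteq> H. U = A - Z F"
  then obtain F where F: "\<And>U. U \<in> \<U> \<Longrightarrow> F U \<subseteq> H \<and> U = A - Z (F U)"
    by metis
  have "(\<Union>U\<in>\<U>. F U) \<subseteq> H" using F by blast
  moreover have "\<Union>\<U> = (\<Union>U\<in>\<U>. A - Z (F U))" using F by blast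
  then have "\<Union>\<U> = A - Z (\<Union>U\<in>\<U>. F U)" by (auto simp: Z)
  ultimately show "\<exists>F \<subseteq> H. \<Union>\<U> = A - Z F" by blast
qed

lemma openin_affine_zariski:
  "openin (affine_zariski I) U \<longleftrightarrow> (\<exists>F \<subseteq> mpolys I.
     U = (I \<rightarrow>\<^sub>E UNIV) - affine_zeros I (eval_mpoly ` F))"
proof -
  have "istopology (\<lambda>U :: ('a \<Rightarrow> 'b) set. \<exists>F \<subseteq> mpolys I.
     U = (I \<rightarrow>\<^sub>E UNIV) - affine_zeros I (eval_mpoly ` F))"
    by (rule istopology_zeros[where V = "\<lambda>f x. eval_mpoly f x = 0"])
      (auto simp: affine_zeros_def mpolys_mult eval_mpoly_mult)
  then show ?thesis
    by (simp add: affine_zariski_def topology_inverse')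
qed

lemma proj_space_related:
  assumes "P \<in> proj_space I" "p \<in> P" "q \<in> P"
  shows "\<exists>c. c \<noteq> 0 \<and> (\<forall>i\<in>I. q i = c * p i)"
proof -
  from assms obtain x a b where "a \<noteq> 0" "b \<noteq> 0"
      "\<forall>i\<in>I. p i = a * x i" "\<forall>i\<in>I. q i = b * x i"
    by (auto simp: proj_space_def proj_rel_def elim!: quotientE)
  then show ?thesis
    by (intro exI[of _ "b / a"]) auto
qed

lemma openin_proj_zariski:
  "openin (proj_zariski I) U \<longleftrightarrow> (\<exists>F \<subseteq> homogeneous_mpolys I.
     U = proj_space I - proj_zeros I (eval_mpoly ` F))"
proof -
  have scale: "eval_mpoly f q = 0"
    if h: "f \<in> homogeneous_mpolys I" "P \<in> proj_space I" "p \<in> P" "q \<in> P" "eval_mpoly f p = 0"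
    for f :: "('a, 'b) mpoly" and p q P
  proof -
    obtain c where "\<forall>i\<in>I. q i = c * p i"
      using proj_space_related[OF h(2-4)] by blast
    from eval_homogeneous_scale[OF h(1) this] h(5) show ?thesis by auto
  qed
  have "istopology (\<lambda>U :: ('a \<Rightarrow> 'b) set set. \<exists>F \<subseteq> homogeneous_mpolys I.
     U = proj_space I - proj_zeros I (eval_mpoly ` F))"
  proof (rule istopology_zeros[where V = "\<lambda>f P. \<forall>p\<in>P. eval_mpoly f p = 0"])
    fix f g :: "('a, 'b) mpoly" and P :: "('a \<Rightarrow> 'b) set"
    assume fgP: "f \<in> homogeneous_mpolys I" "g \<in> homogeneous_mpolys I" "P \<in> proj_space I"
    show "(\<forall>p\<in>P. eval_mpoly (f * g) p = 0) \<longleftrightarrow>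
        (\<forall>p\<in>P. eval_mpoly f p = 0) \<or> (\<forall>p\<in>P. eval_mpoly g p = 0)"
      unfolding eval_mpoly_mult mult_eq_0_iff
      using scale[OF fgP(1,3)] scale[OF fgP(2,3)] by blast
  qed (auto simp: proj_zeros_def homogeneous_mpolys_mult)
  then show ?thesis
    by (simp add: proj_zariski_def topology_inverse')
qed


section \<open>Irreducible components\<close>

definition irreducible_space :: "'a topology \<Rightarrow> bool" where
  "irreducible_space T \<longleftrightarrow> topspace T \<noteq> {} \<and>
     (\<forall>A B. closedin T A \<and> closedin T B \<and> A \<union> B = topspace T
        \<longrightarrow> A = topspace T \<or> B = topspace T)"

definition irreducible_components :: "'a topology \<Rightarrow> 'a set set" where
  "irreducible_components T = {Z. Z \<subseteq> topspace T \<and> irreducible_space (subtopology T Z) \<and>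
     (\<forall>Y. Z \<subseteq> Y \<and> Y \<subseteq> topspace T \<and> irreducible_space (subtopology T Y) \<longrightarrow> Y = Z)}"


section \<open>Games, Spohn varieties and graphical models\<close>

definition state_space :: "nat set \<Rightarrow> (nat \<Rightarrow> nat) \<Rightarrow> (nat \<Rightarrow> nat) set" where
  "state_space C d = (\<Pi>\<^sub>E i\<in>C. {1..d i})"

abbreviation states :: "nat \<Rightarrow> (nat \<Rightarrow> nat) \<Rightarrow> (nat \<Rightarrow> nat) set" where
  "states n d \<equiv> state_space {1..n} d"

text \<open>A game is stored as \<open>X (k, j)\<close>, the entry with multi-index \<open>j\<close> of the payoff tensor
  of player \<open>k\<close>.\<close>

type_synonym game = "nat \<times> (nat \<Rightarrow> nat) \<Rightarrow> real"

definition generic_game :: "nat \<Rightarrow> (nat \<Rightarrow> nat) \<Rightarrow> (game \<Rightarrow> bool) \<Rightarrow> bool" where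
  "generic_game n d Q \<longleftrightarrow>
     (\<exists>U. openin (affine_zariski ({1..n} \<times> states n d)) U \<and> U \<noteq> {} \<and> (\<forall>X\<in>U. Q X))"

definition marginal :: "nat \<Rightarrow> (nat \<Rightarrow> nat) \<Rightarrow> nat \<Rightarrow> nat \<Rightarrow> ((nat \<Rightarrow> nat) \<Rightarrow> complex) \<Rightarrow> complex" where
  "marginal n d k i p = (\<Sum>j | j \<in> states n d \<and> j k = i. p j)"

definition payoff_sum ::
    "nat \<Rightarrow> (nat \<Rightarrow> nat) \<Rightarrow> game \<Rightarrow> nat \<Rightarrow> nat \<Rightarrow> ((nat \<Rightarrow> nat) \<Rightarrow> complex) \<Rightarrow> complex" where
  "payoff_sum n d X k i p = (\<Sum>j | j \<in> states n d \<and> j k = i. complex_of_real (X (k, j)) * p j)"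

text \<open>The minor, on rows \<open>i\<close> and \<open>l\<close>, of the matrix whose \<open>i\<close>-th row is
  \<open>(marginal n d k i p, payoff_sum n d X k i p)\<close>.\<close>

definition spohn_minor ::
    "nat \<Rightarrow> (nat \<Rightarrow> nat) \<Rightarrow> game \<Rightarrow> nat \<Rightarrow> nat \<Rightarrow> nat \<Rightarrow> ((nat \<Rightarrow> nat) \<Rightarrow> complex) \<Rightarrow> complex" where
  "spohn_minor n d X k i l p =
     marginal n d k i p * payoff_sum n d X k l p - payoff_sum n d X k i p * marginal n d k l p"

definition spohn_variety ::
    "nat \<Rightarrow> (nat \<Rightarrow> nat) \<Rightarrow> game \<Rightarrow> ((nat \<Rightarrow> nat) \<Rightarrow> complex) set set" where
  "spohn_variety n d X = proj_zeros (states n d)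
     {spohn_minor n d X k i l | k i l. k \<in> {1..n} \<and> i \<in> {1..d k} \<and> l \<in> {1..d k} \<and> i < l}"

definition maximal_cliques :: "nat \<Rightarrow> nat set set \<Rightarrow> nat set set" where
  "maximal_cliques n E = {C. C \<subseteq> {1..n} \<and> clique C E \<and>
     (\<forall>D. C \<subseteq> D \<and> D \<subseteq> {1..n} \<and> clique D E \<longrightarrow> D = C)}"

definition clique_monomial ::
    "nat \<Rightarrow> (nat \<Rightarrow> nat) \<Rightarrow> nat set set \<Rightarrow> (nat set \<Rightarrow> (nat \<Rightarrow> nat) \<Rightarrow> complex)
      \<Rightarrow> (nat \<Rightarrow> nat) \<Rightarrow> complex" where
  "clique_monomial n d E \<sigma> =
     (\<lambda>j\<in>states n d. \<Prod>C\<in>maximal_cliques n E. \<sigma> C (restrict j C))"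

text \<open>The monomial map is only defined, as a map to projective space, where its coordinates do
  not vanish simultaneously.\<close>

definition graphical_model ::
    "nat \<Rightarrow> (nat \<Rightarrow> nat) \<Rightarrow> nat set set \<Rightarrow> ((nat \<Rightarrow> nat) \<Rightarrow> complex) set set" where
  "graphical_model n d E = proj_zariski (states n d) closure_of
     {proj_rel (states n d) `` {clique_monomial n d E \<sigma>} | \<sigma>.
        \<sigma> \<in> (\<Pi>\<^sub>E C\<in>maximal_cliques n E. state_space C d \<rightarrow>\<^sub>E UNIV) \<and>
        clique_monomial n d E \<sigma> \<in> nonzero_vectors (states n d)}"

definition marginal_hyperplane ::
    "nat \<Rightarrow> (nat \<Rightarrow> nat) \<Rightarrow> nat \<Rightarrow> nat \<Rightarrow> ((nat \<Rightarrow> nat) \<Rightarrow> complex) set set" where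
  "marginal_hyperplane n d k a = proj_zeros (states n d) {marginal n d k a}"

definition excluded_hyperplanes ::
    "nat \<Rightarrow> (nat \<Rightarrow> nat) \<Rightarrow> ((nat \<Rightarrow> nat) \<Rightarrow> complex) set set" where
  "excluded_hyperplanes n d =
     (\<Union>j\<in>states n d. proj_zeros (states n d) {\<lambda>p. p j}) \<union>
     proj_zeros (states n d) {\<lambda>p. \<Sum>j\<in>states n d. p j}"

definition spohn_CI_variety ::
    "nat \<Rightarrow> (nat \<Rightarrow> nat) \<Rightarrow> nat set set \<Rightarrow> game \<Rightarrow> ((nat \<Rightarrow> nat) \<Rightarrow> complex) set set" where
  "spohn_CI_variety n d E X = proj_zariski (states n d) closure_of
     (spohn_variety n d X \<inter> graphical_model n d E - excluded_hyperplanes n d)"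

end

theory Submission
  imports Defs "HOL-Computational_Algebra.Fundamental_Theorem_Algebra"
begin

text \<open>
  Let \<open>Y = M_G \<inter> V_X\<close>. In a Noetherian space, the union of the components of \<open>Y\<close> not contained in
  any of finitely many closed sets is the closure of the complement of these sets in \<open>Y\<close>. So it
  suffices that every point \<open>p\<close> of \<open>Y\<close> lying outside \<open>W\<close>, or outside all marginal hyperplanes, is
  a limit of points of \<open>Y\<close> at which no coordinate, no marginal and not the total sum vanishes.

  The support of \<open>p\<close> is a face of the toric variety \<open>M_G\<close>, so \<open>p\<close> is the value at \<open>t = 0\<close> of a
  monomial map \<open>\<phi>(t, s)\<close> that sends \<open>t \<noteq> 0\<close> into the torus of \<open>M_G\<close>. Near \<open>p\<close> the Spohn variety is
  cut out by \<open>c = \<Sum>k. (d k - 1)\<close> equations, so its preimage has codimension at most \<open>c\<close> in the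
  affine space of all \<open>(t, s)\<close>. If \<open>p\<close> were not such a limit, then this preimage would locally be
  contained in the zero set of one of finitely many nonzero polynomials \<open>l\<close>. But for fixed \<open>(t, s)\<close>
  the conditions on \<open>X\<close> are linear, so the incidence variety of pairs \<open>(X, (t, s))\<close> is rational of
  codimension \<open>c\<close>. Counting monomials shows that, for \<open>X\<close> outside a hypersurface, any
  \<open>dim - c\<close> of the coordinates are algebraically dependent on the part of the fibre where
  \<open>l = 0\<close>, so this part has codimension greater than \<open>c\<close>.

  The contradiction between the two bounds is again obtained by counting: the Nullstellensatz turns
  the algebraic dependences into relations modulo the \<open>c\<close> equations, which makes the quotients by
  high powers of the maximal ideal at \<open>p\<close> too small.
\<close>

section \<open>Multivariate polynomials\<close>

text \<open>The obstacle is the boundary of the torus: the monomial parametrization need not reach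
  the points p with vanishing coordinates. The extra coordinate t does, but then t = 0 has to be
  left again, so t itself is one of the forms l. Only two facts about p are used. Its support meets
  every slice \<open>j k = i\<close>: outside \<open>W\<close> because the support is everything,
  outside the marginal hyperplanes because no marginal vanishes. Hence each linear condition on X
  has a pivot, a payoff entry whose coefficient is nonzero even at t = 0, and can be solved for it.
  Moreover every player has some nonzero marginal at p, so near p the minors involving that row
  imply the others; this gives the number c. Genericity must not depend on p, but only finitely many
  data enter: supports, forms l and sets of coordinates. Both bounds are phrased as algebraic
  dependence of every set of r coordinates, a form in which counting monomials suffices. To have r >
  0 in all cases, c further coordinates on which \<open>\<phi>\<close> does not depend are added to
  (t, s).\<close>

definition mconst :: "'a::comm_semiring_1 \<Rightarrow> ('i, 'a) mpoly" where
  "mconst c = Poly_Mapping.single 0 c"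

definition mvar :: "'i \<Rightarrow> ('i, 'a::comm_semiring_1) mpoly" where
  "mvar i = Poly_Mapping.single (Poly_Mapping.single i 1) 1"

definition mmonom :: "('i \<Rightarrow>\<^sub>0 nat) \<Rightarrow> ('i, 'a::comm_semiring_1) mpoly" where
  "mmonom u = Poly_Mapping.single u 1"

lemma eval_mconst [simp]: "eval_mpoly (mconst c) x = c"
  by (simp add: mconst_def eval_mpoly_single)

lemma eval_mvar [simp]: "eval_mpoly (mvar i) x = x i"
  by (simp add: mvar_def eval_mpoly_single)

lemma eval_zero [simp]: "eval_mpoly 0 x = 0"
  by (simp add: eval_mpoly_def)

lemma eval_one [simp]: "eval_mpoly 1 x = 1"
  by (metis eval_mconst mconst_def single_one)

lemma eval_uminus [simp]: "eval_mpoly (- f) x = - eval_mpoly (f :: ('i, 'a::comm_ring_1) mpoly) x"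
  using eval_mpoly_add[of f "- f" x] by (simp add: eq_neg_iff_add_eq_0 add.commute)

lemma eval_minus [simp]:
  "eval_mpoly (f - g) x = eval_mpoly (f :: ('i, 'a::comm_ring_1) mpoly) x - eval_mpoly g x"
  using eval_mpoly_add[of f "- g" x] by simp

lemmas eval_add [simp] = eval_mpoly_add
lemmas eval_mult [simp] = eval_mpoly_mult

lemma eval_sum [simp]: "eval_mpoly (\<Sum>a\<in>A. f a) x = (\<Sum>a\<in>A. eval_mpoly (f a) x)"
  by (induction A rule: infinite_finite_induct) auto

lemma eval_prod [simp]: "eval_mpoly (\<Prod>a\<in>A. f a) x = (\<Prod>a\<in>A. eval_mpoly (f a) x)"
  by (induction A rule: infinite_finite_induct) auto

lemma eval_power [simp]: "eval_mpoly (f ^ k) x = eval_mpoly f x ^ k"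
  by (induction k) auto

lemma eval_mmonom:
  assumes "finite I" "Poly_Mapping.keys u \<subseteq> I"
  shows "eval_mpoly (mmonom u) x = (\<Prod>i\<in>I. x i ^ Poly_Mapping.lookup u i)"
  unfolding mmonom_def eval_mpoly_single using assms
  by (auto intro!: prod.mono_neutral_left simp: in_keys_iff)

lemma mmonom_add: "mmonom (u + v) = mmonom u * mmonom v"
  by (simp add: mmonom_def mult_single)

lemma mmonom_0 [simp]: "mmonom 0 = 1"
  by (simp add: mmonom_def)

lemma mconst_add: "mconst (a + b) = mconst a + mconst b"
  by (simp add: mconst_def single_add)

lemma mconst_mult: "mconst (a * b) = mconst a * mconst b"
  by (simp add: mconst_def mult_single)

lemma mconst_0 [simp]: "mconst 0 = 0"
  by (simp add: mconst_def)

lemma mconst_1 [simp]: "mconst 1 = 1"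
  by (simp add: mconst_def)

lemma mpoly_sum_monom:
  "f = (\<Sum>u\<in>Poly_Mapping.keys f. mconst (Poly_Mapping.lookup f u) * mmonom u)"
proof (rule poly_mapping_eqI)
  fix k
  have "Poly_Mapping.lookup f k =
      (\<Sum>u\<in>Poly_Mapping.keys f. if u = k then Poly_Mapping.lookup f u else 0)"
    by (simp add: in_keys_iff)
  also have "\<dots> = (\<Sum>u\<in>Poly_Mapping.keys f.
      Poly_Mapping.lookup (mconst (Poly_Mapping.lookup f u) * mmonom u) k)"
    by (intro sum.cong refl) (simp add: mconst_def mmonom_def mult_single lookup_single when_def)
  finally show "Poly_Mapping.lookup f k = Poly_Mapping.lookup
      (\<Sum>u\<in>Poly_Mapping.keys f. mconst (Poly_Mapping.lookup f u) * mmonom u) k"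
    by (simp add: lookup_sum)
qed

lemma lookup_sum_monom:
  assumes "finite A"
  shows "Poly_Mapping.lookup (\<Sum>u\<in>A. mconst (z u) * mmonom u) k = (if k \<in> A then z k else 0)"
proof -
  have "Poly_Mapping.lookup (\<Sum>u\<in>A. mconst (z u) * mmonom u) k = (\<Sum>u\<in>A. if u = k then z u else 0)"
    unfolding lookup_sum
    by (intro sum.cong refl) (simp add: mconst_def mmonom_def mult_single lookup_single when_def)
  then show ?thesis using assms by (simp add: sum.delta)
qed

lemma mpolys_zero [simp]: "0 \<in> mpolys I"
  and mpolys_const [simp]: "mconst c \<in> mpolys I"
  and mpolys_var: "i \<in> I \<Longrightarrow> mvar i \<in> mpolys I"
  and mpolys_monom: "Poly_Mapping.keys u \<subseteq> I \<Longrightarrow> mmonom u \<in> mpolys I"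
  by (auto simp: mpolys_def mconst_def mvar_def mmonom_def)

lemma mpolys_one [simp]: "1 \<in> mpolys I"
  using mpolys_const[of 1 I] by simp

lemma mpolys_add: "f \<in> mpolys I \<Longrightarrow> g \<in> mpolys I \<Longrightarrow> f + g \<in> mpolys I"
  unfolding mpolys_def using Poly_Mapping.keys_add[of f g] by blast

lemma mpolys_uminus: "f \<in> mpolys I \<Longrightarrow> - (f :: ('i, 'a::comm_ring_1) mpoly) \<in> mpolys I"
  by (auto simp: mpolys_def in_keys_iff)

lemma mpolys_sum: "(\<And>a. a \<in> A \<Longrightarrow> f a \<in> mpolys I) \<Longrightarrow> (\<Sum>a\<in>A. f a) \<in> mpolys I"
  by (induction A rule: infinite_finite_induct) (auto simp: mpolys_add)

lemma mpolys_prod: "(\<And>a. a \<in> A \<Longrightarrow> f a \<in> mpolys I) \<Longrightarrow> (\<Prod>a\<in>A. f a) \<in> mpolys I"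
  by (induction A rule: infinite_finite_induct) (auto simp: mpolys_mult)

lemma mpolys_power: "f \<in> mpolys I \<Longrightarrow> f ^ k \<in> mpolys I"
  by (induction k) (auto simp: mpolys_mult)

lemma eval_mpoly_cong:
  assumes "f \<in> mpolys I" "\<And>i. i \<in> I \<Longrightarrow> x i = y i"
  shows "eval_mpoly f x = eval_mpoly f y"
  unfolding eval_mpoly_def using assms
  by (intro sum.cong prod.cong refl arg_cong2[of _ _ _ _ times] arg_cong2[of _ _ _ _ power]) (auto simp: mpolys_def)

section \<open>Polynomial functions and their nonvanishing points\<close>

definition polyf :: "'i set \<Rightarrow> (('i \<Rightarrow> 'a::comm_ring_1) \<Rightarrow> 'a) \<Rightarrow> bool" where
  "polyf I f \<longleftrightarrow> (\<exists>p\<in>mpolys I. f = eval_mpoly p)"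

named_theorems polyf_intros

lemma polyf_eval: "p \<in> mpolys I \<Longrightarrow> polyf I (eval_mpoly p)"
  by (auto simp: polyf_def)

lemma polyf_const [polyf_intros]: "polyf I (\<lambda>x. c)"
  unfolding polyf_def by (rule bexI[of _ "mconst c"]) auto

lemma polyf_var [polyf_intros]: "i \<in> I \<Longrightarrow> polyf I (\<lambda>x. x i)"
  unfolding polyf_def by (rule bexI[of _ "mvar i"]) (auto simp: mpolys_var)

lemma polyf_add [polyf_intros]: "polyf I f \<Longrightarrow> polyf I g \<Longrightarrow> polyf I (\<lambda>x. f x + g x)"
  unfolding polyf_def by clarify (rule_tac x="p + pa" in bexI, auto simp: mpolys_add)

lemma polyf_mult [polyf_intros]: "polyf I f \<Longrightarrow> polyf I g \<Longrightarrow> polyf I (\<lambda>x. f x * g x)"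
  unfolding polyf_def by clarify (rule_tac x="p * pa" in bexI, auto simp: mpolys_mult)

lemma polyf_uminus [polyf_intros]: "polyf I f \<Longrightarrow> polyf I (\<lambda>x. - f x)"
  unfolding polyf_def by clarify (rule_tac x="- p" in bexI, auto simp: mpolys_uminus)

lemma polyf_diff [polyf_intros]: "polyf I f \<Longrightarrow> polyf I g \<Longrightarrow> polyf I (\<lambda>x. f x - g x)"
  using polyf_add[of I f "\<lambda>x. - g x"] polyf_uminus[of I g] by simp

lemma polyf_sum [polyf_intros]:
  "(\<And>a. a \<in> A \<Longrightarrow> polyf I (f a)) \<Longrightarrow> polyf I (\<lambda>x. \<Sum>a\<in>A. f a x)"
  by (induction A rule: infinite_finite_induct) (auto intro: polyf_intros)

lemma polyf_prod [polyf_intros]: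
  "(\<And>a. a \<in> A \<Longrightarrow> polyf I (f a)) \<Longrightarrow> polyf I (\<lambda>x. \<Prod>a\<in>A. f a x)"
  by (induction A rule: infinite_finite_induct) (auto intro: polyf_intros)

lemma polyf_power [polyf_intros]: "polyf I f \<Longrightarrow> polyf I (\<lambda>x. f x ^ k)"
  by (induction k) (auto intro: polyf_intros)

lemma polyf_compose:
  assumes "f \<in> mpolys V" "\<And>v. v \<in> V \<Longrightarrow> polyf I (g v)"
  shows "polyf I (\<lambda>x. eval_mpoly f (\<lambda>v. g v x))"
  unfolding eval_mpoly_def using assms by (auto simp: mpolys_def intro!: polyf_intros)

lemma polyf_compose':
  assumes "polyf V f" "\<And>v. v \<in> V \<Longrightarrow> polyf I (g v)"
  shows "polyf I (\<lambda>x. f (\<lambda>v. g v x))"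
  using assms polyf_compose unfolding polyf_def[of V] by blast

text \<open>Induction on the variables: with the others fixed, \<open>f\<close> is a univariate
  polynomial in variable \<open>i\<close> with infinitely many roots, so its coefficients
  \<open>g n\<close> vanish. Testing at natural numbers yields nonvanishing points that can be read
  both as real games and as complex vectors.\<close>

lemma mpoly_eq_0_if_eval_nat:
  fixes f :: "('i, 'a::{idom, ring_char_0}) mpoly"
  assumes "finite I" "f \<in> mpolys I" "\<And>x::'i \<Rightarrow> nat. eval_mpoly f (\<lambda>i. of_nat (x i)) = 0"
  shows "f = 0"
  using assms
proof (induction I arbitrary: f rule: finite_induct)
  case empty
  then have "Poly_Mapping.keys f \<subseteq> {0}" by (auto simp: mpolys_def)
  then have "f = Poly_Mapping.single 0 (Poly_Mapping.lookup f 0)"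
    by (intro poly_mapping_eqI) (auto simp: lookup_single when_def in_keys_iff)
  moreover from this have "Poly_Mapping.lookup f 0 = 0"
    using empty(2)[of "\<lambda>_. 0"] eval_mconst[of "Poly_Mapping.lookup f 0" "\<lambda>_. 0"]
    unfolding mconst_def by (metis of_nat_0)
  ultimately show ?case by simp
next
  case (insert i I)
  let ?r = "\<lambda>u::'i \<Rightarrow>\<^sub>0 nat. Poly_Mapping.update i 0 u"
  define K where "K = Poly_Mapping.keys f"
  have finK: "finite K" by (simp add: K_def)
  define g where "g n = (\<Sum>u\<in>{u\<in>K. Poly_Mapping.lookup u i = n}.
      mconst (Poly_Mapping.lookup f u) * mmonom (?r u))" for n
  have keysr: "Poly_Mapping.keys (?r u) \<subseteq> I" if "u \<in> K" for u
  proof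
    fix j assume j: "j \<in> Poly_Mapping.keys (?r u)"
    then have "j \<noteq> i" "j \<in> Poly_Mapping.keys u"
      by (simp_all add: in_keys_iff lookup_update split: if_splits)
    then show "j \<in> I" using that insert.prems(1) unfolding K_def mpolys_def by blast
  qed
  have gI: "g n \<in> mpolys I" for n
    unfolding g_def using keysr by (intro mpolys_sum mpolys_mult mpolys_monom) auto
  define m where "m = Max (insert 0 ((\<lambda>u. Poly_Mapping.lookup u i) ` K))"
  have lem: "Poly_Mapping.lookup u i \<le> m" if "u \<in> K" for u
    unfolding m_def using that finK by (intro Max_ge) auto
  have evf: "eval_mpoly f x = (\<Sum>n\<le>m. eval_mpoly (g n) x * x i ^ n)" for x
  proof -
    have mon: "eval_mpoly (mmonom u) x = eval_mpoly (mmonom (?r u)) x * x i ^ Poly_Mapping.lookup u i"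
      if "u \<in> K" for u
    proof -
      have u: "Poly_Mapping.keys u \<subseteq> insert i I"
        using that insert.prems(1) unfolding K_def mpolys_def by blast
      have "eval_mpoly (mmonom u) x = (\<Prod>j\<in>insert i I. x j ^ Poly_Mapping.lookup u j)"
        using insert.hyps u by (intro eval_mmonom) auto
      moreover have "eval_mpoly (mmonom (?r u)) x = (\<Prod>j\<in>I. x j ^ Poly_Mapping.lookup (?r u) j)"
        using insert.hyps keysr[OF that] by (intro eval_mmonom) auto
      moreover have "(\<Prod>j\<in>I. x j ^ Poly_Mapping.lookup (?r u) j) = (\<Prod>j\<in>I. x j ^ Poly_Mapping.lookup u j)"
        using insert.hyps by (intro prod.cong refl) (auto simp: lookup_update)
      ultimately show ?thesis using insert.hyps by (simp add: mult.commute)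
    qed
    have "eval_mpoly f x = (\<Sum>u\<in>K. Poly_Mapping.lookup f u * eval_mpoly (mmonom u) x)"
      by (subst mpoly_sum_monom) (simp add: K_def)
    also have "\<dots> = (\<Sum>n\<le>m. \<Sum>u\<in>{u\<in>K. Poly_Mapping.lookup u i = n}.
        Poly_Mapping.lookup f u * eval_mpoly (mmonom u) x)"
      using finK lem by (intro sum.group[symmetric]) auto
    also have "\<dots> = (\<Sum>n\<le>m. eval_mpoly (g n) x * x i ^ n)"
      unfolding g_def by (intro sum.cong refl) (auto simp: sum_distrib_right mon mult.assoc intro!: sum.cong)
    finally show ?thesis .
  qed
  have g0: "g n = 0" if "n \<le> m" for n
  proof (rule insert.IH[OF gI])
    fix x :: "'i \<Rightarrow> nat"
    let ?p = "\<lambda>t. \<Sum>n\<le>m. eval_mpoly (g n) (\<lambda>i. of_nat (x i)) * t ^ n"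
    have "?p (of_nat k) = 0" for k
    proof -
      have "eval_mpoly (g n) (\<lambda>j. of_nat ((x(i := k)) j)) = eval_mpoly (g n) (\<lambda>i. of_nat (x i))" for n
        using insert.hyps by (intro eval_mpoly_cong[OF gI]) auto
      then show ?thesis
        using insert.prems(2)[of "x(i := k)"] unfolding evf by simp
    qed
    then have "range (of_nat :: nat \<Rightarrow> 'a) \<subseteq> {t. ?p t = 0}" by auto
    moreover have "infinite (range (of_nat :: nat \<Rightarrow> 'a))"
      by (simp add: range_inj_infinite inj_def)
    ultimately have "infinite {t. ?p t = 0}" using finite_subset by blast
    moreover define q where "q = (\<Sum>n\<le>m. monom (eval_mpoly (g n) (\<lambda>i. of_nat (x i))) n)"
    have "?p = poly q" by (rule ext) (simp add: q_def poly_sum poly_monom)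
    ultimately have "q = 0" using poly_roots_finite[of q] by metis
    then have "coeff q n = 0" by simp
    also have "coeff q n = eval_mpoly (g n) (\<lambda>i. of_nat (x i))"
      unfolding q_def coeff_sum using that by (simp add: sum.delta)
    finally show "eval_mpoly (g n) (\<lambda>i. of_nat (x i)) = 0" by simp
  qed
  have "Poly_Mapping.lookup f u = 0" for u
  proof (cases "u \<in> K")
    case True
    define n where "n = Poly_Mapping.lookup u i"
    \<comment> \<open>Monomials with equal exponent of \<open>i\<close> stay distinct when
      \<open>i\<close> is erased, so the coefficients of \<open>f\<close> can be read off
      \<open>g n\<close>.\<close>
    have inj: "inj_on ?r {u\<in>K. Poly_Mapping.lookup u i = n}"
    proof (rule inj_onI)
      fix a b assume ab: "a \<in> {u \<in> K. Poly_Mapping.lookup u i = n}"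
        "b \<in> {u \<in> K. Poly_Mapping.lookup u i = n}" "?r a = ?r b"
      have "Poly_Mapping.lookup a j = Poly_Mapping.lookup b j" for j
      proof -
        have "Poly_Mapping.lookup (?r a) j = Poly_Mapping.lookup (?r b) j" using ab(3) by simp
        then show ?thesis using ab(1,2) by (auto simp: lookup_update split: if_splits)
      qed
      then show "a = b" by (intro poly_mapping_eqI) auto
    qed
    have "0 = Poly_Mapping.lookup (g n) (?r u)"
      using g0[of n] lem[OF True] by (simp add: n_def)
    also have "\<dots> = (\<Sum>v\<in>{u\<in>K. Poly_Mapping.lookup u i = n}.
        if v = u then Poly_Mapping.lookup f v else 0)"
      unfolding g_def lookup_sum
    proof (intro sum.cong refl)
      fix v assume v: "v \<in> {u \<in> K. Poly_Mapping.lookup u i = n}"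
      have "?r v = ?r u \<longleftrightarrow> v = u"
        using inj_onD[OF inj _ v, of u] True n_def by auto
      then show "Poly_Mapping.lookup (mconst (Poly_Mapping.lookup f v) * mmonom (?r v)) (?r u) =
          (if v = u then Poly_Mapping.lookup f v else 0)"
        by (simp add: mconst_def mmonom_def mult_single lookup_single when_def)
    qed
    also have "\<dots> = Poly_Mapping.lookup f u"
      using finK True by (simp add: n_def)
    finally show ?thesis by simp
  qed (simp add: K_def in_keys_iff)
  then show ?case by (intro poly_mapping_eqI) simp
qed

lemma finite_vars: "\<exists>I. finite I \<and> f \<in> mpolys I"
  by (rule exI[of _ "\<Union>m\<in>Poly_Mapping.keys f. Poly_Mapping.keys m"]) (auto simp: mpolys_def)

lemma mpoly_nonzero_point:
  fixes f :: "('i, 'a::{idom, ring_char_0}) mpoly"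
  assumes "f \<noteq> 0"
  obtains x :: "'i \<Rightarrow> nat" where "eval_mpoly f (\<lambda>i. of_nat (x i)) \<noteq> 0"
  using mpoly_eq_0_if_eval_nat finite_vars assms by metis

lemma mpoly_eqI:
  fixes f :: "('i, 'a::{idom, ring_char_0}) mpoly"
  assumes "\<And>x. eval_mpoly f x = eval_mpoly g x"
  shows "f = g"
proof (rule ccontr)
  assume "f \<noteq> g"
  then obtain x :: "'i \<Rightarrow> nat" where "eval_mpoly (f - g) (\<lambda>i. of_nat (x i)) \<noteq> 0"
    using mpoly_nonzero_point[of "f - g"] by auto
  then show False using assms by simp
qed

text \<open>Restricting to the line through the two given points reduces this to univariate
  polynomials.\<close>

lemma polyf_common_nonzero:
  fixes f g :: "('i \<Rightarrow> 'a::{idom, ring_char_0}) \<Rightarrow> 'a"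
  assumes "polyf I f" "polyf I g" "f x \<noteq> 0" "g y \<noteq> 0"
  shows "\<exists>z. f z \<noteq> 0 \<and> g z \<noteq> 0"
proof -
  have line: "\<exists>q. \<forall>t. h (\<lambda>i. x i + t * (y i - x i)) = poly q t" if h: "polyf I h" for h :: "('i \<Rightarrow> 'a) \<Rightarrow> 'a"
  proof -
    obtain p where p: "h = eval_mpoly p" using h unfolding polyf_def by blast
    have "\<exists>q. \<forall>t. eval_mpoly p (\<lambda>i. x i + t * (y i - x i)) = poly q t"
    proof (induction p rule: mpoly_induct)
      case zero
      show ?case by (rule exI[of _ 0]) simp
    next
      case (add f m c)
      then obtain q where "\<forall>t. eval_mpoly f (\<lambda>i. x i + t * (y i - x i)) = poly q t" by blast
      then show ?case
        by (intro exI[of _ "q + [:c:] * (\<Prod>i\<in>Poly_Mapping.keys m. [:x i, y i - x i:] ^ Poly_Mapping.lookup m i)"])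
          (simp add: eval_mpoly_single poly_prod mult.commute)
    qed
    then show ?thesis using p by simp
  qed
  obtain p where p: "\<And>t. f (\<lambda>i. x i + t * (y i - x i)) = poly p t" using line[OF assms(1)] by blast
  obtain q where q: "\<And>t. g (\<lambda>i. x i + t * (y i - x i)) = poly q t" using line[OF assms(2)] by blast
  have "p \<noteq> 0" using p[of 0] assms(3) by auto
  moreover have "q \<noteq> 0" using q[of 1] assms(4) by auto
  ultimately have "finite {t. poly (p * q) t = 0}" by (intro poly_roots_finite) simp
  then obtain t where "poly (p * q) t \<noteq> 0"
    using infinite_UNIV_char_0[where 'a='a] by (metis (mono_tags, lifting) ex_new_if_finite mem_Collect_eq)
  then show ?thesis using p q by (metis mult_eq_0_iff poly_mult)
qed

lemma polyf_common_nonzero_finite: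
  fixes f :: "'j \<Rightarrow> ('i \<Rightarrow> 'a::{idom, ring_char_0}) \<Rightarrow> 'a"
  assumes "finite J" "\<And>j. j \<in> J \<Longrightarrow> polyf I (f j)" "\<And>j. j \<in> J \<Longrightarrow> \<exists>x. f j x \<noteq> 0"
  shows "\<exists>x. (\<Prod>j\<in>J. f j x) \<noteq> 0"
  using assms
proof (induction J rule: finite_induct)
  case (insert j J)
  then obtain x y where "(\<Prod>j\<in>J. f j x) \<noteq> 0" "f j y \<noteq> 0" by blast
  moreover have "polyf I (\<lambda>x. \<Prod>j\<in>J. f j x)" using insert by (intro polyf_intros) auto
  ultimately obtain z where "(\<Prod>j\<in>J. f j z) \<noteq> 0" "f j z \<noteq> 0"
    using polyf_common_nonzero[of I "\<lambda>x. \<Prod>j\<in>J. f j x" "f j" x y] insert.prems(1)[of j] by auto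
  then show ?case using insert.hyps by auto
qed auto

section \<open>Linear systems and the number of exponent vectors\<close>

lemma homogeneous_linear_system:
  fixes c :: "'a \<Rightarrow> 'b \<Rightarrow> 'k::field"
  assumes "finite B" "finite A" "card B < card A"
  shows "\<exists>z. (\<exists>a\<in>A. z a \<noteq> 0) \<and> (\<forall>b\<in>B. (\<Sum>a\<in>A. z a * c a b) = 0)"
  using assms
proof (induction B arbitrary: A c rule: finite_induct)
  case empty
  then have "A \<noteq> {}" by auto
  then show ?case by (intro exI[of _ "\<lambda>_. 1"]) auto
next
  case (insert b B)
  show ?case
  proof (cases "\<forall>a\<in>A. c a b = 0")
    case True
    obtain z where "\<exists>a\<in>A. z a \<noteq> 0" "\<forall>b\<in>B. (\<Sum>a\<in>A. z a * c a b) = 0"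
      using insert.IH[of A c] insert.prems insert.hyps by auto
    then show ?thesis using True by (intro exI[of _ z]) auto
  next
    case False
    then obtain a0 where a0: "a0 \<in> A" "c a0 b \<noteq> 0" by blast
    \<comment> \<open>Gaussian elimination: \<open>c'\<close> is the system with the unknown
      \<open>a0\<close> eliminated by equation \<open>b\<close>, which afterwards determines the
      value of \<open>z'\<close> at \<open>a0\<close>.\<close>
    define c' where "c' a b' = c a b' - c a b / c a0 b * c a0 b'" for a b'
    have "card B < card (A - {a0})" using insert.prems insert.hyps a0 by simp
    then obtain z where z: "\<exists>a\<in>A - {a0}. z a \<noteq> 0" "\<forall>b\<in>B. (\<Sum>a\<in>A - {a0}. z a * c' a b) = 0"
      using insert.IH[of "A - {a0}" c'] insert.prems(1) by auto
    define z' where "z' = z(a0 := - (\<Sum>a\<in>A - {a0}. z a * (c a b / c a0 b)))"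
    have split: "(\<Sum>a\<in>A. z' a * c a b') = (\<Sum>a\<in>A - {a0}. z a * c' a b')" for b'
    proof -
      have "(\<Sum>a\<in>A. z' a * c a b') = z' a0 * c a0 b' + (\<Sum>a\<in>A - {a0}. z a * c a b')"
        using insert.prems(1) a0(1) by (subst sum.remove) (auto simp: z'_def intro!: sum.cong)
      also have "\<dots> = (\<Sum>a\<in>A - {a0}. z a * c' a b')"
        by (simp add: z'_def c'_def algebra_simps sum_subtractf sum_distrib_left)
      finally show ?thesis .
    qed
    have "(\<Sum>a\<in>A. z' a * c a b) = 0"
      unfolding split c'_def using a0 by simp
    then have "\<forall>b'\<in>insert b B. (\<Sum>a\<in>A. z' a * c a b') = 0" using split z(2) by auto
    moreover have "\<exists>a\<in>A. z' a \<noteq> 0" using z(1) by (auto simp: z'_def)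
    ultimately show ?thesis by blast
  qed
qed

text \<open>Exponents are bounded one by one rather than in total, so that the number of monomials
  is exactly \<open>(N + 1) ^ card I\<close> and can be compared between different sets of
  variables.\<close>

definition expo_box :: "'i set \<Rightarrow> nat \<Rightarrow> ('i \<Rightarrow>\<^sub>0 nat) set" where
  "expo_box I N = {u. Poly_Mapping.keys u \<subseteq> I \<and> (\<forall>i. Poly_Mapping.lookup u i \<le> N)}"

lemma bij_betw_expos:
  assumes "finite I"
  shows "bij_betw (\<lambda>u. restrict (Poly_Mapping.lookup u) I)
    {u :: 'i \<Rightarrow>\<^sub>0 nat. Poly_Mapping.keys u \<subseteq> I \<and> (\<forall>i\<in>I. Poly_Mapping.lookup u i \<in> S i)} (PiE I S)"
proof (rule bij_betwI[where g = "\<lambda>a. Abs_poly_mapping (\<lambda>i. if i \<in> I then a i else 0)"])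
  have fin: "finite {i. (if i \<in> I then a i else 0) \<noteq> (0::nat)}" for a
    by (rule finite_subset[OF _ assms]) auto
  have lk: "Poly_Mapping.lookup (Abs_poly_mapping (\<lambda>i. if i \<in> I then a i else 0)) =
      (\<lambda>i. if i \<in> I then a i else (0::nat))" for a
    using fin by simp
  show "(\<lambda>u. restrict (Poly_Mapping.lookup u) I) \<in>
      {u. Poly_Mapping.keys u \<subseteq> I \<and> (\<forall>i\<in>I. Poly_Mapping.lookup u i \<in> S i)} \<rightarrow> PiE I S"
    by auto
  show "(\<lambda>a. Abs_poly_mapping (\<lambda>i. if i \<in> I then a i else 0)) \<in> PiE I S \<rightarrow>
      {u. Poly_Mapping.keys u \<subseteq> I \<and> (\<forall>i\<in>I. Poly_Mapping.lookup u i \<in> S i)}"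
  proof (intro funcsetI CollectI conjI ballI)
    fix a assume a: "a \<in> PiE I S"
    show "Poly_Mapping.keys (Abs_poly_mapping (\<lambda>i. if i \<in> I then a i else 0)) \<subseteq> I"
    proof
      fix t assume "t \<in> Poly_Mapping.keys (Abs_poly_mapping (\<lambda>i. if i \<in> I then a i else 0))"
      then show "t \<in> I" unfolding in_keys_iff lk by (simp split: if_splits)
    qed
    fix i assume "i \<in> I"
    then show "Poly_Mapping.lookup (Abs_poly_mapping (\<lambda>i. if i \<in> I then a i else 0)) i \<in> S i"
      using a unfolding lk by auto
  qed
  fix u assume "u \<in> {u. Poly_Mapping.keys u \<subseteq> I \<and> (\<forall>i\<in>I. Poly_Mapping.lookup u i \<in> S i)}"
  then show "Abs_poly_mapping (\<lambda>i. if i \<in> I then restrict (Poly_Mapping.lookup u) I i else 0) = u"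
    by (intro poly_mapping_eqI) (simp only: lk, auto simp: in_keys_iff)
next
  fix a assume "a \<in> PiE I S"
  moreover have "finite {i. (if i \<in> I then a i else 0) \<noteq> (0::nat)}"
    by (rule finite_subset[OF _ assms]) auto
  ultimately show "restrict (Poly_Mapping.lookup (Abs_poly_mapping (\<lambda>i. if i \<in> I then a i else 0))) I = a"
    by (auto simp: PiE_def extensional_def)
qed

lemma card_expos:
  assumes "finite I"
  shows "card {u :: 'i \<Rightarrow>\<^sub>0 nat. Poly_Mapping.keys u \<subseteq> I \<and> (\<forall>i\<in>I. Poly_Mapping.lookup u i \<in> S i)} = (\<Prod>i\<in>I. card (S i))"
  using bij_betw_same_card[OF bij_betw_expos[OF assms, of S]] card_PiE[OF assms] by simp

lemma finite_expos:
  assumes "finite I" "\<And>i. i \<in> I \<Longrightarrow> finite (S i)"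
  shows "finite {u :: 'i \<Rightarrow>\<^sub>0 nat. Poly_Mapping.keys u \<subseteq> I \<and> (\<forall>i\<in>I. Poly_Mapping.lookup u i \<in> S i)}"
  using bij_betw_finite[OF bij_betw_expos[OF assms(1), of S]] finite_PiE[OF assms] by simp

lemma expo_box_eq: "expo_box I N =
    {u. Poly_Mapping.keys u \<subseteq> I \<and> (\<forall>i\<in>I. Poly_Mapping.lookup u i \<in> {..N})}"
  by (auto simp: expo_box_def) (metis in_keys_iff le0 subsetD)

lemma card_expo_box: "finite I \<Longrightarrow> card (expo_box I N) = (N + 1) ^ card I"
  and finite_expo_box: "finite I \<Longrightarrow> finite (expo_box I N)"
  unfolding expo_box_eq using card_expos[of I "\<lambda>_. {..N}"] finite_expos[of I "\<lambda>_. {..N}"] by auto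

lemma expo_box_mono: "M \<le> N \<Longrightarrow> expo_box I M \<subseteq> expo_box I N"
  by (auto simp: expo_box_def intro: order_trans)

lemma expo_box_add: "u \<in> expo_box I M \<Longrightarrow> v \<in> expo_box I N \<Longrightarrow> u + v \<in> expo_box I (M + N)"
  using Poly_Mapping.keys_add[of u v] by (auto simp: expo_box_def lookup_add add_mono)

lemma mpolys_bounded:
  assumes "f \<in> mpolys I"
  shows "\<exists>N. Poly_Mapping.keys f \<subseteq> expo_box I N"
proof -
  define N where "N = Max (insert 0 (\<Union>u\<in>Poly_Mapping.keys f. Poly_Mapping.lookup u ` Poly_Mapping.keys u))"
  have "Poly_Mapping.lookup u i \<le> N" if "u \<in> Poly_Mapping.keys f" for u i
  proof (cases "i \<in> Poly_Mapping.keys u")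
    case True
    then show ?thesis unfolding N_def using that by (intro Max_ge) auto
  qed (simp add: in_keys_iff)
  then have "Poly_Mapping.keys f \<subseteq> expo_box I N"
    using assms by (auto simp: expo_box_def mpolys_def)
  then show ?thesis by blast
qed

lemma keys_mult_box:
  assumes "Poly_Mapping.keys f \<subseteq> expo_box I M" "Poly_Mapping.keys g \<subseteq> expo_box I N"
  shows "Poly_Mapping.keys (f * g) \<subseteq> expo_box I (M + N)"
  using assms by (auto elim!: keys_mult_mono intro: expo_box_add)

lemma keys_power_box:
  assumes "Poly_Mapping.keys f \<subseteq> expo_box I M"
  shows "Poly_Mapping.keys (f ^ k) \<subseteq> expo_box I (k * M)"
proof (induction k)
  case (Suc k)
  then show ?case using keys_mult_box[OF assms Suc] by simp
qed (auto simp: expo_box_def)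

lemma keys_prod_box:
  assumes "finite A" "\<And>a. a \<in> A \<Longrightarrow> Poly_Mapping.keys (f a) \<subseteq> expo_box I (M a)"
  shows "Poly_Mapping.keys (\<Prod>a\<in>A. f a) \<subseteq> expo_box I (\<Sum>a\<in>A. M a)"
  using assms
proof (induction A rule: finite_induct)
  case (insert a A)
  then show ?case using keys_mult_box[of "f a" I "M a" "prod f A" "sum M A"] by simp
qed (auto simp: expo_box_def)

lemma eval_keys_superset:
  assumes "finite A" "Poly_Mapping.keys f \<subseteq> A"
  shows "eval_mpoly f x = (\<Sum>u\<in>A. Poly_Mapping.lookup f u * eval_mpoly (mmonom u) x)"
  using eval_mpoly_superset[OF assms] by (simp add: mmonom_def eval_mpoly_single)

section \<open>Algebraic dependence by counting monomials\<close>

text \<open>Clearing denominators turns the products of at most \<open>N\<close>-th powers of the rational functions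
  \<open>P v / P0\<close> and of \<open>L\<close> into polynomials lying in a space whose dimension grows slower in \<open>N\<close> than
  their number. The lowest power of \<open>L\<close> in the resulting relation can be divided out, so that the
  relation survives on the hypersurface \<open>L = 0\<close>.\<close>

lemma algebraic_dependence_on_hypersurface:
  fixes P :: "'w \<Rightarrow> ('v, 'a::field_char_0) mpoly"
  assumes fin: "finite \<Gamma>" "finite V" and card: "card \<Gamma> \<le> card V"
    and P: "\<And>v. v \<in> V \<Longrightarrow> P v \<in> mpolys \<Gamma>" and P0: "P0 \<in> mpolys \<Gamma>"
    and L: "L \<in> mpolys \<Gamma>" "L \<noteq> 0"
  shows "\<exists>Q\<in>mpolys V. Q \<noteq> 0 \<and>
    (\<forall>y. eval_mpoly P0 y \<noteq> 0 \<longrightarrow> eval_mpoly L y = 0 \<longrightarrow>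
      eval_mpoly Q (\<lambda>v. eval_mpoly (P v) y / eval_mpoly P0 y) = 0)"
proof -
  obtain cP where cP: "\<And>v. v \<in> V \<Longrightarrow> Poly_Mapping.keys (P v) \<subseteq> expo_box \<Gamma> (cP v)"
    using mpolys_bounded[OF P] by metis
  obtain c0 where c0: "Poly_Mapping.keys P0 \<subseteq> expo_box \<Gamma> c0" using mpolys_bounded[OF P0] by blast
  obtain cL where cL: "Poly_Mapping.keys L \<subseteq> expo_box \<Gamma> cL" using mpolys_bounded[OF L(1)] by blast
  define c where "c = (\<Sum>v\<in>V. cP v) + c0 + cL"
  have cPc: "Poly_Mapping.keys (P v) \<subseteq> expo_box \<Gamma> c" if "v \<in> V" for v
  proof -
    have "cP v \<le> (\<Sum>v\<in>V. cP v)" using that fin by (intro member_le_sum) auto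
    then show ?thesis using cP[OF that] expo_box_mono[of "cP v" c \<Gamma>] by (auto simp: c_def)
  qed
  have c0c: "Poly_Mapping.keys P0 \<subseteq> expo_box \<Gamma> c" and cLc: "Poly_Mapping.keys L \<subseteq> expo_box \<Gamma> c"
    using c0 cL expo_box_mono[of c0 c \<Gamma>] expo_box_mono[of cL c \<Gamma>] by (auto simp: c_def)
  define K where "K = c * (card V + 1) + 1"
  define N where "N = K ^ card \<Gamma>"
  define A where "A = expo_box V N \<times> {..N}"
  define B where "B = expo_box \<Gamma> (c * (card V + 1) * N)"
  define deg where "deg a = (\<Sum>v\<in>V. Poly_Mapping.lookup a v)" for a :: "'w \<Rightarrow>\<^sub>0 nat"
  \<comment> \<open>The power of \<open>P0\<close> clears the denominators of the monomial
    \<open>a\<close> in the quotients \<open>P v / P0\<close>. All \<open>H a\<close> have the same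
    denominator exponent \<open>card V * N\<close>, so relations between them are relations between
    the monomials.\<close>
  define H where "H a = (\<Prod>v\<in>V. P v ^ Poly_Mapping.lookup a v) * P0 ^ (card V * N - deg a)" for a
  have degle: "deg a \<le> card V * N" if "a \<in> expo_box V N" for a
    unfolding deg_def using that sum_bounded_above[of V "Poly_Mapping.lookup a" N]
    by (auto simp: expo_box_def)
  have keysR: "Poly_Mapping.keys (L ^ i * H a) \<subseteq> B" if "a \<in> expo_box V N" "i \<le> N" for a i
  proof -
    have "Poly_Mapping.keys (L ^ i * H a) \<subseteq>
        expo_box \<Gamma> (i * c + ((\<Sum>v\<in>V. Poly_Mapping.lookup a v * c) + (card V * N - deg a) * c))"
      unfolding H_def
      by (intro keys_mult_box keys_power_box keys_prod_box fin cPc c0c cLc)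
    also have "i * c + ((\<Sum>v\<in>V. Poly_Mapping.lookup a v * c) + (card V * N - deg a) * c) =
        (i + (deg a + (card V * N - deg a))) * c"
      unfolding deg_def sum_distrib_right[symmetric] by (simp only: distrib_right add.assoc)
    also have "\<dots> \<le> ((card V + 1) * N) * c"
      using degle[OF that(1)] that(2) by (intro mult_right_mono) auto
    also have "\<dots> = c * (card V + 1) * N" by (simp only: mult_ac)
    finally show ?thesis using expo_box_mono unfolding B_def by blast
  qed
  have finA: "finite A" and finB: "finite B"
    using fin by (auto simp: A_def B_def finite_expo_box)
  have "card B < card A"
  proof -
    have "card B = (c * (card V + 1) * N + 1) ^ card \<Gamma>"
      using fin by (simp add: B_def card_expo_box)
    also have "\<dots> \<le> (K * (N + 1)) ^ card \<Gamma>"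
      by (intro power_mono) (auto simp: K_def algebra_simps)
    also have "\<dots> = N * (N + 1) ^ card \<Gamma>"
      by (simp only: power_mult_distrib N_def[symmetric])
    also have "\<dots> < (N + 1) * (N + 1) ^ card \<Gamma>" by simp
    also have "\<dots> \<le> (N + 1) * (N + 1) ^ card V"
      using card by (intro mult_left_mono power_increasing) auto
    also have "\<dots> = card A"
      unfolding A_def card_cartesian_product using fin by (simp add: card_expo_box)
    finally show ?thesis .
  qed
  then obtain z where z: "\<exists>a\<in>A. z a \<noteq> 0"
      "\<forall>b\<in>B. (\<Sum>a\<in>A. z a * Poly_Mapping.lookup (L ^ snd a * H (fst a)) b) = 0"
    using homogeneous_linear_system[OF finB finA,
        of "\<lambda>a. Poly_Mapping.lookup (L ^ snd a * H (fst a))"] by blast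
  define S where "S i = (\<Sum>a\<in>expo_box V N. mconst (z (a, i)) * H a)" for i
  define Q where "Q i = (\<Sum>a\<in>expo_box V N. mconst (z (a, i)) * mmonom a)" for i
  have evS0: "(\<Sum>i\<le>N. eval_mpoly L y ^ i * eval_mpoly (S i) y) = 0" for y
  proof -
    have "(\<Sum>i\<le>N. eval_mpoly L y ^ i * eval_mpoly (S i) y) =
        (\<Sum>(a, i)\<in>A. z (a, i) * eval_mpoly (L ^ i * H a) y)"
      unfolding A_def sum.cartesian_product[symmetric] S_def
      by (subst sum.swap) (simp add: sum_distrib_left mult_ac)
    also have "\<dots> = (\<Sum>(a, i)\<in>A. z (a, i) *
        (\<Sum>b\<in>B. Poly_Mapping.lookup (L ^ i * H a) b * eval_mpoly (mmonom b) y))"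
      using keysR by (intro sum.cong refl) (auto simp: A_def eval_keys_superset[OF finB, of "_ * _"] simp del: eval_mult)
    also have "\<dots> = (\<Sum>b\<in>B. (\<Sum>a\<in>A. z a * Poly_Mapping.lookup (L ^ snd a * H (fst a)) b) *
        eval_mpoly (mmonom b) y)"
      unfolding sum_distrib_left sum_distrib_right case_prod_unfold
      by (subst sum.swap) (simp add: mult_ac)
    also have "\<dots> = 0" using z(2) by simp
    finally show ?thesis .
  qed
  define i0 where "i0 = (LEAST i. i \<le> N \<and> (\<exists>a\<in>expo_box V N. z (a, i) \<noteq> 0))"
  have ex: "\<exists>i. i \<le> N \<and> (\<exists>a\<in>expo_box V N. z (a, i) \<noteq> 0)" using z(1) by (auto simp: A_def)
  have i0: "i0 \<le> N" "\<exists>a\<in>expo_box V N. z (a, i0) \<noteq> 0"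
    using LeastI_ex[OF ex] unfolding i0_def by auto
  have low: "S i = 0" if "i < i0" for i
    using not_less_Least[of i "\<lambda>i. i \<le> N \<and> (\<exists>a\<in>expo_box V N. z (a, i) \<noteq> 0)"] that i0(1)
    unfolding S_def i0_def by (intro sum.neutral) auto
  define S' where "S' = (\<Sum>i\<in>{i0..N}. L ^ (i - i0) * S i)"
  have HG: "H a \<in> mpolys \<Gamma>" for a
    unfolding H_def by (intro mpolys_mult mpolys_prod mpolys_power P P0)
  have S'G: "S' \<in> mpolys \<Gamma>"
    unfolding S'_def S_def using HG L(1)
    by (intro mpolys_sum mpolys_mult mpolys_power) auto
  have prod0: "eval_mpoly L y ^ i0 * eval_mpoly S' y = 0" for y
  proof -
    have "eval_mpoly L y ^ i0 * eval_mpoly S' y = (\<Sum>i\<in>{i0..N}. eval_mpoly L y ^ i * eval_mpoly (S i) y)"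
      unfolding S'_def by (auto simp: sum_distrib_left mult.assoc[symmetric] power_add[symmetric] intro!: sum.cong)
    also have "\<dots> = (\<Sum>i\<le>N. eval_mpoly L y ^ i * eval_mpoly (S i) y)"
      using low by (intro sum.mono_neutral_left) auto
    finally show ?thesis using evS0 by simp
  qed
  \<comment> \<open>\<open>S'\<close> vanishes wherever \<open>L\<close> does not; if both were
    nonzero functions, they would have a common nonvanishing point.\<close>
  have S'0: "eval_mpoly S' y = 0" for y
  proof (rule ccontr)
    assume y: "eval_mpoly S' y \<noteq> 0"
    obtain x :: "'v \<Rightarrow> nat" where "eval_mpoly L (\<lambda>i. of_nat (x i)) \<noteq> 0"
      using mpoly_nonzero_point[OF L(2)] .
    then show False
      using polyf_common_nonzero[OF polyf_eval[OF S'G] polyf_eval[OF L(1)] y] prod0 by auto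
  qed
  have "Q i0 \<noteq> 0"
  proof
    assume "Q i0 = 0"
    obtain a where a: "a \<in> expo_box V N" "z (a, i0) \<noteq> 0" using i0(2) by blast
    have "Poly_Mapping.lookup (Q i0) a = z (a, i0)"
      unfolding Q_def using a(1) fin(2) by (simp add: lookup_sum_monom finite_expo_box)
    then show False using a(2) \<open>Q i0 = 0\<close> by simp
  qed
  moreover have "Q i0 \<in> mpolys V"
    unfolding Q_def by (intro mpolys_sum mpolys_mult mpolys_monom) (auto simp: expo_box_def)
  moreover have "eval_mpoly (Q i0) (\<lambda>v. eval_mpoly (P v) y / eval_mpoly P0 y) = 0"
    if y: "eval_mpoly P0 y \<noteq> 0" "eval_mpoly L y = 0" for y
  proof -
    have H: "eval_mpoly (H a) y = eval_mpoly P0 y ^ (card V * N) *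
        eval_mpoly (mmonom a) (\<lambda>v. eval_mpoly (P v) y / eval_mpoly P0 y)"
      if "a \<in> expo_box V N" for a
    proof -
      have "Poly_Mapping.keys a \<subseteq> V" using that by (auto simp: expo_box_def)
      then have "eval_mpoly (mmonom a) (\<lambda>v. eval_mpoly (P v) y / eval_mpoly P0 y) =
          (\<Prod>v\<in>V. eval_mpoly (P v) y ^ Poly_Mapping.lookup a v) / eval_mpoly P0 y ^ deg a"
        by (simp add: eval_mmonom[OF fin(2)] power_divide prod_dividef deg_def power_sum)
      then show ?thesis using y(1) degle[OF that] by (simp add: H_def power_diff)
    qed
    have "0 = eval_mpoly S' y" using S'0 by simp
    also have "\<dots> = (\<Sum>i\<in>{i0..N}. if i = i0 then eval_mpoly (S i0) y else 0)"
      unfolding S'_def eval_sum using y(2) by (intro sum.cong refl) (auto simp: power_0_left)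
    also have "\<dots> = eval_mpoly (S i0) y" using i0(1) by simp
    also have "\<dots> = eval_mpoly P0 y ^ (card V * N) *
        eval_mpoly (Q i0) (\<lambda>v. eval_mpoly (P v) y / eval_mpoly P0 y)"
      unfolding S_def Q_def by (simp add: H sum_distrib_left mult_ac)
    finally show ?thesis using y(1) by simp
  qed
  ultimately show ?thesis by blast
qed

section \<open>Standard monomials\<close>

text \<open>Mixed radix notation: the weight of a new variable exceeds every value attained by the
  old ones on the box, so exponents are recovered by \<open>div\<close> and \<open>mod\<close>. The
  weights single out a leading monomial of each polynomial; being positive, they also bound the
  exponents.\<close>

lemma separating_weights:
  assumes "finite I"
  shows "\<exists>W :: 'i \<Rightarrow> nat. (\<forall>i\<in>I. 1 \<le> W i) \<and>
    inj_on (\<lambda>u. \<Sum>i\<in>I. Poly_Mapping.lookup u i * W i) (expo_box I N)"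
  using assms
proof (induction I rule: finite_induct)
  case empty
  have "expo_box {} N = {0::'i \<Rightarrow>\<^sub>0 nat}" by (auto simp: expo_box_def)
  then show ?case by simp
next
  case (insert i I)
  then obtain W where W: "\<forall>i\<in>I. 1 \<le> W i"
    "inj_on (\<lambda>u. \<Sum>i\<in>I. Poly_Mapping.lookup u i * W i) (expo_box I N)" by blast
  define w where "w = 1 + N * (\<Sum>i\<in>I. W i)"
  define W' where "W' = W(i := w)"
  have sumW': "(\<Sum>j\<in>insert i I. Poly_Mapping.lookup u j * W' j) =
      Poly_Mapping.lookup u i * w + (\<Sum>j\<in>I. Poly_Mapping.lookup u j * W j)" for u
    using insert.hyps by (auto simp: W'_def intro!: sum.cong)
  have small: "(\<Sum>j\<in>I. Poly_Mapping.lookup u j * W j) < w" if "u \<in> expo_box (insert i I) N" for u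
  proof -
    have "(\<Sum>j\<in>I. Poly_Mapping.lookup u j * W j) \<le> (\<Sum>j\<in>I. N * W j)"
      using that by (intro sum_mono mult_right_mono) (auto simp: expo_box_def)
    then show ?thesis by (simp add: w_def sum_distrib_left)
  qed
  have "inj_on (\<lambda>u. \<Sum>j\<in>insert i I. Poly_Mapping.lookup u j * W' j) (expo_box (insert i I) N)"
  proof (rule inj_onI)
    fix u v assume uv: "u \<in> expo_box (insert i I) N" "v \<in> expo_box (insert i I) N"
      "(\<Sum>j\<in>insert i I. Poly_Mapping.lookup u j * W' j) = (\<Sum>j\<in>insert i I. Poly_Mapping.lookup v j * W' j)"
    have lk: "Poly_Mapping.lookup x i = (\<Sum>j\<in>insert i I. Poly_Mapping.lookup x j * W' j) div w"
      and rs: "(\<Sum>j\<in>I. Poly_Mapping.lookup x j * W j) = (\<Sum>j\<in>insert i I. Poly_Mapping.lookup x j * W' j) mod w"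
      if "x \<in> expo_box (insert i I) N" for x
      unfolding sumW' using small[OF that] by auto
    have i: "Poly_Mapping.lookup u i = Poly_Mapping.lookup v i" using lk uv by metis
    have s: "(\<Sum>j\<in>I. Poly_Mapping.lookup u j * W j) = (\<Sum>j\<in>I. Poly_Mapping.lookup v j * W j)"
      using rs uv by metis
    have upd: "(\<Sum>j\<in>I. Poly_Mapping.lookup (Poly_Mapping.update i 0 x) j * W j) = (\<Sum>j\<in>I. Poly_Mapping.lookup x j * W j)" for x
      using insert.hyps by (intro sum.cong refl) (auto simp: lookup_update)
    have box: "Poly_Mapping.update i 0 x \<in> expo_box I N" if x: "x \<in> expo_box (insert i I) N" for x
    proof -
      have "j \<in> I" if "j \<in> Poly_Mapping.keys (Poly_Mapping.update i 0 x)" for j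
        using x that by (auto simp: expo_box_def in_keys_iff lookup_update subset_iff split: if_splits)
      then show ?thesis using x by (auto simp: expo_box_def lookup_update)
    qed
    have "Poly_Mapping.update i 0 u = Poly_Mapping.update i 0 v"
      using inj_onD[OF W(2) _ box[OF uv(1)] box[OF uv(2)]] s by (simp add: upd)
    then have e: "Poly_Mapping.lookup (Poly_Mapping.update i 0 u) j =
        Poly_Mapping.lookup (Poly_Mapping.update i 0 v) j" for j by simp
    have "Poly_Mapping.lookup u j = Poly_Mapping.lookup v j" for j
      using e[of j] i by (cases "j = i") (auto simp: lookup_update)
    then show "u = v" by (intro poly_mapping_eqI)
  qed
  moreover have "\<forall>j\<in>insert i I. 1 \<le> W' j" using W(1) by (auto simp: W'_def w_def)
  ultimately show ?case by blast
qed

global_interpretation mpoly_vs: vector_space "\<lambda>c (p :: ('i, 'a::field) mpoly). mconst c * p"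
  by unfold_locales (auto simp: algebra_simps mconst_add mconst_mult)

text \<open>Subspaces of this module are the ideals, and \<open>mpoly_ideal.span\<close> is the
  generated ideal; \<open>mpoly_vs\<close> treats the same ring as a vector space over the
  constants.\<close>

global_interpretation mpoly_ideal: module "(*) :: ('i, 'a::comm_ring_1) mpoly \<Rightarrow> _"
  by unfold_locales (auto simp: algebra_simps)

declare mpoly_vs.scale_scale [simp del] mpoly_ideal.scale_scale [simp del]

text \<open>If at least \<open>r\<close> exponents of a monomial exceed \<open>N\<close>, it is
  divisible by the leading monomial of some \<open>Q T\<close> and can be rewritten by monomials of
  lower weight. The remaining monomials have at most \<open>r - 1\<close> large exponents, which
  gives the growth rate \<open>n ^ (r - 1)\<close>.\<close>

lemma standard_monomials_span:
  fixes Q :: "'i set \<Rightarrow> ('i, 'a::field) mpoly"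
  assumes fin: "finite I" and r: "1 \<le> r"
    and Q: "\<And>T. T \<subseteq> I \<Longrightarrow> card T = r \<Longrightarrow> Q T \<in> mpolys T \<and> Q T \<noteq> 0"
  shows "\<exists>\<kappa>. \<forall>n. \<exists>S. finite S \<and> card S \<le> \<kappa> * (n + 1) ^ (r - 1) \<and>
    (\<forall>u. Poly_Mapping.keys u \<subseteq> I \<longrightarrow> monom_degree u \<le> n \<longrightarrow>
      (\<exists>s\<in>mpoly_vs.span S. mmonom u - s \<in> mpoly_ideal.span (Q ` {T. T \<subseteq> I \<and> card T = r})))"
proof -
  define \<T> where "\<T> = {T. T \<subseteq> I \<and> card T = r}"
  have fin\<T>: "finite \<T>" unfolding \<T>_def using fin by simp
  have "\<exists>N. \<forall>T\<in>\<T>. Poly_Mapping.keys (Q T) \<subseteq> expo_box T N"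
  proof -
    have "\<exists>N. Poly_Mapping.keys (Q T) \<subseteq> expo_box T N" if "T \<in> \<T>" for T
      using mpolys_bounded[of "Q T" T] Q[of T] that by (auto simp: \<T>_def)
    then obtain f where f: "\<And>T. T \<in> \<T> \<Longrightarrow> Poly_Mapping.keys (Q T) \<subseteq> expo_box T (f T)" by metis
    have "f T \<le> (\<Sum>T\<in>\<T>. f T)" if "T \<in> \<T>" for T
      using that fin\<T> by (intro member_le_sum) auto
    then have "Poly_Mapping.keys (Q T) \<subseteq> expo_box T (\<Sum>T\<in>\<T>. f T)" if "T \<in> \<T>" for T
      using f[OF that] expo_box_mono that by blast
    then show ?thesis by blast
  qed
  then obtain N where N: "\<And>T. T \<in> \<T> \<Longrightarrow> Poly_Mapping.keys (Q T) \<subseteq> expo_box T N" by blast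
  obtain W where W: "\<And>i. i \<in> I \<Longrightarrow> 1 \<le> W i"
    and inj: "inj_on (\<lambda>u. \<Sum>i\<in>I. Poly_Mapping.lookup u i * W i) (expo_box I N)"
    using separating_weights[OF fin, of N] by blast
  define wt where "wt u = (\<Sum>i\<in>I. Poly_Mapping.lookup u i * W i)" for u
  have wt_add: "wt (u + v) = wt u + wt v" for u v
    by (simp add: wt_def lookup_add algebra_simps sum.distrib)
  have boxTI: "expo_box T N \<subseteq> expo_box I N" if "T \<in> \<T>" for T
    using that by (auto simp: expo_box_def \<T>_def)
  have "\<exists>a\<in>Poly_Mapping.keys (Q T). \<forall>u\<in>Poly_Mapping.keys (Q T) - {a}. wt u < wt a" if T: "T \<in> \<T>" for T
  proof -
    have ne: "Poly_Mapping.keys (Q T) \<noteq> {}" using Q[of T] T by (auto simp: \<T>_def)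
    obtain a where a: "a \<in> Poly_Mapping.keys (Q T)" "\<And>u. u \<in> Poly_Mapping.keys (Q T) \<Longrightarrow> wt u \<le> wt a"
    proof -
      have "Max (wt ` Poly_Mapping.keys (Q T)) \<in> wt ` Poly_Mapping.keys (Q T)"
        using ne by (intro Max_in) auto
      then obtain a where "a \<in> Poly_Mapping.keys (Q T)" "Max (wt ` Poly_Mapping.keys (Q T)) = wt a" by blast
      then show ?thesis
        using Max_ge[of "wt ` Poly_Mapping.keys (Q T)"] by (intro that[of a]) force+
    qed
    have "wt u \<noteq> wt a" if "u \<in> Poly_Mapping.keys (Q T) - {a}" for u
      using inj_onD[OF inj, of u a] that a(1) N[OF T] boxTI[OF T] unfolding wt_def by blast
    then show ?thesis using a by (metis Diff_iff le_neq_implies_less)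
  qed
  then obtain a where a: "\<And>T. T \<in> \<T> \<Longrightarrow> a T \<in> Poly_Mapping.keys (Q T)"
    "\<And>T u. T \<in> \<T> \<Longrightarrow> u \<in> Poly_Mapping.keys (Q T) - {a T} \<Longrightarrow> wt u < wt (a T)" by metis
  \<comment> \<open>The size is bounded by weight, not by degree: rewriting lowers the weight but
    may raise the degree.\<close>
  define Std where "Std M = {u. Poly_Mapping.keys u \<subseteq> I \<and> card {i\<in>I. N < Poly_Mapping.lookup u i} < r \<and> wt u \<le> M}" for M
  have reduce: "\<exists>s\<in>mpoly_vs.span (mmonom ` Std M). mmonom u - s \<in> mpoly_ideal.span (Q ` \<T>)"
    if "Poly_Mapping.keys u \<subseteq> I" "wt u \<le> M" for u M
    using that
  proof (induction "wt u" arbitrary: u rule: less_induct)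
    case less
    show ?case
    proof (cases "card {i\<in>I. N < Poly_Mapping.lookup u i} < r")
      case True
      then have "mmonom u \<in> mpoly_vs.span (mmonom ` Std M)"
        using less.prems by (intro mpoly_vs.span_base) (auto simp: Std_def)
      then show ?thesis by (metis cancel_comm_monoid_add_class.diff_cancel mpoly_ideal.span_zero)
    next
      case False
      then obtain T where T: "T \<subseteq> {i\<in>I. N < Poly_Mapping.lookup u i}" "card T = r"
        using obtain_subset_with_card_n[of r "{i\<in>I. N < Poly_Mapping.lookup u i}"] by auto
      then have TT: "T \<in> \<T>" by (auto simp: \<T>_def)
      define u' where "u' = u - a T"
      have le: "Poly_Mapping.lookup (a T) i \<le> Poly_Mapping.lookup u i" for i
      proof (cases "i \<in> T")
        case True
        then show ?thesis
          using T(1) a(1)[OF TT] N[OF TT] by (force simp: expo_box_def intro: order_trans[of _ N])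
      next
        case False
        then have "Poly_Mapping.lookup (a T) i = 0"
          using subsetD[OF N[OF TT] a(1)[OF TT]] unfolding expo_box_def
          by (metis (no_types, lifting) CollectD in_keys_iff subsetD)
        then show ?thesis by simp
      qed
      have u: "u = u' + a T"
        using le by (intro poly_mapping_eqI) (simp add: u'_def lookup_add lookup_minus)
      have u'I: "Poly_Mapping.keys u' \<subseteq> I"
        using less.prems(1) by (auto simp: u'_def in_keys_iff lookup_minus)
      define c where "c v = Poly_Mapping.lookup (Q T) v" for v
      have c0: "c (a T) \<noteq> 0" using a(1)[OF TT] by (auto simp: c_def in_keys_iff)
      define K where "K = Poly_Mapping.keys (Q T) - {a T}"
      have "\<exists>s. s \<in> mpoly_vs.span (mmonom ` Std M) \<and> mmonom (u' + v) - s \<in> mpoly_ideal.span (Q ` \<T>)"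
        if "v \<in> K" for v
      proof -
        have lt: "wt (u' + v) < wt u" using a(2)[OF TT, of v] that by (simp add: u wt_add K_def)
        have "Poly_Mapping.keys v \<subseteq> I"
          using that N[OF TT] TT by (auto simp: K_def expo_box_def \<T>_def)
        then have "Poly_Mapping.keys (u' + v) \<subseteq> I"
          using Poly_Mapping.keys_add[of u' v] u'I by blast
        then show ?thesis using less.hyps[OF lt] lt less.prems(2) by auto
      qed
      then obtain s where s: "\<And>v. v \<in> K \<Longrightarrow> s v \<in> mpoly_vs.span (mmonom ` Std M)"
        "\<And>v. v \<in> K \<Longrightarrow> mmonom (u' + v) - s v \<in> mpoly_ideal.span (Q ` \<T>)" by metis
      define s' where "s' = (\<Sum>v\<in>K. mconst (- c v / c (a T)) * s v)"
      have s'in: "s' \<in> mpoly_vs.span (mmonom ` Std M)"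
        unfolding s'_def by (intro mpoly_vs.span_sum mpoly_vs.span_scale s)
      have QT: "Q T = mconst (c (a T)) * mmonom (a T) + (\<Sum>v\<in>K. mconst (c v) * mmonom v)"
      proof -
        have "Q T = (\<Sum>v\<in>Poly_Mapping.keys (Q T). mconst (c v) * mmonom v)"
          unfolding c_def by (rule mpoly_sum_monom)
        also have "\<dots> = mconst (c (a T)) * mmonom (a T) + (\<Sum>v\<in>K. mconst (c v) * mmonom v)"
          unfolding K_def using a(1)[OF TT] by (intro sum.remove) auto
        finally show ?thesis .
      qed
      have inv: "mconst (1 / c (a T)) * mconst (c v) = mconst (c v / c (a T))" for v
        by (simp add: mconst_mult[symmetric])
      have "mmonom u = mconst (1 / c (a T)) * mmonom u' * Q T - (\<Sum>v\<in>K. mconst (c v / c (a T)) * mmonom (u' + v))"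
      proof -
        have "mconst (1 / c (a T)) * mmonom u' * Q T =
            (mconst (1 / c (a T)) * mconst (c (a T))) * mmonom (u' + a T) +
            (\<Sum>v\<in>K. (mconst (1 / c (a T)) * mconst (c v)) * mmonom (u' + v))"
        proof -
          have "mconst (1 / c (a T)) * mmonom u' * Q T =
              mconst (1 / c (a T)) * mmonom u' * (mconst (c (a T)) * mmonom (a T)) +
              (\<Sum>v\<in>K. mconst (1 / c (a T)) * mmonom u' * (mconst (c v) * mmonom v))"
            by (subst QT) (simp only: distrib_left sum_distrib_left)
          then show ?thesis by (simp only: mmonom_add mult_ac)
        qed
        then show ?thesis unfolding inv using c0 by (simp add: u)
      qed
      moreover have neg: "mconst (- c v / c (a T)) = - mconst (c v / c (a T))" for v
        by (simp add: mconst_def single_uminus)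
      ultimately have "mmonom u - s' = mconst (1 / c (a T)) * mmonom u' * Q T +
          (\<Sum>v\<in>K. mconst (- c v / c (a T)) * (mmonom (u' + v) - s v))"
        by (simp add: s'_def neg right_diff_distrib sum_subtractf sum_negf)
      also have "\<dots> \<in> mpoly_ideal.span (Q ` \<T>)"
        using TT by (intro mpoly_ideal.span_add mpoly_ideal.span_sum mpoly_ideal.span_scale s(2)
            mpoly_ideal.span_base imageI)
      finally show ?thesis using s'in by blast
    qed
  qed
  \<comment> \<open>A monomial of degree at most \<open>n\<close> has weight at most
    \<open>\<omega> * n\<close>. In \<open>\<kappa>\<close>, the factor \<open>2 ^ card I\<close>
    counts the possible sets of large exponents and \<open>(N + 1) ^ card I\<close> bounds the
    choices for the small ones.\<close>
  define \<omega> where "\<omega> = (\<Sum>i\<in>I. W i)"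
  define \<kappa> where "\<kappa> = 2 ^ card I * ((N + 1) ^ card I * (\<omega> + 1) ^ (r - 1))"
  have cardStd: "finite (Std M) \<and> card (Std M) \<le> 2 ^ card I * ((N + 1) ^ card I * (M + 1) ^ (r - 1))" for M
  proof -
    define E where "E T = {u :: 'i \<Rightarrow>\<^sub>0 nat. Poly_Mapping.keys u \<subseteq> I \<and>
        (\<forall>i\<in>I. Poly_Mapping.lookup u i \<in> (if i \<in> T then {..M} else {..N}))}" for T
    define \<R> where "\<R> = {T. T \<subseteq> I \<and> card T < r}"
    have fin\<R>: "finite \<R>" using fin by (simp add: \<R>_def)
    have finE: "finite (E T)" for T unfolding E_def using fin by (intro finite_expos) auto
    have cE: "card (E T) \<le> (N + 1) ^ card I * (M + 1) ^ (r - 1)" if "T \<in> \<R>" for T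
    proof -
      have "card (E T) = (\<Prod>i\<in>I. if i \<in> T then M + 1 else N + 1)"
        unfolding E_def card_expos[OF fin] by (intro prod.cong) auto
      also have "\<dots> = (M + 1) ^ card (I \<inter> T) * (N + 1) ^ card (I - T)"
        using fin by (simp add: prod.If_cases Int_def Diff_eq Compl_eq)
      also have "\<dots> \<le> (M + 1) ^ (r - 1) * (N + 1) ^ card I"
        using that fin by (intro mult_mono power_increasing card_mono)
          (auto simp: \<R>_def Int_absorb1)
      finally show ?thesis by (simp add: mult.commute)
    qed
    have sub: "Std M \<subseteq> (\<Union>T\<in>\<R>. E T)"
    proof
      fix u assume u: "u \<in> Std M"
      define T where "T = {i\<in>I. N < Poly_Mapping.lookup u i}"
      have "Poly_Mapping.lookup u i \<le> M" if "i \<in> I" for i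
      proof -
        have "Poly_Mapping.lookup u i \<le> Poly_Mapping.lookup u i * W i" using W[OF that] by simp
        also have "\<dots> \<le> wt u" unfolding wt_def using that fin by (intro member_le_sum) auto
        finally show ?thesis using u by (simp add: Std_def)
      qed
      then have "u \<in> E T" "T \<in> \<R>" using u by (auto simp: E_def \<R>_def T_def Std_def)
      then show "u \<in> (\<Union>T\<in>\<R>. E T)" by blast
    qed
    have "card (Std M) \<le> card (\<Union>T\<in>\<R>. E T)"
      using sub finE fin\<R> by (intro card_mono) auto
    also have "\<dots> \<le> (\<Sum>T\<in>\<R>. card (E T))" using fin\<R> by (rule card_UN_le)
    also have "\<dots> \<le> card \<R> * ((N + 1) ^ card I * (M + 1) ^ (r - 1))"
      using sum_bounded_above[of \<R> "\<lambda>T. card (E T)"] cE by simp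
    also have "\<dots> \<le> 2 ^ card I * ((N + 1) ^ card I * (M + 1) ^ (r - 1))"
      using card_mono[of "Pow I" \<R>] fin by (intro mult_right_mono) (auto simp: \<R>_def card_Pow)
    finally show ?thesis using sub finE fin\<R> by (meson finite_UN finite_subset)
  qed
  show ?thesis
  proof (intro exI[of _ \<kappa>] allI)
    fix n
    let ?S = "mmonom ` Std (\<omega> * n) :: ('i, 'a) mpoly set"
    have "card ?S \<le> card (Std (\<omega> * n))" using cardStd by (intro card_image_le) auto
    also have "\<dots> \<le> 2 ^ card I * ((N + 1) ^ card I * (\<omega> * n + 1) ^ (r - 1))" using cardStd by blast
    also have "\<dots> \<le> 2 ^ card I * ((N + 1) ^ card I * ((\<omega> + 1) * (n + 1)) ^ (r - 1))"
      by (intro mult_left_mono power_mono) auto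
    also have "\<dots> = \<kappa> * (n + 1) ^ (r - 1)"
      unfolding power_mult_distrib by (simp add: \<kappa>_def mult_ac)
    finally have "card ?S \<le> \<kappa> * (n + 1) ^ (r - 1)" .
    moreover have "wt u \<le> \<omega> * n" if "Poly_Mapping.keys u \<subseteq> I" "monom_degree u \<le> n" for u
    proof -
      have "wt u \<le> (\<Sum>i\<in>I. Poly_Mapping.lookup u i * \<omega>)"
        unfolding wt_def \<omega>_def using fin by (intro sum_mono mult_left_mono member_le_sum) auto
      also have "\<dots> = (\<Sum>i\<in>Poly_Mapping.keys u. Poly_Mapping.lookup u i * \<omega>)"
        using that fin by (intro sum.mono_neutral_right) (auto simp: in_keys_iff)
      also have "\<dots> \<le> n * \<omega>"
        using that(2) by (simp add: monom_degree_def sum_distrib_right[symmetric])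
      finally show ?thesis by (simp add: mult.commute)
    qed
    ultimately show "\<exists>S. finite S \<and> card S \<le> \<kappa> * (n + 1) ^ (r - 1) \<and>
        (\<forall>u. Poly_Mapping.keys u \<subseteq> I \<longrightarrow> monom_degree u \<le> n \<longrightarrow>
          (\<exists>s\<in>mpoly_vs.span S. mmonom u - s \<in> mpoly_ideal.span (Q ` {T. T \<subseteq> I \<and> card T = r})))"
      using reduce cardStd unfolding \<T>_def by (intro exI[of _ ?S]) auto
  qed
qed

section \<open>The Nullstellensatz\<close>

lemma countable_expos: "countable (UNIV :: ('i::countable \<Rightarrow>\<^sub>0 nat) set)"
proof -
  let ?g = "\<lambda>m :: 'i \<Rightarrow>\<^sub>0 nat. (\<lambda>i. (i, Poly_Mapping.lookup m i)) ` Poly_Mapping.keys m"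
  have "inj ?g"
  proof (rule injI)
    fix m m' assume eq: "?g m = ?g m'"
    have sub: "Poly_Mapping.lookup a i = Poly_Mapping.lookup b i" if "?g a = ?g b" "i \<in> Poly_Mapping.keys a" for a b i
    proof -
      have "(i, Poly_Mapping.lookup a i) \<in> ?g b" using that by blast
      then show ?thesis by auto
    qed
    have "Poly_Mapping.lookup m i = Poly_Mapping.lookup m' i" for i
      using sub[OF eq] sub[OF eq[symmetric]] by (metis in_keys_iff)
    then show "m = m'" by (rule poly_mapping_eqI)
  qed
  moreover have "countable (range ?g)"
    by (rule countable_subset[OF _ countable_Collect_finite]) auto
  ultimately show ?thesis using countable_image_inj_eq by blast
qed

lemma uncountable_fibre:
  assumes "uncountable Z" "countable B" "f ` Z \<subseteq> B"
  shows "\<exists>b. infinite {c\<in>Z. f c = b}"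
proof (rule ccontr)
  assume "\<not> ?thesis"
  then have "countable (\<Union>b\<in>B. {c\<in>Z. f c = b})"
    using assms(2) by (intro countable_UN) (auto simp: countable_finite)
  moreover have "Z \<subseteq> (\<Union>b\<in>B. {c\<in>Z. f c = b})" using assms(3) by auto
  ultimately show False using assms(1) countable_subset by blast
qed

lemma mpoly_as_ring_generated:
  fixes f :: "('i, 'a::{idom, ring_char_0}) mpoly"
  assumes "\<And>c. P (mconst c)" "\<And>i. P (mvar i)" "\<And>f g. P f \<Longrightarrow> P g \<Longrightarrow> P (f + g)"
    "\<And>f g. P f \<Longrightarrow> P g \<Longrightarrow> P (f * g)"
  shows "P f"
proof (induction f rule: mpoly_induct)
  case zero
  show ?case using assms(1)[of 0] by simp
next
  case (add f m c)
  have pow: "P (mvar i ^ k)" for i k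
    using assms(1)[of 1] assms(2,4) by (induction k) auto
  have "P (\<Prod>i\<in>A. mvar i ^ Poly_Mapping.lookup m i)" for A
    using assms(1)[of 1] assms(4) pow by (induction A rule: infinite_finite_induct) auto
  moreover have "Poly_Mapping.single m c = mconst c * (\<Prod>i\<in>Poly_Mapping.keys m. mvar i ^ Poly_Mapping.lookup m i)"
    by (rule mpoly_eqI) (simp add: eval_mpoly_single)
  ultimately show ?case using assms(1,3,4) add by metis
qed

text \<open>For an ideal \<open>P\<close> maximal among those containing \<open>F\<close> but no power of \<open>h\<close>, and a variable
  \<open>x\<close>, suppose that no \<open>x - c\<close> lies in \<open>P\<close>. Then for every \<open>c\<close> some power of \<open>h\<close> is congruent to a
  multiple \<open>u c * (x - c)\<close>. Since the polynomial ring has countable dimension, the \<open>u c\<close> are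
  linearly dependent, which yields a nonzero univariate polynomial in \<open>x\<close> lying in \<open>P\<close>.\<close>

lemma nullstellensatz:
  fixes F :: "('i::countable, complex) mpoly set"
  assumes zeros: "\<And>y. (\<forall>f\<in>F. eval_mpoly f y = 0) \<Longrightarrow> eval_mpoly h y = 0"
  shows "\<exists>k. h ^ k \<in> mpoly_ideal.span F"
proof (rule ccontr)
  assume no_power: "\<not> (\<exists>k. h ^ k \<in> mpoly_ideal.span F)"
  define \<P> where "\<P> = {P. mpoly_ideal.subspace P \<and> F \<subseteq> P \<and> (\<forall>k. h ^ k \<notin> P)}"
  have "mpoly_ideal.span F \<in> \<P>"
    using no_power by (auto simp: \<P>_def mpoly_ideal.span_base)
  moreover have "\<Union>C \<in> \<P>" if C: "C \<noteq> {}" "subset.chain \<P> C" for C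
  proof -
    have sub: "C \<subseteq> \<P>" and ch: "\<And>X Y. X \<in> C \<Longrightarrow> Y \<in> C \<Longrightarrow> X \<subseteq> Y \<or> Y \<subseteq> X"
      using C(2) by (auto simp: subset.chain_def)
    have ss: "mpoly_ideal.subspace X" if "X \<in> C" for X using that sub by (auto simp: \<P>_def)
    have "mpoly_ideal.subspace (\<Union>C)"
    proof (rule mpoly_ideal.subspaceI)
      show "0 \<in> \<Union>C" using C(1) ss mpoly_ideal.subspace_0 by blast
      show "x + y \<in> \<Union>C" if xy: "x \<in> \<Union>C" "y \<in> \<Union>C" for x y
      proof -
        obtain X Y where XY: "X \<in> C" "Y \<in> C" "x \<in> X" "y \<in> Y" using xy by blast
        then show ?thesis using ch[of X Y] ss mpoly_ideal.subspace_add by (metis UnionI subsetD)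
      qed
      show "c * x \<in> \<Union>C" if "x \<in> \<Union>C" for c x
        using that ss mpoly_ideal.subspace_scale by blast
    qed
    then show ?thesis using sub C(1) by (auto simp: \<P>_def)
  qed
  ultimately obtain P where P: "P \<in> \<P>" and max: "\<And>X. X \<in> \<P> \<Longrightarrow> P \<subseteq> X \<Longrightarrow> X = P"
    using subset_Zorn_nonempty[of \<P>] by blast
  have Ps: "mpoly_ideal.subspace P" and FP: "F \<subseteq> P" and hP: "\<And>k. h ^ k \<notin> P"
    using P by (auto simp: \<P>_def)
  note P_add = mpoly_ideal.subspace_add[OF Ps] and P_diff = mpoly_ideal.subspace_diff[OF Ps]
    and P_mult = mpoly_ideal.subspace_scale[OF Ps] and P_sum = mpoly_ideal.subspace_sum[OF Ps]
  have one: "1 \<notin> P" using hP[of 0] by simp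
  have power: "\<exists>k u. h ^ k - u * q \<in> P" if "q \<notin> P" for q
  proof -
    have sp: "mpoly_ideal.span P = P" using Ps by simp
    have "P \<subseteq> mpoly_ideal.span (insert q P)" "q \<in> mpoly_ideal.span (insert q P)"
      using mpoly_ideal.span_superset[of "insert q P"] by auto
    then have "mpoly_ideal.span (insert q P) \<notin> \<P>" using max that by blast
    then have "\<exists>k. h ^ k \<in> mpoly_ideal.span (insert q P)"
      using FP \<open>P \<subseteq> mpoly_ideal.span (insert q P)\<close> by (auto simp: \<P>_def)
    then show ?thesis unfolding mpoly_ideal.span_insert sp by blast
  qed
  have prime: "q1 \<in> P \<or> q2 \<in> P" if "q1 * q2 \<in> P" for q1 q2
  proof (rule ccontr)
    assume "\<not> ?thesis"
    then obtain k1 u1 k2 u2 where ku: "h ^ k1 - u1 * q1 \<in> P" "h ^ k2 - u2 * q2 \<in> P"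
      using power by metis
    have "h ^ k1 * (h ^ k2 - u2 * q2) + u2 * q2 * (h ^ k1 - u1 * q1) + u1 * u2 * (q1 * q2) \<in> P"
      by (rule P_add[OF P_add[OF P_mult[OF ku(2)] P_mult[OF ku(1)]] P_mult[OF that]])
    also have "h ^ k1 * (h ^ k2 - u2 * q2) + u2 * q2 * (h ^ k1 - u1 * q1) + u1 * u2 * (q1 * q2) = h ^ (k1 + k2)"
      by (simp add: algebra_simps power_add)
    finally show False using hP by blast
  qed
  have "\<exists>c. mvar i - mconst c \<in> P" for i
  proof (rule ccontr)
    define l where "l c = mvar i - mconst c" for c :: complex
    assume "\<not> ?thesis"
    then have lP: "l c \<notin> P" for c by (auto simp: l_def)
    have "\<forall>c. \<exists>p. h ^ fst p - snd p * l c \<in> P" using power[OF lP] by auto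
    then obtain p where p: "\<And>c. h ^ fst (p c) - snd (p c) * l c \<in> P" by metis
    define k u where "k = fst \<circ> p" and "u = snd \<circ> p"
    have ku: "h ^ k c - u c * l c \<in> P" for c using p by (simp add: k_def u_def)
    \<comment> \<open>Pigeonhole: there are uncountably many \<open>c\<close> but only countably
      many pairs of an exponent and a finite support. Hence infinitely many \<open>u c\<close> share
      the exponent \<open>K\<close> and lie in the finite-dimensional space of polynomials with
      support \<open>B\<close>.\<close>
    have "\<exists>b. infinite {c\<in>UNIV. (k c, Poly_Mapping.keys (u c)) = b}"
    proof (rule uncountable_fibre[OF uncountable_UNIV_complex])
      have "countable (Collect (finite :: ('i \<Rightarrow>\<^sub>0 nat) set \<Rightarrow> bool))"
        using countable_Collect_finite_subset[OF countable_expos] by simp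
      then show "countable ((UNIV :: nat set) \<times> Collect (finite :: ('i \<Rightarrow>\<^sub>0 nat) set \<Rightarrow> bool))"
        by blast
    qed auto
    then obtain K B where inf: "infinite {c. k c = K \<and> Poly_Mapping.keys (u c) = B}" by auto
    then obtain c1 where "k c1 = K" "Poly_Mapping.keys (u c1) = B"
      using not_finite_existsD by blast
    then have finB: "finite B" using finite_keys by blast
    obtain Z where Z: "Z \<subseteq> {c. k c = K \<and> Poly_Mapping.keys (u c) = B}" "finite Z" "card Z = card B + 1"
      using infinite_arbitrarily_large[OF inf, of "card B + 1"] by blast
    obtain z where z: "\<exists>c\<in>Z. z c \<noteq> 0" "\<forall>b\<in>B. (\<Sum>c\<in>Z. z c * Poly_Mapping.lookup (u c) b) = 0"
      using homogeneous_linear_system[OF finB Z(2), of "\<lambda>c b. Poly_Mapping.lookup (u c) b"] Z(3) by auto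
    have zu: "(\<Sum>c\<in>Z. mconst (z c) * u c) = 0"
    proof (rule poly_mapping_eqI)
      fix b
      have "Poly_Mapping.lookup (mconst a * p) b = a * Poly_Mapping.lookup p b"
        for a and p :: "('i, complex) mpoly"
        unfolding mconst_def mult_map_scale_conv_mult[symmetric]
        by (simp add: Poly_Mapping.map.rep_eq when_def)
      then have "Poly_Mapping.lookup (\<Sum>c\<in>Z. mconst (z c) * u c) b = (\<Sum>c\<in>Z. z c * Poly_Mapping.lookup (u c) b)"
        by (simp add: lookup_sum)
      also have "\<dots> = 0"
      proof (cases "b \<in> B")
        case False
        then show ?thesis using Z(1) by (intro sum.neutral) (auto simp: in_keys_iff)
      qed (use z(2) in auto)
      finally show "Poly_Mapping.lookup (\<Sum>c\<in>Z. mconst (z c) * u c) b = Poly_Mapping.lookup 0 b" by simp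
    qed
    \<comment> \<open>Multiplying the linear relation between the \<open>u c\<close> by the product
      of all \<open>l c\<close> replaces each \<open>u c * l c\<close> by \<open>h ^ K\<close>
      modulo \<open>P\<close>. What remains is \<open>h ^ K * g\<close>; as in Lagrange
      interpolation, only one summand of \<open>g\<close> survives at \<open>c0\<close>, so
      \<open>g\<close> is not zero.\<close>
    define R where "R c = (\<Prod>c'\<in>Z - {c}. l c')" for c
    define g where "g = (\<Sum>c\<in>Z. mconst (z c) * R c)"
    have "h ^ K * g = h ^ K * g - (\<Sum>c\<in>Z. mconst (z c) * u c) * (\<Prod>c\<in>Z. l c)"
      by (simp add: zu)
    also have "\<dots> = (\<Sum>c\<in>Z. mconst (z c) * R c * (h ^ K - u c * l c))"
    proof -
      have "(\<Prod>c\<in>Z. l c) = l c * R c" if "c \<in> Z" for c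
        unfolding R_def using that Z(2) by (intro prod.remove)
      then have "(\<Sum>c\<in>Z. mconst (z c) * u c) * (\<Prod>c\<in>Z. l c) = (\<Sum>c\<in>Z. mconst (z c) * u c * (l c * R c))"
        unfolding sum_distrib_right by (intro sum.cong refl) simp
      then show ?thesis by (simp add: g_def sum_distrib_left algebra_simps sum_subtractf)
    qed
    also have "\<dots> \<in> P"
    proof (intro P_sum P_mult)
      fix c assume "c \<in> Z"
      then have "k c = K" using Z(1) by auto
      then show "h ^ K - u c * l c \<in> P" using ku[of c] by simp
    qed
    finally have gP: "g \<in> P" using prime hP by blast
    define p where "p = (\<Sum>c\<in>Z. smult (z c) (\<Prod>c'\<in>Z - {c}. [:- c', 1:]))"
    have evp: "eval_mpoly g y = poly p (y i)" for y
      by (simp add: g_def R_def l_def p_def poly_sum poly_prod)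
    obtain c0 where c0: "c0 \<in> Z" "z c0 \<noteq> 0" using z(1) by blast
    have "poly p c0 = (\<Sum>c\<in>Z. if c = c0 then z c0 * (\<Prod>c'\<in>Z - {c0}. c0 - c') else 0)"
      unfolding p_def poly_sum
    proof (intro sum.cong refl)
      fix c assume "c \<in> Z"
      show "poly (smult (z c) (\<Prod>c'\<in>Z - {c}. [:- c', 1:])) c0 =
          (if c = c0 then z c0 * (\<Prod>c'\<in>Z - {c0}. c0 - c') else 0)"
      proof (cases "c = c0")
        case False
        then have "(\<Prod>c'\<in>Z - {c}. c0 - c') = 0" using c0(1) Z(2) by (intro prod_zero) auto
        then show ?thesis using False by (simp add: poly_prod)
      qed (simp add: poly_prod)
    qed
    also have "\<dots> = z c0 * (\<Prod>c'\<in>Z - {c0}. c0 - c')" using Z(2) c0(1) by simp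
    also have "\<dots> \<noteq> 0" using c0(2) Z(2) by (auto simp: prod_zero_iff)
    finally have p0: "p \<noteq> 0" by auto
    \<comment> \<open>Over the complex numbers \<open>g\<close> splits into factors
      \<open>l x\<close>, none of which lies in the prime ideal \<open>P\<close>.\<close>
    then obtain A where A: "p = smult (lead_coeff p) (\<Prod>x\<in>#A. [:- x, 1:])"
      using alg_closed_imp_factorization by blast
    have "eval_mpoly (\<Prod>x\<in>#A. l x) y = poly (\<Prod>x\<in>#A. [:- x, 1:]) (y i)" for y
      by (induction A) (auto simp: l_def algebra_simps)
    then have "g = mconst (lead_coeff p) * (\<Prod>x\<in>#A. l x)"
      by (intro mpoly_eqI) (simp add: evp, subst A, simp)
    then have "mconst (1 / lead_coeff p) * g = (\<Prod>x\<in>#A. l x)"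
      using p0 by (simp add: mult.assoc[symmetric] mconst_mult[symmetric])
    then have "(\<Prod>x\<in>#A. l x) \<in> P" using P_mult gP by metis
    moreover have "(\<Prod>x\<in>#A. l x) \<notin> P"
      using one prime lP by (induction A) auto
    ultimately show False by blast
  qed
  \<comment> \<open>Modulo \<open>P\<close> each variable is a constant, hence each polynomial is
    congruent to its value at \<open>c\<close>. So \<open>c\<close> is a common zero of
    \<open>F\<close>, and \<open>h\<close>, which vanishes there, would lie in
    \<open>P\<close>.\<close>
  then obtain c where c: "\<And>i. mvar i - mconst (c i) \<in> P" by metis
  have mod: "f - mconst (eval_mpoly f c) \<in> P" for f
  proof (induction f rule: mpoly_as_ring_generated)
    case (3 f g)
    then have "(f - mconst (eval_mpoly f c)) + (g - mconst (eval_mpoly g c)) \<in> P" by (rule P_add)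
    then show ?case by (simp add: mconst_add algebra_simps)
  next
    case (4 f g)
    then have "g * (f - mconst (eval_mpoly f c)) + mconst (eval_mpoly f c) * (g - mconst (eval_mpoly g c)) \<in> P"
      by (intro P_add P_mult)
    then show ?case by (simp add: mconst_mult algebra_simps)
  qed (use c mpoly_ideal.subspace_0[OF Ps] in auto)
  have "eval_mpoly f c = 0" if "f \<in> F" for f
  proof (rule ccontr)
    assume ne: "eval_mpoly f c \<noteq> 0"
    have "f - (f - mconst (eval_mpoly f c)) \<in> P" using P_diff[OF subsetD[OF FP that] mod[of f]] .
    then have "mconst (1 / eval_mpoly f c) * mconst (eval_mpoly f c) \<in> P" by (intro P_mult) simp
    then show False using one ne by (simp add: mconst_mult[symmetric])
  qed
  then have "eval_mpoly h c = 0" using zeros by blast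
  then show False using mod[of h] hP[of 1] by simp
qed

section \<open>A local dimension bound\<close>

text \<open>An element of \<open>higher_order I n\<close> lies in the ideal generated by the monomials of degree \<open>n\<close> in
  the variables in \<open>I\<close> and by all other variables.\<close>

definition higher_order :: "'i set \<Rightarrow> nat \<Rightarrow> ('i, 'a::comm_ring_1) mpoly set" where
  "higher_order I n = {p. \<forall>u\<in>Poly_Mapping.keys p. Poly_Mapping.keys u \<subseteq> I \<longrightarrow> n \<le> monom_degree u}"

lemma higher_order_add: "p \<in> higher_order I n \<Longrightarrow> q \<in> higher_order I n \<Longrightarrow> p + q \<in> higher_order I n"
  unfolding higher_order_def using Poly_Mapping.keys_add[of p q] by blast

lemma keys_add_nat: "Poly_Mapping.keys (u + v) = Poly_Mapping.keys u \<union> Poly_Mapping.keys (v :: 'i \<Rightarrow>\<^sub>0 nat)"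
  by (auto simp: in_keys_iff lookup_add)

lemma higher_order_mult:
  assumes "p \<in> higher_order I m" "q \<in> higher_order I n"
  shows "p * q \<in> higher_order I (m + n)"
  unfolding higher_order_def
proof (intro CollectI ballI impI)
  fix u assume "u \<in> Poly_Mapping.keys (p * q)" "Poly_Mapping.keys u \<subseteq> I"
  then obtain a b where "u = a + b" "a \<in> Poly_Mapping.keys p" "b \<in> Poly_Mapping.keys q"
    "Poly_Mapping.keys a \<subseteq> I" "Poly_Mapping.keys b \<subseteq> I"
    by (elim keys_mult_mono) (auto simp: keys_add_nat)
  then show "m + n \<le> monom_degree u"
    using assms by (auto simp: higher_order_def monom_degree_add add_mono)
qed

lemma higher_order_0 [simp]: "p \<in> higher_order I 0"
  by (simp add: higher_order_def)

lemma zero_higher_order [simp]: "0 \<in> higher_order I n"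
  by (simp add: higher_order_def)

lemma higher_order_scale: "q \<in> higher_order I n \<Longrightarrow> p * q \<in> higher_order I n"
  using higher_order_mult[of p I 0 q n] by simp

lemma subspace_higher_order: "mpoly_ideal.subspace (higher_order I n)"
  by (intro mpoly_ideal.subspaceI higher_order_add higher_order_scale) auto

lemma higher_order_power: "p \<in> higher_order I 1 \<Longrightarrow> p ^ k \<in> higher_order I k"
  using higher_order_mult[of p I 1] by (induction k) auto

lemma higher_order_mono: "m \<le> n \<Longrightarrow> p \<in> higher_order I n \<Longrightarrow> p \<in> higher_order I m"
  by (auto simp: higher_order_def)

lemma ex_key: "u \<noteq> 0 \<Longrightarrow> \<exists>i. i \<in> Poly_Mapping.keys u"
  by (rule ccontr) (auto simp: in_keys_iff intro: poly_mapping_eqI)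

lemma higher_order_1:
  fixes p :: "('i, 'a::{idom, ring_char_0}) mpoly"
  assumes "eval_mpoly p (\<lambda>_. 0) = 0"
  shows "p \<in> higher_order I 1"
proof -
  have "eval_mpoly p (\<lambda>_. 0) = (\<Sum>u\<in>Poly_Mapping.keys p. if u = 0 then Poly_Mapping.lookup p 0 else 0)"
    unfolding eval_mpoly_def
  proof (intro sum.cong refl)
    fix u
    show "Poly_Mapping.lookup p u * (\<Prod>i\<in>Poly_Mapping.keys u. 0 ^ Poly_Mapping.lookup u i) =
        (if u = 0 then Poly_Mapping.lookup p 0 else 0)"
    proof (cases "u = 0")
      case False
      then obtain i where "i \<in> Poly_Mapping.keys u"
        using ex_key by blast
      then have "(\<Prod>i\<in>Poly_Mapping.keys u. (0::'a) ^ Poly_Mapping.lookup u i) = 0"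
        by (intro prod_zero) (auto simp: in_keys_iff)
      then show ?thesis using False by simp
    qed simp
  qed
  then have z: "0 \<notin> Poly_Mapping.keys p" using assms by (auto simp: in_keys_iff split: if_splits)
  have "1 \<le> monom_degree u" if u: "u \<in> Poly_Mapping.keys p" for u
  proof -
    obtain i where "i \<in> Poly_Mapping.keys u"
      using u z ex_key[of u] by blast
    then have "Poly_Mapping.keys u \<noteq> {}" "\<forall>i\<in>Poly_Mapping.keys u. 0 < Poly_Mapping.lookup u i"
      by (auto simp: in_keys_iff)
    then show ?thesis unfolding monom_degree_def by (simp add: Suc_le_eq sum_pos)
  qed
  then show ?thesis by (auto simp: higher_order_def)
qed

definition gpow :: "('t \<Rightarrow> 'a::comm_monoid_mult) \<Rightarrow> 't set \<Rightarrow> ('t \<Rightarrow>\<^sub>0 nat) \<Rightarrow> 'a" where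
  "gpow g \<tau> \<beta> = (\<Prod>t\<in>\<tau>. g t ^ Poly_Mapping.lookup \<beta> t)"

lemma gpow_add_single:
  assumes "finite \<tau>" "t \<in> \<tau>"
  shows "gpow g \<tau> (Poly_Mapping.single t 1 + \<beta>) = g t * gpow g \<tau> \<beta>"
proof -
  have "(\<Prod>s\<in>\<tau>. g s ^ Poly_Mapping.lookup (Poly_Mapping.single t 1) s) = (\<Prod>s\<in>\<tau>. if s = t then g t else 1)"
    by (intro prod.cong refl) (auto simp: lookup_single when_def)
  then show ?thesis
    using assms by (simp add: gpow_def lookup_add power_add prod.distrib)
qed

text \<open>Writing \<open>p \<equiv> s + \<Sum>t. g t * b t\<close> modulo \<open>M\<close> and iterating on the \<open>b t\<close>.\<close>

lemma span_mod_iterate: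
  fixes g :: "'t \<Rightarrow> ('i, 'a::field) mpoly"
  assumes fin: "finite \<tau>" and M: "mpoly_ideal.subspace M"
    and step: "\<And>p. \<exists>s\<in>mpoly_vs.span S. \<exists>b. p - s - (\<Sum>t\<in>\<tau>. g t * b t) \<in> M"
    and top: "\<And>\<beta>. \<beta> \<in> expo_box \<tau> K \<Longrightarrow> monom_degree \<beta> = K \<Longrightarrow> gpow g \<tau> \<beta> \<in> M'"
    and M': "mpoly_ideal.subspace M'" "M \<subseteq> M'"
  shows "\<exists>s\<in>mpoly_vs.span ((\<lambda>(\<beta>, s). gpow g \<tau> \<beta> * s) ` (expo_box \<tau> K \<times> S)). p - s \<in> M'"
proof -
  \<comment> \<open>The remainder after \<open>k\<close> rounds lies in \<open>J k\<close>,
    generated by the products of degree \<open>k\<close> in the \<open>g t\<close> together with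
    \<open>M\<close>. Each round raises this degree by one; at degree \<open>K\<close> the products
    fall into \<open>M'\<close>.\<close>
  define \<S> where "\<S> k = (\<lambda>(\<beta>, s). gpow g \<tau> \<beta> * s) ` (expo_box \<tau> k \<times> S)" for k
  define J where "J k = mpoly_ideal.span ({gpow g \<tau> \<beta> | \<beta>. \<beta> \<in> expo_box \<tau> k \<and> monom_degree \<beta> = k} \<union> M)" for k
  have mult_in: "g t * s \<in> mpoly_vs.span (\<S> (Suc k))" if "t \<in> \<tau>" "s \<in> mpoly_vs.span (\<S> k)" for t s k
    using that(2)
  proof (induction s rule: mpoly_vs.span_induct_alt)
    case base
    show ?case using mpoly_vs.span_zero by simp
  next
    case (step c x y)
    obtain \<beta> s where x: "x = gpow g \<tau> \<beta> * s" "\<beta> \<in> expo_box \<tau> k" "s \<in> S"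
      using step(1) by (auto simp: \<S>_def)
    have "Poly_Mapping.single t 1 \<in> expo_box \<tau> 1"
      using that(1) by (auto simp: expo_box_def lookup_single when_def)
    then have "Poly_Mapping.single t 1 + \<beta> \<in> expo_box \<tau> (Suc k)"
      using expo_box_add[of _ \<tau> 1 \<beta> k] x(2) by simp
    then have "gpow g \<tau> (Poly_Mapping.single t 1 + \<beta>) * s \<in> \<S> (Suc k)"
      using x(3) by (force simp: \<S>_def)
    then have gx: "g t * x \<in> \<S> (Suc k)"
      using gpow_add_single[OF fin that(1), of g \<beta>] x(1) by (simp add: mult.assoc)
    have "mconst c * (g t * x) + g t * y \<in> mpoly_vs.span (\<S> (Suc k))"
      by (rule mpoly_vs.span_add[OF mpoly_vs.span_scale[OF mpoly_vs.span_base[OF gx]] step(2)])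
    then show ?case by (simp add: algebra_simps)
  qed
  have mult_J: "g t * q \<in> J (Suc k)" if "t \<in> \<tau>" "q \<in> J k" for t q k
    using that(2) unfolding J_def
  proof (induction q rule: mpoly_ideal.span_induct_alt)
    case base
    show ?case using mpoly_ideal.span_zero by simp
  next
    case (step c x y)
    have gx: "g t * x \<in> {gpow g \<tau> \<beta> | \<beta>. \<beta> \<in> expo_box \<tau> (Suc k) \<and> monom_degree \<beta> = Suc k} \<union> M"
    proof (cases "x \<in> M")
      case True
      then show ?thesis using mpoly_ideal.subspace_scale[OF M] by blast
    next
      case False
      then obtain \<beta> where \<beta>: "x = gpow g \<tau> \<beta>" "\<beta> \<in> expo_box \<tau> k" "monom_degree \<beta> = k"
        using step(1) by blast
      have "Poly_Mapping.single t 1 \<in> expo_box \<tau> 1"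
        using that(1) by (auto simp: expo_box_def lookup_single when_def)
      then have "Poly_Mapping.single t 1 + \<beta> \<in> expo_box \<tau> (Suc k)"
        using expo_box_add[of _ \<tau> 1 \<beta> k] \<beta>(2) by simp
      moreover have "monom_degree (Poly_Mapping.single t 1 + \<beta>) = Suc k"
        using \<beta>(3) by (simp add: monom_degree_add) (simp add: monom_degree_def)
      ultimately have "gpow g \<tau> (Poly_Mapping.single t 1 + \<beta>) \<in>
          {gpow g \<tau> \<beta> | \<beta>. \<beta> \<in> expo_box \<tau> (Suc k) \<and> monom_degree \<beta> = Suc k}" by blast
      then show ?thesis unfolding gpow_add_single[OF fin that(1)] \<beta>(1) by blast
    qed
    have "c * (g t * x) + g t * y \<in> mpoly_ideal.span
        ({gpow g \<tau> \<beta> | \<beta>. \<beta> \<in> expo_box \<tau> (Suc k) \<and> monom_degree \<beta> = Suc k} \<union> M)"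
      by (rule mpoly_ideal.span_add[OF mpoly_ideal.span_scale[OF mpoly_ideal.span_base[OF gx]] step(2)])
    then show ?case by (simp add: algebra_simps)
  qed
  have M_J: "x \<in> J k" if "x \<in> M" for x k
    using that unfolding J_def by (intro mpoly_ideal.span_base) simp
  have mono: "mpoly_vs.span (\<S> 0) \<subseteq> mpoly_vs.span (\<S> k)" for k
    unfolding \<S>_def using expo_box_mono[of 0 k \<tau>] by (intro mpoly_vs.span_mono image_mono) auto
  have S0: "S \<subseteq> \<S> k" for k
  proof
    fix s assume "s \<in> S"
    moreover have "0 \<in> expo_box \<tau> k" by (simp add: expo_box_def)
    moreover have "gpow g \<tau> 0 * s = s" by (simp add: gpow_def)
    ultimately show "s \<in> \<S> k" unfolding \<S>_def by force
  qed
  have "\<exists>s\<in>mpoly_vs.span (\<S> k). p - s \<in> J k" for k p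
  proof (induction k arbitrary: p)
    case 0
    have "gpow g \<tau> 0 \<in> {gpow g \<tau> \<beta> | \<beta>. \<beta> \<in> expo_box \<tau> 0 \<and> monom_degree \<beta> = 0} \<union> M"
      by (auto simp: expo_box_def monom_degree_def intro!: exI[of _ 0])
    then have "p * gpow g \<tau> 0 \<in> J 0"
      unfolding J_def by (intro mpoly_ideal.span_scale mpoly_ideal.span_base)
    then show ?case using mpoly_vs.span_zero by (intro bexI[of _ 0]) (auto simp: gpow_def)
  next
    case (Suc k)
    obtain s b where s: "s \<in> mpoly_vs.span S" "p - s - (\<Sum>t\<in>\<tau>. g t * b t) \<in> M"
      using step by blast
    have "\<forall>t. \<exists>r. r \<in> mpoly_vs.span (\<S> k) \<and> b t - r \<in> J k" using Suc.IH by blast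
    then obtain s' where s': "\<And>t. s' t \<in> mpoly_vs.span (\<S> k)" "\<And>t. b t - s' t \<in> J k"
      by metis
    have "s + (\<Sum>t\<in>\<tau>. g t * s' t) \<in> mpoly_vs.span (\<S> (Suc k))"
      using mpoly_vs.span_mono[OF S0] s(1) s'(1) mult_in
      by (intro mpoly_vs.span_add mpoly_vs.span_sum) auto
    moreover have "p - (s + (\<Sum>t\<in>\<tau>. g t * s' t)) =
        (p - s - (\<Sum>t\<in>\<tau>. g t * b t)) + (\<Sum>t\<in>\<tau>. g t * (b t - s' t))"
      by (simp add: algebra_simps sum_subtractf)
    moreover have "(p - s - (\<Sum>t\<in>\<tau>. g t * b t)) + (\<Sum>t\<in>\<tau>. g t * (b t - s' t)) \<in> J (Suc k)"
      using M_J[OF s(2), of "Suc k"] mult_J s'(2) unfolding J_def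
      by (intro mpoly_ideal.span_add mpoly_ideal.span_sum) auto
    ultimately show ?case by (intro bexI[of _ "s + (\<Sum>t\<in>\<tau>. g t * s' t)"]) (simp only:)
  qed
  then obtain s where s: "s \<in> mpoly_vs.span (\<S> K)" "p - s \<in> J K" by blast
  have "J K \<subseteq> M'"
    unfolding J_def using top M' by (intro mpoly_ideal.span_minimal) auto
  then show ?thesis using s unfolding \<S>_def by blast
qed

text \<open>Truncated geometric series: \<open>N = 1 - G / a\<close> has no constant term, so
  \<open>N ^ n\<close> is of order \<open>n\<close>. Thus a polynomial not vanishing at the origin
  is a unit in the truncated local ring.\<close>

lemma inverse_mod_higher_order:
  fixes G :: "('i, 'a::field_char_0) mpoly"
  assumes "eval_mpoly G (\<lambda>_. 0) \<noteq> 0"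
  shows "\<exists>G'. 1 - G' * G \<in> higher_order I n"
proof -
  define a where "a = eval_mpoly G (\<lambda>_. 0)"
  define N where "N = 1 - mconst (1 / a) * G"
  have N1: "N \<in> higher_order I 1"
    using assms by (intro higher_order_1) (simp add: N_def a_def)
  have "1 - ((\<Sum>i<n. N ^ i) * mconst (1 / a)) * G = N ^ n"
  proof -
    have "mconst (1 / a) * G = 1 - N" by (simp add: N_def)
    moreover have "((\<Sum>i<n. N ^ i) * mconst (1 / a)) * G = (mconst (1 / a) * G) * (\<Sum>i<n. N ^ i)"
      by (simp only: mult_ac)
    ultimately have "((\<Sum>i<n. N ^ i) * mconst (1 / a)) * G = (1 - N) * (\<Sum>i<n. N ^ i)" by simp
    also have "\<dots> = 1 - N ^ n" by (simp add: one_diff_power_eq)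
    finally show ?thesis by simp
  qed
  then show ?thesis using higher_order_power[OF N1, of n] by metis
qed

text \<open>The quotient by \<open>higher_order I n\<close> has dimension at least \<open>const * n ^ card I\<close>. By the
  Nullstellensatz, powers of the \<open>Q T\<close> lie in the ideal of the \<open>f j\<close> modulo \<open>higher_order I n\<close>, so
  that the quotient is spanned by products of monomials of degree less than \<open>n\<close> in the \<open>f j\<close>,
  boundedly many monomials in the \<open>Q T\<close> and \<open>O(n ^ (r - 1))\<close> standard monomials.\<close>

lemma local_dimension_bound:
  fixes f :: "'j \<Rightarrow> ('i::countable, complex) mpoly"
  assumes fin: "finite I" "finite C" and cardI: "card I = card C + r" and r: "1 \<le> r"
    and f0: "\<And>j. j \<in> C \<Longrightarrow> eval_mpoly (f j) (\<lambda>_. 0) = 0"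
    and G0: "eval_mpoly G (\<lambda>_. 0) \<noteq> 0"
    and Q: "\<And>T. T \<subseteq> I \<Longrightarrow> card T = r \<Longrightarrow> Q T \<in> mpolys T \<and> Q T \<noteq> 0"
    and vanish: "\<And>T y. T \<subseteq> I \<Longrightarrow> card T = r \<Longrightarrow> (\<forall>j\<in>C. eval_mpoly (f j) y = 0) \<Longrightarrow>
      eval_mpoly G y \<noteq> 0 \<Longrightarrow> eval_mpoly (Q T) y = 0"
  shows False
proof -
  define \<T> where "\<T> = {T. T \<subseteq> I \<and> card T = r}"
  have fin\<T>: "finite \<T>" unfolding \<T>_def using fin by simp
  have "\<exists>k. (G * Q T) ^ k \<in> mpoly_ideal.span (f ` C)" if "T \<in> \<T>" for T
    using vanish[of T] that unfolding \<T>_def by (intro nullstellensatz) auto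
  then obtain k where k: "\<And>T. T \<in> \<T> \<Longrightarrow> (G * Q T) ^ k T \<in> mpoly_ideal.span (f ` C)" by metis
  \<comment> \<open>Exceeding the sum of the \<open>k T\<close>, the degree \<open>K\<close> forces
    some factor \<open>Q T ^ k T\<close> into every product of degree \<open>K\<close> in the
    \<open>Q T\<close>.\<close>
  define K where "K = (\<Sum>T\<in>\<T>. k T) + 1"
  obtain \<kappa> where \<kappa>: "\<And>n. \<exists>S. finite S \<and> card S \<le> \<kappa> * (n + 1) ^ (r - 1) \<and>
    (\<forall>u. Poly_Mapping.keys u \<subseteq> I \<longrightarrow> monom_degree u \<le> n \<longrightarrow>
      (\<exists>s\<in>mpoly_vs.span S. mmonom u - s \<in> mpoly_ideal.span (Q ` \<T>)))"
    using standard_monomials_span[OF fin(1) r Q] unfolding \<T>_def by blast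
  define m where "m = card I"
  have m1: "1 \<le> m" using cardI r by (simp add: m_def)
  have bound: "(N + 1) ^ m \<le> (m * N + 2) ^ card C * ((K + 1) ^ card \<T> * (\<kappa> * (m * N + 2) ^ (r - 1)))" for N
  proof -
    \<comment> \<open>Monomials of the box of side \<open>N\<close> in \<open>m\<close> variables
      have degree at most \<open>m * N\<close>, hence stay linearly independent modulo
      \<open>?O\<close>.\<close>
    define n where "n = m * N + 1"
    let ?O = "higher_order I n :: ('i, complex) mpoly set"
    obtain S where S: "finite S" "card S \<le> \<kappa> * (n + 1) ^ (r - 1)"
      "\<And>u. Poly_Mapping.keys u \<subseteq> I \<Longrightarrow> monom_degree u \<le> n \<Longrightarrow>
        \<exists>s\<in>mpoly_vs.span S. mmonom u - s \<in> mpoly_ideal.span (Q ` \<T>)"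
      using \<kappa>[of n] by blast
    have span_image: "\<exists>b. p = (\<Sum>t\<in>\<tau>. g t * b t)"
      if "finite \<tau>" "p \<in> mpoly_ideal.span (g ` \<tau>)" for p and g :: "'t \<Rightarrow> ('i, complex) mpoly" and \<tau>
      using that(2)
    proof (induction p rule: mpoly_ideal.span_induct_alt)
      case base
      show ?case by (rule exI[of _ "\<lambda>_. 0"]) simp
    next
      case (step c x y)
      obtain t where t: "t \<in> \<tau>" "x = g t" using step(1) by blast
      obtain b where b: "y = (\<Sum>t\<in>\<tau>. g t * b t)" using step(2) by blast
      have "(\<Sum>s\<in>\<tau>. g s * (b s + (if s = t then c else 0))) = c * x + y"
        using t that(1) by (simp add: b distrib_left sum.distrib if_distrib[of "\<lambda>a. _ * a"] cong: if_cong)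
      then show ?case by (intro exI[of _ "\<lambda>s. b s + (if s = t then c else 0)"]) simp
    qed
    have step1: "\<exists>s\<in>mpoly_vs.span S. \<exists>b. p - s - (\<Sum>T\<in>\<T>. Q T * b T) \<in> ?O" for p
    proof -
      have "\<exists>s\<in>mpoly_vs.span S. \<exists>q\<in>mpoly_ideal.span (Q ` \<T>). p - s - q \<in> ?O"
      proof (induction p rule: mpoly_induct)
        case zero
        show ?case
          using mpoly_vs.span_zero mpoly_ideal.span_zero by (intro bexI[of _ 0]) auto
      next
        case (add p u c)
        obtain s q where sq: "s \<in> mpoly_vs.span S" "q \<in> mpoly_ideal.span (Q ` \<T>)" "p - s - q \<in> ?O"
          using add by blast
        have cu: "Poly_Mapping.single u c = mconst c * mmonom u"
          by (simp add: mconst_def mmonom_def mult_single)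
        show ?case
        proof (cases "Poly_Mapping.keys u \<subseteq> I \<and> monom_degree u \<le> n")
          case True
          then obtain s' where s': "s' \<in> mpoly_vs.span S" "mmonom u - s' \<in> mpoly_ideal.span (Q ` \<T>)"
            using S(3) by blast
          have "p + Poly_Mapping.single u c - (s + mconst c * s') - (q + mconst c * (mmonom u - s')) = p - s - q"
            unfolding cu by (simp add: algebra_simps)
          then have "p + Poly_Mapping.single u c - (s + mconst c * s') - (q + mconst c * (mmonom u - s')) \<in> ?O"
            using sq(3) by (simp only:)
          moreover have "s + mconst c * s' \<in> mpoly_vs.span S"
            by (rule mpoly_vs.span_add[OF sq(1) mpoly_vs.span_scale[OF s'(1)]])
          moreover have "q + mconst c * (mmonom u - s') \<in> mpoly_ideal.span (Q ` \<T>)"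
            by (rule mpoly_ideal.span_add[OF sq(2) mpoly_ideal.span_scale[OF s'(2)]])
          ultimately show ?thesis by blast
        next
          case False
          then have "Poly_Mapping.single u c \<in> ?O" by (auto simp: higher_order_def)
          then have "(p - s - q) + Poly_Mapping.single u c \<in> ?O" by (intro higher_order_add sq)
          also have "(p - s - q) + Poly_Mapping.single u c = p + Poly_Mapping.single u c - s - q" by simp
          finally show ?thesis using sq by blast
        qed
      qed
      then obtain s q where sq: "s \<in> mpoly_vs.span S" "q \<in> mpoly_ideal.span (Q ` \<T>)" "p - s - q \<in> ?O"
        by blast
      obtain b where "q = (\<Sum>T\<in>\<T>. Q T * b T)" using span_image[OF fin\<T> sq(2)] by blast
      then show ?thesis using sq by blast
    qed

    define J where "J = mpoly_ideal.span (f ` C \<union> ?O)"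
    have Jsub: "mpoly_ideal.subspace J" by (simp add: J_def)
    have OJ: "?O \<subseteq> J" unfolding J_def using mpoly_ideal.span_superset by blast
    have fJ: "mpoly_ideal.span (f ` C) \<subseteq> J" unfolding J_def by (intro mpoly_ideal.span_mono) simp
    \<comment> \<open>The Nullstellensatz only gives a power of \<open>G * Q T\<close>; the factor
      \<open>G\<close> is removed because it is invertible modulo \<open>?O\<close>.\<close>
    have QJ: "Q T ^ k T \<in> J" if T: "T \<in> \<T>" for T
    proof -
      obtain G' where G': "1 - G' * G \<in> ?O" using inverse_mod_higher_order[OF G0] by blast
      have "1 - (G' * G) ^ k T = (\<Sum>i<k T. (G' * G) ^ i) * (1 - G' * G)"
        by (simp add: one_diff_power_eq mult.commute)
      then have "1 - (G' * G) ^ k T \<in> ?O" using higher_order_scale[OF G'] by metis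
      then have "Q T ^ k T * (1 - (G' * G) ^ k T) \<in> J" using OJ higher_order_scale by blast
      moreover have "G' ^ k T * (G * Q T) ^ k T \<in> J"
        using k[OF T] fJ mpoly_ideal.subspace_scale[OF Jsub] by blast
      ultimately have "Q T ^ k T * (1 - (G' * G) ^ k T) + G' ^ k T * (G * Q T) ^ k T \<in> J"
        by (rule mpoly_ideal.subspace_add[OF Jsub])
      then show ?thesis by (simp add: algebra_simps power_mult_distrib)
    qed
    have topQ: "gpow Q \<T> \<beta> \<in> J" if \<beta>: "\<beta> \<in> expo_box \<T> K" "monom_degree \<beta> = K" for \<beta>
    proof -
      have "\<exists>T\<in>\<T>. k T \<le> Poly_Mapping.lookup \<beta> T"
      proof (rule ccontr)
        assume neg: "\<not> (\<exists>T\<in>\<T>. k T \<le> Poly_Mapping.lookup \<beta> T)"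
        have "monom_degree \<beta> \<le> (\<Sum>T\<in>\<T>. Poly_Mapping.lookup \<beta> T)"
          unfolding monom_degree_def using \<beta>(1) fin\<T> by (intro sum_mono2) (auto simp: expo_box_def)
        also have "\<dots> \<le> (\<Sum>T\<in>\<T>. k T)" using neg by (intro sum_mono) auto
        finally show False using \<beta>(2) by (simp add: K_def)
      qed
      then obtain T where T: "T \<in> \<T>" "k T \<le> Poly_Mapping.lookup \<beta> T" by blast
      have "gpow Q \<T> \<beta> = Q T ^ Poly_Mapping.lookup \<beta> T * (\<Prod>T\<in>\<T> - {T}. Q T ^ Poly_Mapping.lookup \<beta> T)"
        unfolding gpow_def using fin\<T> T(1) by (intro prod.remove)
      also have "Q T ^ Poly_Mapping.lookup \<beta> T = Q T ^ (Poly_Mapping.lookup \<beta> T - k T) * Q T ^ k T"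
        using T(2) by (simp add: power_add[symmetric])
      also have "Q T ^ (Poly_Mapping.lookup \<beta> T - k T) * Q T ^ k T * (\<Prod>T\<in>\<T> - {T}. Q T ^ Poly_Mapping.lookup \<beta> T) =
          (Q T ^ (Poly_Mapping.lookup \<beta> T - k T) * (\<Prod>T\<in>\<T> - {T}. Q T ^ Poly_Mapping.lookup \<beta> T)) * Q T ^ k T"
        by (simp only: mult_ac)
      finally show ?thesis using mpoly_ideal.subspace_scale[OF Jsub QJ[OF T(1)]] by simp
    qed
    define S1 where "S1 = (\<lambda>(\<beta>, s). gpow Q \<T> \<beta> * s) ` (expo_box \<T> K \<times> S)"
    have step2: "\<exists>s\<in>mpoly_vs.span S1. \<exists>b. p - s - (\<Sum>j\<in>C. f j * b j) \<in> ?O" for p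
    proof -
      obtain s where s: "s \<in> mpoly_vs.span S1" "p - s \<in> J"
        using span_mod_iterate[OF fin\<T> subspace_higher_order step1 _ Jsub OJ, where p = p and K = K]
          topQ unfolding S1_def[symmetric] by blast
      then obtain x y where xy: "p - s = x + y" "x \<in> mpoly_ideal.span (f ` C)" "y \<in> mpoly_ideal.span ?O"
        unfolding J_def mpoly_ideal.span_Un by blast
      then obtain b where "x = (\<Sum>j\<in>C. f j * b j)" using span_image[OF fin(2)] by blast
      moreover have "y \<in> ?O"
        using mpoly_ideal.span_minimal[OF order_refl subspace_higher_order] xy(3) by blast
      ultimately have "p - s - (\<Sum>j\<in>C. f j * b j) \<in> ?O" using xy(1) by simp
      then show ?thesis using s(1) by blast
    qed
    have topf: "gpow f C \<alpha> \<in> ?O" if \<alpha>: "\<alpha> \<in> expo_box C n" "monom_degree \<alpha> = n" for \<alpha>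
    proof -
      have "(\<Prod>j\<in>A. f j ^ Poly_Mapping.lookup \<alpha> j) \<in> higher_order I (\<Sum>j\<in>A. Poly_Mapping.lookup \<alpha> j)"
        if "finite A" "A \<subseteq> C" for A
        using that
      proof (induction A rule: finite_induct)
        case (insert j A)
        then have "f j ^ Poly_Mapping.lookup \<alpha> j \<in> higher_order I (Poly_Mapping.lookup \<alpha> j)"
          using f0 by (intro higher_order_power higher_order_1) auto
        then show ?case using insert by (simp add: higher_order_mult)
      qed auto
      moreover have "n \<le> (\<Sum>j\<in>C. Poly_Mapping.lookup \<alpha> j)"
        unfolding \<alpha>(2)[symmetric] monom_degree_def
        using \<alpha>(1) fin(2) by (intro sum_mono2) (auto simp: expo_box_def)
      ultimately show ?thesis unfolding gpow_def using fin(2) higher_order_mono by blast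
    qed
    define S2 where "S2 = (\<lambda>(\<beta>, s). gpow f C \<beta> * s) ` (expo_box C n \<times> S1)"
    have all: "\<exists>s\<in>mpoly_vs.span S2. p - s \<in> ?O" for p
      using span_mod_iterate[OF fin(2) subspace_higher_order step2 _ subspace_higher_order order_refl, where p = p and K = n] topf
      unfolding S2_def[symmetric] by blast
    have finS1: "finite S1" unfolding S1_def using S(1) finite_expo_box[OF fin\<T>] by simp
    have finS2: "finite S2" unfolding S2_def using finS1 finite_expo_box[OF fin(2)] by simp
    have "card S1 \<le> (K + 1) ^ card \<T> * (\<kappa> * (n + 1) ^ (r - 1))"
    proof -
      have "card S1 \<le> card (expo_box \<T> K \<times> S)"
        unfolding S1_def using S(1) finite_expo_box[OF fin\<T>] by (intro card_image_le) simp
      also have "\<dots> = (K + 1) ^ card \<T> * card S"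
        unfolding card_cartesian_product card_expo_box[OF fin\<T>] ..
      also have "\<dots> \<le> (K + 1) ^ card \<T> * (\<kappa> * (n + 1) ^ (r - 1))"
        using S(2) by (rule mult_left_mono) simp
      finally show ?thesis .
    qed
    moreover have "card S2 \<le> (n + 1) ^ card C * card S1"
    proof -
      have "card S2 \<le> card (expo_box C n \<times> S1)"
        unfolding S2_def using finS1 finite_expo_box[OF fin(2)] by (intro card_image_le) simp
      then show ?thesis unfolding card_cartesian_product card_expo_box[OF fin(2)] .
    qed
    ultimately have cardS2: "card S2 \<le> (n + 1) ^ card C * ((K + 1) ^ card \<T> * (\<kappa> * (n + 1) ^ (r - 1)))"
      by (meson le_trans mult_left_mono zero_le)
    \<comment> \<open>Otherwise a nontrivial combination of box monomials would lie in
      \<open>?O\<close>, although all of them have degree below \<open>n\<close>.\<close>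
    have "card (expo_box I N) \<le> card S2"
    proof (rule ccontr)
      assume "\<not> card (expo_box I N) \<le> card S2"
      then have lt: "card S2 < card (expo_box I N)" by simp
      have "\<forall>u. \<exists>s. s \<in> mpoly_vs.span S2 \<and> mmonom u - s \<in> ?O" using all by blast
      then obtain s where s: "\<And>u. s u \<in> mpoly_vs.span S2" "\<And>u. mmonom u - s u \<in> ?O"
        by metis
      have "\<exists>c. s u = (\<Sum>b\<in>S2. mconst (c b) * b)" for u
        using s(1)[of u] unfolding mpoly_vs.span_finite[OF finS2] by auto
      then obtain c where c: "\<And>u. s u = (\<Sum>b\<in>S2. mconst (c u b) * b)" by metis
      obtain z where z: "\<exists>u\<in>expo_box I N. z u \<noteq> 0" "\<forall>b\<in>S2. (\<Sum>u\<in>expo_box I N. z u * c u b) = 0"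
        using homogeneous_linear_system[OF finS2 finite_expo_box[OF fin(1)] lt, of c] by blast
      have msum: "(\<Sum>u\<in>A. mconst (h u)) = mconst (\<Sum>u\<in>A. h u)" for A and h :: "('i \<Rightarrow>\<^sub>0 nat) \<Rightarrow> complex"
        by (induction A rule: infinite_finite_induct) (auto simp: mconst_add)
      have "(\<Sum>u\<in>expo_box I N. mconst (z u) * s u) =
          (\<Sum>b\<in>S2. (\<Sum>u\<in>expo_box I N. mconst (z u * c u b)) * b)"
        unfolding c sum_distrib_left sum_distrib_right mconst_mult mult.assoc by (rule sum.swap)
      also have "\<dots> = 0" using z(2) by (simp add: msum)
      finally have zs: "(\<Sum>u\<in>expo_box I N. mconst (z u) * s u) = 0" .
      have "(\<Sum>u\<in>expo_box I N. mconst (z u) * (mmonom u - s u)) \<in> ?O"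
        using s(2) by (intro mpoly_ideal.subspace_sum[OF subspace_higher_order] higher_order_scale)
      then have inO: "(\<Sum>u\<in>expo_box I N. mconst (z u) * mmonom u) \<in> ?O"
        using zs by (simp add: right_diff_distrib sum_subtractf)
      obtain u where u: "u \<in> expo_box I N" "z u \<noteq> 0" using z(1) by blast
      have "Poly_Mapping.lookup (\<Sum>u\<in>expo_box I N. mconst (z u) * mmonom u) u = z u"
        using u(1) by (simp add: lookup_sum_monom finite_expo_box[OF fin(1)])
      then have "u \<in> Poly_Mapping.keys (\<Sum>u\<in>expo_box I N. mconst (z u) * mmonom u)"
        using u(2) by (simp add: in_keys_iff)
      then have "n \<le> monom_degree u" using inO u(1) unfolding higher_order_def expo_box_def by blast
      also have "\<dots> \<le> (\<Sum>i\<in>I. Poly_Mapping.lookup u i)"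
        unfolding monom_degree_def using u(1) fin(1) by (intro sum_mono2) (auto simp: expo_box_def)
      also have "\<dots> \<le> m * N"
        using sum_bounded_above[of I "Poly_Mapping.lookup u" N] u(1) by (simp add: m_def expo_box_def)
      finally show False by (simp add: n_def)
    qed
    then show ?thesis
      using cardS2 unfolding card_expo_box[OF fin(1)] by (simp add: m_def n_def)
  qed
  \<comment> \<open>The exponents \<open>card C\<close> and \<open>r - 1\<close> add up to only
    \<open>m - 1\<close>, against \<open>m\<close> on the left. \<open>N\<close> absorbs the
    constants, so that the right side is at most \<open>N * (N + 1) ^ (m - 1)\<close>.\<close>
  define A where "A = (K + 1) ^ card \<T> * \<kappa>"
  define N where "N = (m + 2) ^ (m - 1) * A"
  have "(N + 1) ^ m \<le> (m * N + 2) ^ card C * ((K + 1) ^ card \<T> * (\<kappa> * (m * N + 2) ^ (r - 1)))"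
    by (rule bound)
  also have "\<dots> = A * (m * N + 2) ^ (card C + (r - 1))"
    by (simp only: A_def power_add mult_ac)
  also have "card C + (r - 1) = m - 1" using cardI r by (simp add: m_def)
  also have "A * (m * N + 2) ^ (m - 1) \<le> A * ((m + 2) * (N + 1)) ^ (m - 1)"
    by (intro mult_left_mono power_mono) auto
  also have "\<dots> = N * (N + 1) ^ (m - 1)"
    by (simp only: N_def power_mult_distrib mult_ac)
  also have "\<dots> < (N + 1) * (N + 1) ^ (m - 1)" by simp
  also have "\<dots> = (N + 1) ^ m" using m1 by (metis Suc_diff_le diff_Suc_1 power_Suc One_nat_def)
  finally show False by simp
qed

section \<open>Integer relations and characters\<close>

lemma power_int_sum:
  fixes x :: "'a::field"
  assumes "x \<noteq> 0"
  shows "x powi (\<Sum>a\<in>A. f a) = (\<Prod>a\<in>A. x powi f a)"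
  using assms by (induction A rule: infinite_finite_induct) (auto simp: power_int_add)

lemma prod_power_int:
  fixes f :: "'b \<Rightarrow> 'a::field"
  shows "(\<Prod>a\<in>A. f a) powi n = (\<Prod>a\<in>A. f a powi n)"
  by (induction A rule: infinite_finite_induct) (auto simp: power_int_mult_distrib)

text \<open>The step uses that the nonzero complex numbers form a divisible group: the values of the
  new coordinate on the relations of the old ones form a group \<open>N\<int>\<close>, and an \<open>N\<close>-th root of the
  character value at a generator can be chosen for the new parameter.\<close>

lemma character_extension:
  fixes a :: "'j \<Rightarrow> 'w \<Rightarrow> int" and z :: "'j \<Rightarrow> complex"
  assumes "finite \<Omega>" "finite J" "\<And>j. j \<in> J \<Longrightarrow> z j \<noteq> 0"
    and "\<And>u. (\<forall>\<omega>\<in>\<Omega>. (\<Sum>j\<in>J. u j * a j \<omega>) = 0) \<Longrightarrow> (\<Prod>j\<in>J. z j powi u j) = 1"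
  shows "\<exists>s. (\<forall>\<omega>. s \<omega> \<noteq> 0) \<and> (\<forall>j\<in>J. z j = (\<Prod>\<omega>\<in>\<Omega>. s \<omega> powi a j \<omega>))"
  using assms
proof (induction \<Omega> arbitrary: z rule: finite_induct)
  case empty
  have "z j = 1" if "j \<in> J" for j
  proof -
    have "(\<Prod>i\<in>J. z i powi (if i = j then 1 else 0)) = (\<Prod>i\<in>J. if i = j then z j else 1)"
      by (intro prod.cong refl) auto
    then show ?thesis using empty(3)[of "\<lambda>i. if i = j then 1 else 0"] that empty(1) by simp
  qed
  then show ?case by (intro exI[of _ "\<lambda>_. 1"]) simp
next
  case (insert \<omega>0 \<Omega>)
  define rel where "rel u \<longleftrightarrow> (\<forall>\<omega>\<in>\<Omega>. (\<Sum>j\<in>J. u j * a j \<omega>) = 0)" for u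
  define h where "h u = (\<Sum>j\<in>J. u j * a j \<omega>0)" for u
  define ev where "ev u = (\<Prod>j\<in>J. z j powi u j)" for u
  have rel_comb: "rel (\<lambda>j. u j - q * v j)" if "rel u" "rel v" for u v q
    using that by (simp add: rel_def algebra_simps sum_subtractf sum_distrib_left[symmetric])
  have h_comb: "h (\<lambda>j. u j - q * v j) = h u - q * h v" for u v q
    by (simp add: h_def algebra_simps sum_subtractf sum_distrib_left)
  have ev_comb: "ev (\<lambda>j. u j - q * v j) = ev u / ev v powi q" for u v q
  proof -
    have "ev (\<lambda>j. u j - q * v j) = (\<Prod>j\<in>J. z j powi u j / (z j powi v j) powi q)"
      unfolding ev_def using insert.prems(2)
      by (intro prod.cong refl) (simp add: power_int_diff power_int_mult mult.commute[of q])
    then show ?thesis by (simp add: ev_def prod_dividef prod_power_int)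
  qed
  have ev_nz: "ev u \<noteq> 0" for u
    unfolding ev_def using insert.prems by (simp add: prod_zero_iff)
  have ev_0: "ev u = 1" if "rel u" "h u = 0" for u
    using insert.prems(3)[of u] that by (simp add: rel_def h_def ev_def)
  have "\<exists>(N::nat) v. rel v \<and> h v = int N \<and> (\<forall>u. rel u \<longrightarrow> int N dvd h u)"
  proof (cases "\<exists>u. rel u \<and> 0 < h u")
    case True
    define Pn where "Pn n \<longleftrightarrow> 0 < n \<and> (\<exists>u. rel u \<and> h u = int n)" for n :: nat
    obtain u0 where u0: "rel u0" "0 < h u0" using True by blast
    have "Pn (nat (h u0))" using u0 by (auto simp: Pn_def)
    then obtain N where "Pn N" and least: "\<And>m. m < N \<Longrightarrow> \<not> Pn m"
      using exists_least_iff[of Pn] by blast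
    then have N: "0 < N \<and> (\<exists>u. rel u \<and> h u = int N)" by (simp add: Pn_def)
    then obtain v where v: "rel v" "h v = int N" by blast
    have "int N dvd h u" if u: "rel u" for u
    proof (rule ccontr)
      assume "\<not> int N dvd h u"
      then have pos: "0 < h u mod int N" using N
        by (metis dvd_eq_mod_eq_0 of_nat_0_less_iff order_less_le pos_mod_sign)
      define u' where "u' = (\<lambda>j. u j - (h u div int N) * v j)"
      have "rel u'" unfolding u'_def using rel_comb u v(1) by blast
      moreover have "h u' = int (nat (h u mod int N))"
        unfolding u'_def h_comb v(2) using pos by (simp add: minus_div_mult_eq_mod)
      ultimately have "Pn (nat (h u mod int N))"
        using pos by (auto simp: Pn_def)
      then have "N \<le> nat (h u mod int N)" using least not_less by blast
      then show False using N pos_mod_bound[of "int N" "h u"] pos by linarith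
    qed
    then show ?thesis using v by blast
  next
    case False
    have "h u = 0" if "rel u" for u
    proof -
      have "rel (\<lambda>j. 0)" by (simp add: rel_def)
      then have "rel (\<lambda>j. 0 - 1 * u j)" using rel_comb that by blast
      then have "\<not> 0 < h (\<lambda>j. 0 - 1 * u j)" "\<not> 0 < h u" using False that by blast+
      moreover have "h (\<lambda>j. 0 - 1 * u j) = - h u" by (simp add: h_def sum_negf)
      ultimately show ?thesis by simp
    qed
    then show ?thesis
      by (intro exI[of _ 0] exI[of _ "\<lambda>_. 0"]) (auto simp: rel_def h_def)
  qed
  then obtain N :: nat and v where v: "rel v" "h v = int N" "\<And>u. rel u \<Longrightarrow> int N dvd h u" by blast
  \<comment> \<open>If \<open>N = 0\<close>, then \<open>v\<close> is also a relation for the new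
    coordinate, so \<open>ev v = 1\<close>; otherwise the fundamental theorem of algebra supplies
    the root.\<close>
  have "\<exists>s0. s0 \<noteq> 0 \<and> s0 ^ N = ev v"
  proof (cases "N = 0")
    case True
    then show ?thesis using ev_0[of v] v by (intro exI[of _ 1]) auto
  next
    case False
    then obtain s0 where "ev v = s0 ^ N" using exists_complex_root[of N "ev v"] by blast
    then show ?thesis using ev_nz[of v] False by (intro exI[of _ s0]) auto
  qed
  then obtain s0 where s0: "s0 \<noteq> 0" "s0 ^ N = ev v" by blast
  define z' where "z' j = z j / s0 powi a j \<omega>0" for j
  have "(\<Prod>j\<in>J. z' j powi u j) = 1" if "\<forall>\<omega>\<in>\<Omega>. (\<Sum>j\<in>J. u j * a j \<omega>) = 0" for u
  proof -
    have ru: "rel u" using that by (simp add: rel_def)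
    obtain q where q: "h u = int N * q" using v(3)[OF ru] by (auto elim: dvdE)
    have "ev (\<lambda>j. u j - q * v j) = 1"
      using ev_0 rel_comb[OF ru v(1), of q] h_comb[of u q v] q v(2) by simp
    then have "ev u = ev v powi q" using ev_nz by (simp add: ev_comb)
    also have "\<dots> = s0 powi h u"
      unfolding q s0(2)[symmetric] by (simp add: power_int_mult)
    also have "\<dots> = (\<Prod>j\<in>J. (s0 powi a j \<omega>0) powi u j)"
      unfolding h_def using s0(1)
      by (simp add: power_int_sum power_int_mult[symmetric] mult.commute)
    finally show ?thesis
      using s0(1) ev_nz[of u] by (simp add: z'_def power_int_divide_distrib prod_dividef ev_def)
  qed
  moreover have "z' j \<noteq> 0" if "j \<in> J" for j
    using that insert.prems(2) s0(1) by (simp add: z'_def)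
  ultimately obtain s where s: "\<forall>\<omega>. s \<omega> \<noteq> 0" "\<forall>j\<in>J. z' j = (\<Prod>\<omega>\<in>\<Omega>. s \<omega> powi a j \<omega>)"
    using insert.IH[of z'] insert.prems(1) by blast
  define s' where "s' = s(\<omega>0 := s0)"
  have "z j = (\<Prod>\<omega>\<in>insert \<omega>0 \<Omega>. s' \<omega> powi a j \<omega>)" if "j \<in> J" for j
  proof -
    have "(\<Prod>\<omega>\<in>\<Omega>. s' \<omega> powi a j \<omega>) = (\<Prod>\<omega>\<in>\<Omega>. s \<omega> powi a j \<omega>)"
      using insert.hyps by (intro prod.cong refl) (auto simp: s'_def)
    also have "\<dots> = z j / s0 powi a j \<omega>0" using s(2) that by (simp add: z'_def)
    finally show ?thesis using insert.hyps s0(1) by (simp add: s'_def)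
  qed
  moreover have "\<forall>\<omega>. s' \<omega> \<noteq> 0" using s(1) s0(1) by (simp add: s'_def)
  ultimately show ?case by blast
qed

section \<open>Integer linear forms and supporting weights of faces\<close>

definition int_closed :: "('w \<Rightarrow> int) set \<Rightarrow> bool" where
  "int_closed W \<longleftrightarrow> W \<noteq> {} \<and>
    (\<forall>w\<in>W. \<forall>w'\<in>W. \<forall>\<alpha> \<beta>. (\<lambda>x. \<alpha> * w x + \<beta> * w' x) \<in> W)"

definition int_linear :: "(('w \<Rightarrow> int) \<Rightarrow> int) \<Rightarrow> bool" where
  "int_linear L \<longleftrightarrow> (\<forall>w w' \<alpha> \<beta>. L (\<lambda>x. \<alpha> * w x + \<beta> * w' x) = \<alpha> * L w + \<beta> * L w')"

lemma int_closed_kernel: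
  assumes "int_closed W" "int_linear L"
  shows "int_closed {w\<in>W. L w = 0}"
proof -
  obtain w where "w \<in> W" using assms(1) by (auto simp: int_closed_def)
  then have "(\<lambda>x. 0 * w x + 0 * w x) \<in> W" "L (\<lambda>x. 0 * w x + 0 * w x) = 0"
    using assms unfolding int_closed_def int_linear_def by (blast, metis add_0 mult_zero_left)
  then show ?thesis using assms unfolding int_closed_def int_linear_def by auto
qed

text \<open>Gordan's theorem of the alternative for a group \<open>W\<close> of integer vectors. In
  the induction over the forms, \<open>W\<close> varies because the step passes to the kernel of the
  new form.\<close>

lemma gordan_int:
  assumes "finite J" "\<And>j. j \<in> J \<Longrightarrow> int_linear (L j)" "int_closed W"
  shows "(\<exists>w\<in>W. \<forall>j\<in>J. 0 < L j w) \<or>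
    (\<exists>y. (\<forall>j\<in>J. 0 \<le> y j) \<and> (\<exists>j\<in>J. 0 < y j) \<and> (\<forall>w\<in>W. (\<Sum>j\<in>J. y j * L j w) = 0))"
  using assms
proof (induction J arbitrary: W rule: finite_induct)
  case empty
  then show ?case by (auto simp: int_closed_def)
next
  case (insert i J)
  note lin = insert.prems(1)
  have comb: "L j (\<lambda>x. \<alpha> * w x + \<beta> * w' x) = \<alpha> * L j w + \<beta> * L j w'" if "j \<in> insert i J" for j w w' \<alpha> \<beta>
    using lin[OF that] by (simp add: int_linear_def)
  have Wcomb: "(\<lambda>x. \<alpha> * w x + \<beta> * w' x) \<in> W" if "w \<in> W" "w' \<in> W" for w w' \<alpha> \<beta>
    using insert.prems(2) that by (simp add: int_closed_def)
  show ?case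
  proof (rule disjCI, rule ccontr)
    assume noy: "\<not> (\<exists>y. (\<forall>j\<in>insert i J. 0 \<le> y j) \<and> (\<exists>j\<in>insert i J. 0 < y j) \<and>
        (\<forall>w\<in>W. (\<Sum>j\<in>insert i J. y j * L j w) = 0))"
      and now: "\<not> (\<exists>w\<in>W. \<forall>j\<in>insert i J. 0 < L j w)"
    \<comment> \<open>A large multiple of \<open>w\<close> keeps the forms in \<open>J\<close>
      positive, while adding \<open>w'\<close> makes the form \<open>i\<close> positive.\<close>
    have perturb: False if "w \<in> W" "w' \<in> W" "\<forall>j\<in>J. 0 < L j w" "L i w = 0" "0 < L i w'" for w w'
    proof -
      define K where "K = 1 + (\<Sum>j\<in>J. \<bar>L j w'\<bar>)"
      have "0 < K * L j w + 1 * L j w'" if "j \<in> J" for j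
      proof -
        have "\<bar>L j w'\<bar> \<le> (\<Sum>j\<in>J. \<bar>L j w'\<bar>)" using that insert.hyps by (intro member_le_sum) auto
        then have "\<bar>L j w'\<bar> < K" by (simp add: K_def)
        moreover have "K * 1 \<le> K * L j w"
          using \<open>\<forall>j\<in>J. 0 < L j w\<close> that
          by (intro mult_left_mono) (auto simp: K_def sum_nonneg int_one_le_iff_zero_less)
        ultimately show ?thesis by linarith
      qed
      then have "\<forall>j\<in>insert i J. 0 < K * L j w + 1 * L j w'"
        using that(4,5) by auto
      then have "\<forall>j\<in>insert i J. 0 < L j (\<lambda>x. K * w x + 1 * w' x)"
        using comb[of _ K w 1 w'] by simp
      then show False using now Wcomb[OF that(1,2)] by blast
    qed
    obtain w1 where w1: "w1 \<in> W" "\<forall>j\<in>J. 0 < L j w1"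
    proof -
      have "\<not> (\<exists>y. (\<forall>j\<in>J. 0 \<le> y j) \<and> (\<exists>j\<in>J. 0 < y j) \<and> (\<forall>w\<in>W. (\<Sum>j\<in>J. y j * L j w) = 0))"
      proof
        assume "\<exists>y. (\<forall>j\<in>J. 0 \<le> y j) \<and> (\<exists>j\<in>J. 0 < y j) \<and> (\<forall>w\<in>W. (\<Sum>j\<in>J. y j * L j w) = 0)"
        then obtain y where y: "\<forall>j\<in>J. 0 \<le> y j" "\<exists>j\<in>J. 0 < y j" "\<forall>w\<in>W. (\<Sum>j\<in>J. y j * L j w) = 0" by blast
        have "(\<Sum>j\<in>insert i J. (y(i := 0)) j * L j w) = (\<Sum>j\<in>J. y j * L j w)" for w
          using insert.hyps by (auto intro!: sum.cong)
        then have "\<forall>w\<in>W. (\<Sum>j\<in>insert i J. (y(i := 0)) j * L j w) = 0" using y(3) by simp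
        moreover have "\<forall>j\<in>insert i J. 0 \<le> (y(i := 0)) j" using y(1) by simp
        moreover have "\<exists>j\<in>insert i J. 0 < (y(i := 0)) j" using y(2) insert.hyps(2) by auto
        ultimately show False using noy by blast
      qed
      then show ?thesis using insert.IH[OF lin insert.prems(2)] that by blast
    qed
    obtain w0 where w0: "w0 \<in> W" "0 < L i w0"
    proof -
      have "\<not> (\<forall>w\<in>W. L i w = 0)"
      proof
        assume "\<forall>w\<in>W. L i w = 0"
        then have "\<forall>w\<in>W. (\<Sum>j\<in>insert i J. (if j = i then 1 else 0) * L j w) = 0"
          using insert.hyps by (auto intro!: sum.neutral)
        moreover have "\<forall>j\<in>insert i J. (0::int) \<le> (if j = i then 1 else 0)"
          "\<exists>j\<in>insert i J. (0::int) < (if j = i then 1 else 0)" by auto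
        ultimately show False
          using noy not_ex[THEN iffD1, OF noy, THEN spec, of "\<lambda>j. if j = i then 1 else 0"] by blast
      qed
      then obtain w where "w \<in> W" "L i w \<noteq> 0" by blast
      moreover have "L i (\<lambda>x. (- 1) * w x + 0 * w x) = - L i w" by (subst comb) auto
      ultimately show ?thesis using that[of w] that[OF Wcomb[of w w "- 1" 0]] by linarith
    qed
    have "L i w1 < 0"
      using now w1 perturb[OF w1(1) w0(1) w1(2) _ w0(2)] by force
    define W' where "W' = {w\<in>W. L i w = 0}"
    have "int_closed W'" unfolding W'_def using insert.prems by (intro int_closed_kernel) auto
    moreover have "\<not> (\<exists>w\<in>W'. \<forall>j\<in>J. 0 < L j w)"
      using perturb[OF _ w0(1) _ _ w0(2)] by (auto simp: W'_def)
    ultimately obtain y where y: "\<forall>j\<in>J. 0 \<le> y j" "\<exists>j\<in>J. 0 < y j"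
      "\<And>w. w \<in> W' \<Longrightarrow> (\<Sum>j\<in>J. y j * L j w) = 0"
      using insert.IH[of W'] lin by blast
    define S where "S w = (\<Sum>j\<in>J. y j * L j w)" for w
    \<comment> \<open>\<open>S\<close> vanishes on the kernel of \<open>L i\<close>, so it is
      proportional to \<open>L i\<close> on \<open>W\<close>. Since
      \<open>L i w1 < 0 < S w1\<close>, the factor is negative, and moving \<open>L i\<close> to the
      other side gives it a positive coefficient.\<close>
    have S: "L i w0 * S w = L i w * S w0" if "w \<in> W" for w
    proof -
      have "(\<lambda>x. L i w0 * w x + (- L i w) * w0 x) \<in> W'"
        using Wcomb[OF that w0(1), of "L i w0" "- L i w"] comb[of i "L i w0" w "- L i w" w0] by (simp add: W'_def)
      then have "S (\<lambda>x. L i w0 * w x + (- L i w) * w0 x) = 0" using y(3) by (simp add: S_def)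
      moreover have "S (\<lambda>x. L i w0 * w x + (- L i w) * w0 x) = L i w0 * S w + (- L i w) * S w0"
      proof -
        have "S (\<lambda>x. L i w0 * w x + (- L i w) * w0 x) = (\<Sum>j\<in>J. y j * (L i w0 * L j w + (- L i w) * L j w0))"
          unfolding S_def by (intro sum.cong refl arg_cong2[of _ _ _ _ times] comb) simp
        also have "\<dots> = L i w0 * S w + (- L i w) * S w0"
          unfolding S_def by (simp add: algebra_simps sum_subtractf sum_distrib_left sum_negf)
        finally show ?thesis .
      qed
      ultimately show ?thesis by simp
    qed
    have "0 < S w1"
    proof -
      obtain j where "j \<in> J" "0 < y j" using y(2) by blast
      then show ?thesis unfolding S_def using y(1) w1(2) insert.hyps
        by (intro sum_pos2[of J j]) (auto intro: mult_nonneg_nonneg less_imp_le)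
    qed
    then have "0 < L i w1 * S w0" using S[OF w1(1)] w0(2) by (metis mult_pos_pos)
    then have S0: "S w0 < 0" using \<open>L i w1 < 0\<close> by (simp add: zero_less_mult_iff)
    define y' where "y' j = (if j = i then - S w0 else L i w0 * y j)" for j
    have "(\<Sum>j\<in>insert i J. y' j * L j w) = 0" if "w \<in> W" for w
    proof -
      have "(\<Sum>j\<in>J. y' j * L j w) = L i w0 * S w"
        unfolding S_def sum_distrib_left using insert.hyps by (intro sum.cong) (auto simp: y'_def)
      then show ?thesis using insert.hyps S[OF that] by (simp add: y'_def)
    qed
    moreover have "\<forall>j\<in>insert i J. 0 \<le> y' j" using y(1) w0(2) S0 by (auto simp: y'_def)
    moreover have "\<exists>j\<in>insert i J. 0 < y' j" using S0 by (auto simp: y'_def)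
    ultimately show False using noy by blast
  qed
qed

text \<open>A form vanishing on the common kernel of finitely many others is a rational combination
  of them; \<open>N\<close> is a common denominator.\<close>

lemma int_kernel_combination:
  assumes "finite F" "\<And>f. f \<in> F \<Longrightarrow> int_linear (L f)" "int_linear M" "int_closed W"
    "\<And>w. w \<in> W \<Longrightarrow> (\<forall>f\<in>F. L f w = 0) \<Longrightarrow> M w = 0"
  shows "\<exists>N z. N \<noteq> 0 \<and> (\<forall>w\<in>W. N * M w = (\<Sum>f\<in>F. z f * L f w))"
  using assms
proof (induction F arbitrary: W rule: finite_induct)
  case empty
  then show ?case by (intro exI[of _ 1]) auto
next
  case (insert g F)
  define W' where "W' = {w\<in>W. L g w = 0}"
  have "int_closed W'" unfolding W'_def using insert.prems by (intro int_closed_kernel) auto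
  then obtain N z where Nz: "N \<noteq> 0" "\<And>w. w \<in> W' \<Longrightarrow> N * M w = (\<Sum>f\<in>F. z f * L f w)"
    using insert.IH[of W'] insert.prems unfolding W'_def by auto
  define S where "S w = (\<Sum>f\<in>F. z f * L f w)" for w
  show ?case
  proof (cases "\<forall>w\<in>W. L g w = 0")
    case True
    have "N * M w = (\<Sum>f\<in>insert g F. (z(g := 0)) f * L f w)" if "w \<in> W" for w
    proof -
      have "(\<Sum>f\<in>insert g F. (z(g := 0)) f * L f w) = (\<Sum>f\<in>F. z f * L f w)"
        using insert.hyps by (auto intro!: sum.cong)
      then show ?thesis using Nz(2)[of w] that True by (simp add: W'_def)
    qed
    then show ?thesis using Nz(1) by blast
  next
    case False
    then obtain w0 where w0: "w0 \<in> W" "L g w0 \<noteq> 0" by blast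
    have lin: "L f (\<lambda>x. \<alpha> * w x + \<beta> * w' x) = \<alpha> * L f w + \<beta> * L f w'" if "f \<in> insert g F" for f w w' \<alpha> \<beta>
      using insert.prems(1)[OF that] by (simp add: int_linear_def)
    have key: "(N * L g w0) * M w = L g w0 * S w + (N * M w0 - S w0) * L g w" if "w \<in> W" for w
    proof -
      let ?v = "\<lambda>x. L g w0 * w x + (- L g w) * w0 x"
      have "?v \<in> W" using insert.prems(3) that w0(1) unfolding int_closed_def by blast
      moreover have "L g ?v = 0" by (subst lin) auto
      ultimately have "?v \<in> W'" by (simp only: W'_def mem_Collect_eq conj_commute) 
      then have "N * M ?v = S ?v" using Nz(2) by (simp add: S_def)
      moreover have "M ?v = L g w0 * M w + (- L g w) * M w0"
        using insert.prems(2) unfolding int_linear_def by blast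
      moreover have "S ?v = L g w0 * S w + (- L g w) * S w0"
      proof -
        have "S ?v = (\<Sum>f\<in>F. z f * (L g w0 * L f w + (- L g w) * L f w0))"
          unfolding S_def by (intro sum.cong refl arg_cong2[of _ _ _ _ times] lin) simp
        also have "\<dots> = L g w0 * S w + (- L g w) * S w0"
          unfolding S_def by (simp add: algebra_simps sum_subtractf sum_distrib_left sum_negf)
        finally show ?thesis .
      qed
      ultimately have "N * (L g w0 * M w + (- L g w) * M w0) = L g w0 * S w + (- L g w) * S w0" by simp
      then show ?thesis by (simp add: algebra_simps)
    qed
    define z' where "z' f = (if f = g then N * M w0 - S w0 else L g w0 * z f)" for f
    have "(N * L g w0) * M w = (\<Sum>f\<in>insert g F. z' f * L f w)" if "w \<in> W" for w
    proof -
      have "(\<Sum>f\<in>F. z' f * L f w) = L g w0 * S w"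
        unfolding S_def sum_distrib_left using insert.hyps by (intro sum.cong) (auto simp: z'_def)
      then show ?thesis using insert.hyps key[OF that] by (simp add: z'_def)
    qed
    then show ?thesis using Nz(1) w0(2) by (intro exI[of _ "N * L g w0"] exI[of _ z']) auto
  qed
qed

text \<open>By Gordan's alternative, failure yields a nonnegative nonzero combination of the vectors
  \<open>a j\<close> outside \<open>F\<close> that vanishes on every weight killing
  \<open>F\<close>. It is then a rational combination of the vectors in \<open>F\<close>. With
  denominators cleared this is a relation whose right side uses only \<open>F\<close> and whose left
  side does not, against \<open>rel\<close>.\<close>

lemma supporting_weight:
  fixes a :: "'j \<Rightarrow> 'w \<Rightarrow> int"
  assumes fin: "finite \<Omega>" "finite J" "F \<subseteq> J"
    and rel: "\<And>u v :: 'j \<Rightarrow> nat. (\<forall>\<omega>\<in>\<Omega>. (\<Sum>j\<in>J. int (u j) * a j \<omega>) = (\<Sum>j\<in>J. int (v j) * a j \<omega>)) \<Longrightarrow>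
      (\<forall>j\<in>J - F. v j = 0) \<Longrightarrow> (\<forall>j\<in>J - F. u j = 0)"
  shows "\<exists>w. (\<forall>j\<in>F. (\<Sum>\<omega>\<in>\<Omega>. a j \<omega> * w \<omega>) = 0) \<and> (\<forall>j\<in>J - F. 0 < (\<Sum>\<omega>\<in>\<Omega>. a j \<omega> * w \<omega>))"
proof -
  define L where "L j w = (\<Sum>\<omega>\<in>\<Omega>. a j \<omega> * w \<omega>)" for j w
  have lin: "int_linear (L j)" for j
    by (auto simp: int_linear_def L_def algebra_simps sum.distrib sum_distrib_left)
  define W where "W = {w. \<forall>j\<in>F. L j w = 0}"
  have "(\<lambda>_. 0) \<in> W" by (simp add: W_def L_def)
  then have W: "int_closed W"
    using lin unfolding int_closed_def W_def int_linear_def by auto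
  have finF: "finite F" using fin finite_subset by blast
  have "\<not> (\<exists>y. (\<forall>j\<in>J - F. 0 \<le> y j) \<and> (\<exists>j\<in>J - F. 0 < y j) \<and> (\<forall>w\<in>W. (\<Sum>j\<in>J - F. y j * L j w) = 0))"
  proof
    assume "\<exists>y. (\<forall>j\<in>J - F. 0 \<le> y j) \<and> (\<exists>j\<in>J - F. 0 < y j) \<and> (\<forall>w\<in>W. (\<Sum>j\<in>J - F. y j * L j w) = 0)"
    then obtain y where y: "\<forall>j\<in>J - F. 0 \<le> y j" "\<exists>j\<in>J - F. 0 < y j" "\<forall>w\<in>W. (\<Sum>j\<in>J - F. y j * L j w) = 0"
      by blast
    define M where "M w = (\<Sum>j\<in>J - F. y j * L j w)" for w
    have linM: "int_linear M"
      using lin by (auto simp: int_linear_def M_def algebra_simps sum.distrib sum_distrib_left)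
    have "int_closed (UNIV :: ('w \<Rightarrow> int) set)" by (simp add: int_closed_def)
    then obtain N0 z0 where Nz0: "N0 \<noteq> 0" "\<And>w. N0 * M w = (\<Sum>f\<in>F. z0 f * L f w)"
      using int_kernel_combination[OF finF, of L M UNIV] lin linM y(3) by (auto simp: W_def M_def)
    define N z where "N = \<bar>N0\<bar>" and "z f = sgn N0 * z0 f" for f
    have N: "0 < N" using Nz0(1) by (simp add: N_def)
    have Nz: "N * M w = (\<Sum>f\<in>F. z f * L f w)" for w
    proof -
      have "N * M w = sgn N0 * (N0 * M w)" by (simp add: N_def abs_sgn mult_ac)
      also have "\<dots> = (\<Sum>f\<in>F. z f * L f w)"
        unfolding Nz0(2) sum_distrib_left z_def by (simp add: mult_ac)
      finally show ?thesis .
    qed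
    have coord: "L j (\<lambda>x. if x = \<omega> then 1 else 0) = a j \<omega>" if "\<omega> \<in> \<Omega>" for j \<omega>
      unfolding L_def using that fin(1) by (simp add: if_distrib[of "\<lambda>b. _ * b"] cong: if_cong)
    \<comment> \<open>Coefficients on \<open>F\<close> may have either sign; negative ones move to
      the side of \<open>u\<close>, so that both exponent vectors are natural.\<close>
    define u where "u j = (if j \<in> F then nat (- z j) else nat (N * y j))" for j
    define v where "v j = (if j \<in> F then nat (z j) else 0)" for j
    have "(\<Sum>j\<in>J. int (u j) * a j \<omega>) = (\<Sum>j\<in>J. int (v j) * a j \<omega>)" if \<omega>: "\<omega> \<in> \<Omega>" for \<omega>
    proof -
      have split: "(\<Sum>j\<in>J. g j) = (\<Sum>j\<in>J - F. g j) + (\<Sum>j\<in>F. g j)" for g :: "'j \<Rightarrow> int"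
        using fin by (intro sum.subset_diff)
      have "(\<Sum>j\<in>J - F. int (u j) * a j \<omega>) = (\<Sum>j\<in>J - F. N * (y j * a j \<omega>))"
        using y(1) N by (intro sum.cong refl) (auto simp: u_def)
      also have "\<dots> = (\<Sum>f\<in>F. z f * a f \<omega>)"
        using Nz[of "\<lambda>x. if x = \<omega> then 1 else 0"] by (simp add: M_def coord[OF \<omega>] sum_distrib_left)
      finally have 1: "(\<Sum>j\<in>J - F. int (u j) * a j \<omega>) = (\<Sum>f\<in>F. z f * a f \<omega>)" .
      have 2: "(\<Sum>j\<in>F. int (v j) * a j \<omega>) - (\<Sum>j\<in>F. int (u j) * a j \<omega>) = (\<Sum>f\<in>F. z f * a f \<omega>)"
        unfolding sum_subtractf[symmetric] by (intro sum.cong refl) (auto simp: u_def v_def left_diff_distrib[symmetric])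
      have 3: "(\<Sum>j\<in>J - F. int (v j) * a j \<omega>) = 0" by (intro sum.neutral) (auto simp: v_def)
      show ?thesis using split[of "\<lambda>j. int (u j) * a j \<omega>"] split[of "\<lambda>j. int (v j) * a j \<omega>"] 1 2 3 by linarith
    qed
    then have "\<forall>j\<in>J - F. u j = 0" using rel[of u v] by (auto simp: v_def)
    moreover obtain j where j: "j \<in> J - F" "0 < y j" using y(2) by blast
    ultimately have "nat (N * y j) = 0" by (auto simp: u_def)
    then have "N * y j \<le> 0" by simp
    moreover have "0 < N * y j" using N j(2) by (rule mult_pos_pos)
    ultimately show False by simp
  qed
  then obtain w where "w \<in> W" "\<forall>j\<in>J - F. 0 < L j w"
    using gordan_int[of "J - F" L W] lin W fin(2) by blast
  then show ?thesis unfolding W_def L_def by blast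
qed

section \<open>Noetherian rings and spaces\<close>

definition subring :: "'a::comm_ring_1 set \<Rightarrow> bool" where
  "subring A \<longleftrightarrow> 0 \<in> A \<and> 1 \<in> A \<and> (\<forall>x\<in>A. \<forall>y\<in>A. x + y \<in> A \<and> x * y \<in> A) \<and> (\<forall>x\<in>A. - x \<in> A)"

text \<open>The ascending chain condition in terms of sequences of elements. It is stated for
  subsets of a ring so that variables can be adjoined one at a time inside a fixed type.\<close>

definition noetherian_subring :: "'a::comm_ring_1 set \<Rightarrow> bool" where
  "noetherian_subring A \<longleftrightarrow> subring A \<and> (\<forall>f :: nat \<Rightarrow> 'a. range f \<subseteq> A \<longrightarrow>
    (\<exists>m c. (\<forall>i<m. c i \<in> A) \<and> f m = (\<Sum>i<m. c i * f i)))"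

lemma subring_sum: "subring A \<Longrightarrow> (\<And>b. b \<in> B \<Longrightarrow> f b \<in> A) \<Longrightarrow> (\<Sum>b\<in>B. f b) \<in> A"
  by (induction B rule: infinite_finite_induct) (auto simp: subring_def)

definition polys_over :: "'a::comm_ring_1 set \<Rightarrow> 'a poly set" where
  "polys_over A = {p. \<forall>i. coeff p i \<in> A}"

lemma subring_polys_over:
  assumes "subring A"
  shows "subring (polys_over A)"
proof -
  have "coeff (p * q) i \<in> A" if "\<forall>i. coeff p i \<in> A" "\<forall>i. coeff q i \<in> A" for p q i
    unfolding coeff_mult using assms that by (intro subring_sum) (auto simp: subring_def)
  then show ?thesis using assms by (auto simp: subring_def polys_over_def)
qed

lemma monom_polys_over: "subring A \<Longrightarrow> a \<in> A \<Longrightarrow> monom a n \<in> polys_over A"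
  by (auto simp: polys_over_def subring_def)

definition combos :: "'a::comm_ring_1 set \<Rightarrow> nat \<Rightarrow> (nat \<Rightarrow> 'a) \<Rightarrow> 'a set" where
  "combos A n g = {\<Sum>i<n. c i * g i | c. \<forall>i<n. c i \<in> A}"

lemma combos_add:
  assumes "subring A" "x \<in> combos A n g" "y \<in> combos A n g"
  shows "x + y \<in> combos A n g"
proof -
  obtain c d where "x = (\<Sum>i<n. c i * g i)" "\<forall>i<n. c i \<in> A" "y = (\<Sum>i<n. d i * g i)" "\<forall>i<n. d i \<in> A"
    using assms(2,3) by (auto simp: combos_def)
  then have "x + y = (\<Sum>i<n. (c i + d i) * g i)" "\<forall>i<n. c i + d i \<in> A"
    using assms(1) by (auto simp: distrib_right sum.distrib subring_def)
  then show ?thesis unfolding combos_def by (intro CollectI exI[of _ "\<lambda>i. c i + d i"] conjI)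
qed

lemma combos_scale:
  assumes "subring A" "x \<in> combos A n g" "a \<in> A"
  shows "a * x \<in> combos A n g"
proof -
  obtain c where "x = (\<Sum>i<n. c i * g i)" "\<forall>i<n. c i \<in> A"
    using assms(2) by (auto simp: combos_def)
  then have "a * x = (\<Sum>i<n. (a * c i) * g i)" "\<forall>i<n. a * c i \<in> A"
    using assms by (auto simp: sum_distrib_left mult.assoc subring_def)
  then show ?thesis unfolding combos_def by (intro CollectI exI[of _ "\<lambda>i. a * c i"] conjI)
qed

lemma combos_mono:
  assumes "subring A" "m \<le> n"
  shows "combos A m g \<subseteq> combos A n g"
proof
  fix x assume "x \<in> combos A m g"
  then obtain c where c: "x = (\<Sum>i<m. c i * g i)" "\<forall>i<m. c i \<in> A" by (auto simp: combos_def)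
  define d where "d i = (if i < m then c i else 0)" for i
  have "(\<Sum>i<m. c i * g i) = (\<Sum>i<n. d i * g i)"
    using assms(2) by (intro sum.mono_neutral_cong_left) (auto simp: d_def)
  moreover have "\<forall>i<n. d i \<in> A" using c(2) assms(1) by (auto simp: d_def subring_def)
  ultimately show "x \<in> combos A n g" using c(1) unfolding combos_def by blast
qed

text \<open>The classical proof of Hilbert's basis theorem: a sequence of elements of minimal degree
  outside the ideals generated by their predecessors has leading coefficients violating the
  Noetherian condition for \<open>A\<close>.\<close>

lemma hilbert_basis:
  assumes A: "noetherian_subring A"
    and P: "P \<subseteq> polys_over A" "\<And>p q. p \<in> P \<Longrightarrow> q \<in> P \<Longrightarrow> p + q \<in> P"
      "\<And>p q. p \<in> P \<Longrightarrow> q \<in> polys_over A \<Longrightarrow> q * p \<in> P"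
  shows "\<exists>n g. (\<forall>i<n. g i \<in> P) \<and> P \<subseteq> combos (polys_over A) n g"
proof (rule ccontr)
  assume neg: "\<not> ?thesis"
  let ?PA = "polys_over A"
  have sA: "subring A" using A by (simp add: noetherian_subring_def)
  have sPA: "subring ?PA" by (rule subring_polys_over[OF sA])
  define R where "R g n r \<longleftrightarrow> r \<in> P \<and> r \<notin> combos ?PA n g \<and>
    (\<forall>q\<in>P. q \<notin> combos ?PA n g \<longrightarrow> degree r \<le> degree q)" for g n r
  have "\<exists>g. \<forall>n. R g n (g n)"
  proof (rule dependent_wellorder_choice)
    fix r n and f g :: "nat \<Rightarrow> 'a poly" assume "\<And>i. i < n \<Longrightarrow> f i = g i"
    then have "combos ?PA n f = combos ?PA n g"
      unfolding combos_def by (metis (no_types, lifting) lessThan_iff sum.cong)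
    then show "R f n r = R g n r" by (simp add: R_def)
  next
    fix n and f :: "nat \<Rightarrow> 'a poly" assume f: "\<And>i. i < n \<Longrightarrow> R f i (f i)"
    define B where "B = {p\<in>P. p \<notin> combos ?PA n f}"
    have "B \<noteq> {}" using neg f unfolding B_def R_def by blast
    then obtain r where "r \<in> B" "\<forall>q\<in>B. degree r \<le> degree q"
      using ex_has_least_nat[of "\<lambda>p. p \<in> B" _ degree] by blast
    then show "\<exists>r. R f n r" unfolding R_def B_def by blast
  qed
  then obtain g where g: "\<And>n. g n \<in> P" "\<And>n. g n \<notin> combos ?PA n g"
    "\<And>n q. q \<in> P \<Longrightarrow> q \<notin> combos ?PA n g \<Longrightarrow> degree (g n) \<le> degree q"
    unfolding R_def by blast
  have deg: "degree (g i) \<le> degree (g m)" if "i \<le> m" for i m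
    using g(3)[OF g(1)] g(2)[of m] combos_mono[OF sPA that] by blast
  have "range (\<lambda>i. lead_coeff (g i)) \<subseteq> A" using g(1) P(1) by (auto simp: polys_over_def)
  then obtain m c where c: "\<forall>i<m. c i \<in> A" "lead_coeff (g m) = (\<Sum>i<m. c i * lead_coeff (g i))"
    using A unfolding noetherian_subring_def by blast
  define e where "e i = monom (c i) (degree (g m) - degree (g i))" for i
  define s where "s = (\<Sum>i<m. e i * g i)"
  \<comment> \<open>The summands \<open>e i * g i\<close> are shifted to the degree of
    \<open>g m\<close>, so that \<open>q\<close> loses the leading term. Subtraction is written as a
    multiplication because \<open>P\<close> is only given as closed under sums and
    multiples.\<close>
  define q where "q = g m + monom (- 1) 0 * s"
  have q: "q = g m - s" by (simp add: q_def minus_monom[symmetric] one_pCons[symmetric] monom_0)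
  have ePA: "e i \<in> ?PA" if "i < m" for i
    unfolding e_def using c(1) that by (intro monom_polys_over[OF sA]) auto
  have sc: "s \<in> combos ?PA m g" unfolding s_def combos_def using ePA by blast
  have m1: "monom (- 1) 0 \<in> ?PA" using sA by (intro monom_polys_over[OF sA]) (auto simp: subring_def)
  have z: "0 \<in> P" using P(3)[OF g(1)[of 0], of 0] sPA by (auto simp: subring_def)
  have sP: "s \<in> P"
  proof -
    have "(\<Sum>i\<in>B. e i * g i) \<in> P" if "finite B" "B \<subseteq> {..<m}" for B
      using that by (induction B rule: finite_induct) (auto simp: z intro!: P(2,3) g(1) ePA)
    then show ?thesis by (simp add: s_def)
  qed
  have qP: "q \<in> P" unfolding q_def by (intro P(2,3) g(1) m1 sP)
  have qn: "q \<notin> combos ?PA m g"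
  proof
    assume "q \<in> combos ?PA m g"
    then have "q + s \<in> combos ?PA m g" using sc by (intro combos_add[OF sPA])
    then show False using g(2)[of m] q by simp
  qed
  have "degree (e i * g i) \<le> degree (g m)" if "i < m" for i
    using degree_mult_le[of "e i" "g i"] degree_monom_le[of "c i" "degree (g m) - degree (g i)"] deg[of i m] that
    unfolding e_def by simp
  then have "degree s \<le> degree (g m)" unfolding s_def by (intro degree_sum_le) auto
  then have dq: "degree q \<le> degree (g m)" unfolding q by (intro degree_diff_le) auto
  have "coeff s (degree (g m)) = (\<Sum>i<m. c i * lead_coeff (g i))"
    unfolding s_def coeff_sum e_def using deg by (intro sum.cong refl) (simp add: coeff_monom_mult)
  then have "coeff q (degree (g m)) = 0" using c(2) by (simp add: q)
  moreover have "degree q = degree (g m)" using dq g(3)[OF qP qn] by simp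
  ultimately have "q = 0" by (metis leading_coeff_0_iff)
  moreover have "0 \<in> combos ?PA m g"
    unfolding combos_def using sPA by (auto simp: subring_def intro!: exI[of _ "\<lambda>_. 0"])
  ultimately show False using qn by simp
qed

definition adjoin :: "'a::comm_ring_1 set \<Rightarrow> 'a \<Rightarrow> 'a set" where
  "adjoin A x = {poly p x | p. p \<in> polys_over A}"

text \<open>The ideals generated by the initial segments of \<open>f\<close> pull back along
  evaluation at \<open>x\<close> to one ideal \<open>P\<close> of polynomials over \<open>A\<close>.
  Its finitely many generators all occur at a common stage \<open>m\<close>, so \<open>f m\<close>
  is already a combination of its predecessors.\<close>

lemma noetherian_adjoin:
  assumes A: "noetherian_subring A"
  shows "noetherian_subring (adjoin A x)"
proof -
  have sA: "subring A" using A by (simp add: noetherian_subring_def)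
  have sPA: "subring (polys_over A)" by (rule subring_polys_over[OF sA])
  let ?B = "adjoin A x"
  have sB: "subring ?B"
    unfolding subring_def
  proof (intro conjI ballI)
    show "0 \<in> ?B" "1 \<in> ?B"
      using sPA unfolding adjoin_def subring_def by (force intro: exI[of _ 0], force intro: exI[of _ 1])
    fix a assume "a \<in> ?B"
    then obtain p where p: "a = poly p x" "p \<in> polys_over A" by (auto simp: adjoin_def)
    then have "- a = poly (- p) x" "- p \<in> polys_over A" using sPA by (auto simp: subring_def)
    then show "- a \<in> ?B" unfolding adjoin_def by blast
    fix b assume "b \<in> ?B"
    then obtain q where q: "b = poly q x" "q \<in> polys_over A" by (auto simp: adjoin_def)
    have "a + b = poly (p + q) x" "p + q \<in> polys_over A" "a * b = poly (p * q) x" "p * q \<in> polys_over A"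
      using p q sPA by (auto simp: subring_def)
    then show "a + b \<in> ?B" "a * b \<in> ?B" unfolding adjoin_def by blast+
  qed
  have "\<exists>m c. (\<forall>i<m. c i \<in> ?B) \<and> f m = (\<Sum>i<m. c i * f i)" if f: "range f \<subseteq> ?B" for f :: "nat \<Rightarrow> 'a"
  proof -
    define P where "P = {p\<in>polys_over A. \<exists>m. poly p x \<in> combos ?B m f}"
    have "\<exists>n g. (\<forall>i<n. g i \<in> P) \<and> P \<subseteq> combos (polys_over A) n g"
    proof (rule hilbert_basis[OF A])
      fix p q assume "p \<in> P" "q \<in> P"
      then obtain m k where pq: "p \<in> polys_over A" "q \<in> polys_over A"
        "poly p x \<in> combos ?B m f" "poly q x \<in> combos ?B k f" by (auto simp: P_def)
      then have "poly p x \<in> combos ?B (max m k) f" "poly q x \<in> combos ?B (max m k) f"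
        using combos_mono[OF sB, of m "max m k" f] combos_mono[OF sB, of k "max m k" f] by auto
      then have "poly (p + q) x \<in> combos ?B (max m k) f" by (simp add: combos_add[OF sB])
      then show "p + q \<in> P" using pq(1,2) sPA unfolding P_def subring_def by blast
    next
      fix p q assume p: "p \<in> P" and q: "q \<in> polys_over A"
      then obtain m where "poly p x \<in> combos ?B m f" by (auto simp: P_def)
      moreover have "poly q x \<in> ?B" using q by (auto simp: adjoin_def)
      ultimately have "poly (q * p) x \<in> combos ?B m f" by (simp add: combos_scale[OF sB])
      then show "q * p \<in> P" using p q sPA unfolding P_def subring_def by blast
    qed (auto simp: P_def)
    then obtain n g where g: "\<And>i. i < n \<Longrightarrow> g i \<in> P" "P \<subseteq> combos (polys_over A) n g" by blast
    have "\<exists>m. \<forall>i<n. poly (g i) x \<in> combos ?B m f"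
    proof -
      have "\<forall>i. \<exists>m. i < n \<longrightarrow> poly (g i) x \<in> combos ?B m f" using g(1) by (auto simp: P_def)
      then obtain k where k: "\<And>i. i < n \<Longrightarrow> poly (g i) x \<in> combos ?B (k i) f" by metis
      have "k i \<le> Max (insert 0 (k ` {..<n}))" if "i < n" for i
        using that by (intro Max_ge) auto
      then show ?thesis using k combos_mono[OF sB] by blast
    qed
    then obtain m where m: "\<And>i. i < n \<Longrightarrow> poly (g i) x \<in> combos ?B m f" by blast
    obtain p where p: "f m = poly p x" "p \<in> polys_over A" using f by (auto simp: adjoin_def)
    have "1 \<in> ?B" using sB by (simp add: subring_def)
    then have "f m \<in> combos ?B (Suc m) f"
      using sB unfolding combos_def subring_def
      by (auto intro!: exI[of _ "\<lambda>i. if i = m then 1 else 0"] simp: if_distrib[of "\<lambda>a. a * _"] cong: if_cong)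
    then have "p \<in> P" unfolding P_def using p by auto
    then obtain c where c: "p = (\<Sum>i<n. c i * g i)" "\<forall>i<n. c i \<in> polys_over A"
      using g(2) by (auto simp: combos_def)
    have fm: "f m = (\<Sum>i<n. poly (c i) x * poly (g i) x)" by (simp add: p(1) c(1) poly_sum)
    have "(\<Sum>i\<in>I. poly (c i) x * poly (g i) x) \<in> combos ?B m f" if "finite I" "I \<subseteq> {..<n}" for I
      using that
    proof (induction I rule: finite_induct)
      case empty
      then show ?case using sB by (auto simp: combos_def subring_def intro!: exI[of _ "\<lambda>_. 0"])
    next
      case (insert i I)
      then have "poly (c i) x \<in> ?B" using c(2) by (auto simp: adjoin_def)
      then show ?case using insert m combos_add[OF sB] combos_scale[OF sB] by auto
    qed
    then have "f m \<in> combos ?B m f" unfolding fm by blast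
    then show ?thesis unfolding combos_def by blast
  qed
  then show ?thesis using sB by (simp add: noetherian_subring_def)
qed

lemma adjoin_superset:
  assumes "subring A"
  shows "A \<subseteq> adjoin A x" "x \<in> adjoin A x"
proof -
  have "[:a:] \<in> polys_over A" if "a \<in> A" for a
    using assms that by (auto simp: polys_over_def subring_def coeff_pCons split: nat.split)
  then show "A \<subseteq> adjoin A x" unfolding adjoin_def by force
  have "[:0, 1:] \<in> polys_over A"
    using assms by (auto simp: polys_over_def subring_def coeff_pCons split: nat.split)
  moreover have "x = poly [:0, 1:] x" by simp
  ultimately show "x \<in> adjoin A x" unfolding adjoin_def by blast
qed

text \<open>The variables in \<open>I\<close> are adjoined one by one to the constants, which are
  Noetherian because a nonzero constant divides every other.\<close>

lemma mpolys_noetherian: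
  fixes f :: "nat \<Rightarrow> ('i, 'a::field) mpoly"
  assumes "finite I" "\<And>n. f n \<in> mpolys I"
  shows "\<exists>m c. f m = (\<Sum>i<m. c i * f i)"
proof -
  have "\<exists>A. noetherian_subring A \<and> range mconst \<subseteq> A \<and> mvar ` I \<subseteq> (A :: ('i, 'a) mpoly set)"
    using assms(1)
  proof (induction I rule: finite_induct)
    case empty
    let ?A = "range (mconst :: 'a \<Rightarrow> ('i, 'a) mpoly)"
    have "subring ?A"
      unfolding subring_def
    proof (intro conjI ballI)
      show "0 \<in> ?A" "1 \<in> ?A" by (metis mconst_0 rangeI, metis mconst_1 rangeI)
      fix a assume "a \<in> ?A"
      then obtain p where p: "a = mconst p" by blast
      have "- a = mconst (- p)" by (simp add: p mconst_def single_uminus)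
      then show "- a \<in> ?A" by blast
      fix b assume "b \<in> ?A"
      then obtain q where q: "b = mconst q" by blast
      have "a + b = mconst (p + q)" "a * b = mconst (p * q)" by (simp_all add: p q mconst_add mconst_mult)
      then show "a + b \<in> ?A" "a * b \<in> ?A" by blast+
    qed
    moreover have "\<exists>m c. (\<forall>i<m. c i \<in> ?A) \<and> f m = (\<Sum>i<m. c i * f i)" if "range f \<subseteq> ?A" for f :: "nat \<Rightarrow> ('i, 'a) mpoly"
    proof (cases "f 0 = 0")
      case True
      then show ?thesis by (intro exI[of _ 0]) auto
    next
      case False
      have "f 0 \<in> ?A" "f 1 \<in> ?A" using that by auto
      then obtain a b where ab: "f 0 = mconst a" "f 1 = mconst b" by (auto elim!: rangeE)
      then have "a \<noteq> 0" using False by auto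
      then have "f 1 = (\<Sum>i<1. mconst (b / a) * f i)" by (simp add: ab mconst_mult[symmetric] flip: One_nat_def)
      then show ?thesis by (intro exI[of _ 1] exI[of _ "\<lambda>_. mconst (b / a)"]) blast
    qed
    ultimately show ?case by (intro exI[of _ ?A]) (simp add: noetherian_subring_def)
  next
    case (insert i I)
    then obtain A :: "('i, 'a) mpoly set" where A: "noetherian_subring A" "range mconst \<subseteq> A" "mvar ` I \<subseteq> A" by blast
    then show ?case using noetherian_adjoin[OF A(1), of "mvar i"] adjoin_superset[of A "mvar i"]
      by (intro exI[of _ "adjoin A (mvar i)"]) (auto simp: noetherian_subring_def)
  qed
  then obtain A :: "('i, 'a) mpoly set" where A: "noetherian_subring A" "range mconst \<subseteq> A" "mvar ` I \<subseteq> A" by blast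
  have sA: "subring A" using A(1) by (simp add: noetherian_subring_def)
  have "p \<in> A" if p: "p \<in> mpolys I" for p
  proof -
    have pow: "mvar i ^ k \<in> A" if "i \<in> I" for i k
      using sA A(3) that by (induction k) (auto simp: subring_def)
    have prod: "(\<Prod>i\<in>K. mvar i ^ Poly_Mapping.lookup u i) \<in> A" if "K \<subseteq> I" for K u
      using that pow sA by (induction K rule: infinite_finite_induct) (auto simp: subring_def)
    have mm: "mmonom u = (\<Prod>i\<in>Poly_Mapping.keys u. (mvar i :: ('i, 'a) mpoly) ^ Poly_Mapping.lookup u i)" for u
    proof -
      have vp: "(mvar i :: ('i, 'a) mpoly) ^ k = mmonom (Poly_Mapping.single i k)" for i k
        by (induction k) (auto simp: mvar_def mmonom_def mult_single single_add[symmetric])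
      have pp: "(\<Prod>i\<in>K. mmonom (g i)) = (mmonom (\<Sum>i\<in>K. g i) :: ('i, 'a) mpoly)" for K and g :: "'i \<Rightarrow> ('i \<Rightarrow>\<^sub>0 nat)"
        by (induction K rule: infinite_finite_induct) (auto simp: mmonom_add)
      have "u = (\<Sum>i\<in>Poly_Mapping.keys u. Poly_Mapping.single i (Poly_Mapping.lookup u i))"
        by (intro poly_mapping_eqI) (auto simp: lookup_sum lookup_single when_def in_keys_iff)
      then show ?thesis by (simp add: vp pp)
    qed
    have "mconst (Poly_Mapping.lookup p u) * mmonom u \<in> A" if "u \<in> Poly_Mapping.keys p" for u
    proof -
      have "Poly_Mapping.keys u \<subseteq> I" using p that by (auto simp: mpolys_def)
      then have "mmonom u \<in> A" unfolding mm by (rule prod)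
      then show ?thesis using sA A(2) unfolding subring_def by blast
    qed
    then have "(\<Sum>u\<in>Poly_Mapping.keys p. mconst (Poly_Mapping.lookup p u) * mmonom u) \<in> A"
      by (rule subring_sum[OF sA])
    then show ?thesis by (simp only: mpoly_sum_monom[symmetric])
  qed
  then have "range f \<subseteq> A" using assms(2) by blast
  then show ?thesis using A(1) unfolding noetherian_subring_def by blast
qed

section \<open>The Zariski topology of projective space is Noetherian\<close>

lemma topspace_proj_zariski:
  "topspace (proj_zariski I :: ('i \<Rightarrow> 'a::field) set topology) = proj_space I"
proof
  show "topspace (proj_zariski I :: ('i \<Rightarrow> 'a) set topology) \<subseteq> proj_space I"
    unfolding topspace_def by (auto simp: openin_proj_zariski)
  have "(1 :: ('i, 'a) mpoly) \<in> homogeneous_mpolys I"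
    unfolding homogeneous_mpolys_def by auto
  moreover have "proj_zeros I (eval_mpoly ` {1 :: ('i, 'a) mpoly}) = {}"
  proof -
    have "P \<noteq> {}" if P: "P \<in> proj_space I" for P :: "('i \<Rightarrow> 'a) set"
    proof -
      obtain x where x: "x \<in> nonzero_vectors I" "P = proj_rel I `` {x}"
        using P unfolding proj_space_def by (blast elim: quotientE)
      have "x \<in> P" using x by (auto simp: proj_rel_def intro!: exI[of _ 1])
      then show ?thesis by blast
    qed
    note ne = this
    show ?thesis
    proof (rule equals0I)
      fix P assume "P \<in> proj_zeros I (eval_mpoly ` {1 :: ('i, 'a) mpoly})"
      then have P: "P \<in> proj_space I" "\<forall>p\<in>P. eval_mpoly (1 :: ('i, 'a) mpoly) p = 0"
        unfolding proj_zeros_def by blast+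
      then obtain p where "p \<in> P" using ne by blast
      then show False using P(2) by simp
    qed
  qed
  ultimately have "openin (proj_zariski I) (proj_space I :: ('i \<Rightarrow> 'a) set set)"
    unfolding openin_proj_zariski by (intro exI[of _ "{1}"] conjI) (blast, simp only: Diff_empty)
  then show "proj_space I \<subseteq> topspace (proj_zariski I :: ('i \<Rightarrow> 'a) set topology)" by (rule openin_subset)
qed

lemma closedin_proj_zariski:
  "closedin (proj_zariski I) Z \<longleftrightarrow> (\<exists>F \<subseteq> homogeneous_mpolys I. Z = proj_zeros I (eval_mpoly ` F))"
proof -
  have sub: "proj_zeros I F \<subseteq> proj_space I" for F by (auto simp: proj_zeros_def)
  show ?thesis
    unfolding closedin_def topspace_proj_zariski openin_proj_zariski
  proof
    assume "Z \<subseteq> proj_space I \<and> (\<exists>F\<subseteq>homogeneous_mpolys I.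
      proj_space I - Z = proj_space I - proj_zeros I (eval_mpoly ` F))"
    then obtain F where F: "Z \<subseteq> proj_space I" "F \<subseteq> homogeneous_mpolys I"
      "proj_space I - Z = proj_space I - proj_zeros I (eval_mpoly ` F)" by blast
    have "Z = proj_zeros I (eval_mpoly ` F)" using F(1,3) sub[of "eval_mpoly ` F"] by blast
    then show "\<exists>F\<subseteq>homogeneous_mpolys I. Z = proj_zeros I (eval_mpoly ` F)" using F(2) by blast
  next
    assume "\<exists>F\<subseteq>homogeneous_mpolys I. Z = proj_zeros I (eval_mpoly ` F)"
    then obtain F where "F \<subseteq> homogeneous_mpolys I" "Z = proj_zeros I (eval_mpoly ` F)" by blast
    then show "Z \<subseteq> proj_space I \<and> (\<exists>F\<subseteq>homogeneous_mpolys I.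
      proj_space I - Z = proj_space I - proj_zeros I (eval_mpoly ` F))"
      using sub[of "eval_mpoly ` F"] by blast
  qed
qed

lemma homogeneous_mpolysD: "f \<in> homogeneous_mpolys I \<Longrightarrow> f \<in> mpolys I"
  by (auto simp: homogeneous_mpolys_def)

definition noetherian_space :: "'a topology \<Rightarrow> bool" where
  "noetherian_space T \<longleftrightarrow> (\<forall>Z :: nat \<Rightarrow> 'a set. (\<forall>n. closedin T (Z n)) \<longrightarrow> \<not> (\<forall>n. Z (Suc n) \<subset> Z n))"

text \<open>A strictly descending chain provides polynomials \<open>f n\<close> and points
  \<open>p n\<close> such that \<open>f n\<close> does not vanish at \<open>p n\<close> while all
  earlier ones do. Hence no \<open>f n\<close> is in the ideal of its predecessors.\<close>

lemma noetherian_proj_zariski: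
  assumes "finite I"
  shows "noetherian_space (proj_zariski I :: ('i \<Rightarrow> 'a::field) set topology)"
  unfolding noetherian_space_def
proof (intro allI impI notI)
  fix Z :: "nat \<Rightarrow> ('i \<Rightarrow> 'a) set set"
  assume cl: "\<forall>n. closedin (proj_zariski I) (Z n)" and dec: "\<forall>n. Z (Suc n) \<subset> Z n"
  obtain F where F: "\<And>n. F n \<subseteq> homogeneous_mpolys I" "\<And>n. Z n = proj_zeros I (eval_mpoly ` F n)"
    using cl unfolding closedin_proj_zariski by metis
  have "\<exists>f P p. f \<in> F (Suc n) \<and> P \<in> Z n \<and> p \<in> P \<and> eval_mpoly f p \<noteq> 0" for n
  proof -
    obtain P where P: "P \<in> Z n" "P \<notin> Z (Suc n)" using dec by blast
    then have "P \<in> proj_space I" using F(2) by (auto simp: proj_zeros_def)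
    then show ?thesis using P F(2)[of "Suc n"] by (auto simp: proj_zeros_def)
  qed
  then obtain f P p where fPp: "\<And>n. f n \<in> F (Suc n)" "\<And>n. P n \<in> Z n" "\<And>n. p n \<in> P n" "\<And>n. eval_mpoly (f n) (p n) \<noteq> 0"
    by metis
  have anti: "Z n \<subseteq> Z m" if "m \<le> n" for m n
  proof -
    have "decseq Z" using dec by (intro decseq_SucI) blast
    then show ?thesis using that by (rule decseqD)
  qed
  have van: "eval_mpoly (f k) (p n) = 0" if "k < n" for k n
  proof -
    have "P n \<in> Z (Suc k)" using anti[of "Suc k" n] that fPp(2) by auto
    then show ?thesis using fPp(1,3) F(2) by (auto simp: proj_zeros_def)
  qed
  have "f n \<in> mpolys I" for n using fPp(1) F(1) homogeneous_mpolysD by blast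
  then obtain m c where "f m = (\<Sum>i<m. c i * f i)" using mpolys_noetherian[OF assms, of f] by blast
  then have "eval_mpoly (f m) (p m) = 0" using van by simp
  then show False using fPp(4) by blast
qed

section \<open>Irreducible subsets and components\<close>

lemma irreducible_subtopology_iff:
  assumes "Z \<subseteq> topspace T"
  shows "irreducible_space (subtopology T Z) \<longleftrightarrow> Z \<noteq> {} \<and>
    (\<forall>A B. closedin T A \<longrightarrow> closedin T B \<longrightarrow> Z \<subseteq> A \<union> B \<longrightarrow> Z \<subseteq> A \<or> Z \<subseteq> B)"
proof -
  have ts: "topspace (subtopology T Z) = Z" using assms by (rule topspace_subtopology_subset)
  show ?thesis
  proof (intro iffI conjI allI impI)
    assume irr: "irreducible_space (subtopology T Z)"
    show "Z \<noteq> {}" using irr ts by (simp add: irreducible_space_def)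
    fix A B assume AB: "closedin T A" "closedin T B" "Z \<subseteq> A \<union> B"
    have "closedin (subtopology T Z) (A \<inter> Z)" "closedin (subtopology T Z) (B \<inter> Z)"
      using AB unfolding closedin_subtopology by auto
    moreover have "(A \<inter> Z) \<union> (B \<inter> Z) = Z" using AB(3) by blast
    ultimately have "A \<inter> Z = Z \<or> B \<inter> Z = Z" using irr unfolding irreducible_space_def ts by blast
    then show "Z \<subseteq> A \<or> Z \<subseteq> B" by blast
  next
    assume r: "Z \<noteq> {} \<and> (\<forall>A B. closedin T A \<longrightarrow> closedin T B \<longrightarrow> Z \<subseteq> A \<union> B \<longrightarrow> Z \<subseteq> A \<or> Z \<subseteq> B)"
    show "irreducible_space (subtopology T Z)"
      unfolding irreducible_space_def ts closedin_subtopology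
    proof (intro conjI allI impI)
      show "Z \<noteq> {}" using r by blast
      fix A B assume "(\<exists>S. closedin T S \<and> A = S \<inter> Z) \<and> (\<exists>S. closedin T S \<and> B = S \<inter> Z) \<and> A \<union> B = Z"
      then obtain S S' where S: "closedin T S" "A = S \<inter> Z" "closedin T S'" "B = S' \<inter> Z" "A \<union> B = Z" by blast
      then have "Z \<subseteq> S \<union> S'" by blast
      then have "Z \<subseteq> S \<or> Z \<subseteq> S'" using r S by blast
      then show "A = Z \<or> B = Z" using S by blast
    qed
  qed
qed

lemma irreducible_finite_cover:
  assumes "irreducible_space (subtopology T Z)" "Z \<subseteq> topspace T" "finite \<A>"
    "\<And>A. A \<in> \<A> \<Longrightarrow> closedin T A" "Z \<subseteq> \<Union>\<A>"
  shows "\<exists>A\<in>\<A>. Z \<subseteq> A"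
  using assms(3-5)
proof (induction \<A> rule: finite_induct)
  case empty
  then show ?case using irreducible_subtopology_iff[OF assms(2)] assms(1) by auto
next
  case (insert A \<A>)
  have "closedin T (\<Union>\<A>)" using insert by (intro closedin_Union) auto
  moreover have "closedin T A" "Z \<subseteq> A \<union> \<Union>\<A>" using insert.prems by auto
  ultimately have "Z \<subseteq> A \<or> Z \<subseteq> \<Union>\<A>"
    using irreducible_subtopology_iff[OF assms(2)] assms(1) by blast
  then show ?case using insert.IH insert.prems by auto
qed

lemma irreducible_decomposition:
  assumes N: "noetherian_space T" and "closedin T Z"
  shows "\<exists>\<C>. finite \<C> \<and> (\<forall>C\<in>\<C>. closedin T C \<and> irreducible_space (subtopology T C)) \<and> \<Union>\<C> = Z"
proof -
  define r where "r = {(A, B). closedin T A \<and> closedin T B \<and> A \<subset> B}"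
  have "wf r"
    unfolding wf_iff_no_infinite_down_chain
  proof
    assume "\<exists>f. \<forall>i. (f (Suc i), f i) \<in> r"
    then obtain f where "\<forall>i. (f (Suc i), f i) \<in> r" by blast
    then have "\<forall>i. closedin T (f i)" "\<forall>i. f (Suc i) \<subset> f i" by (auto simp: r_def)
    then show False using N unfolding noetherian_space_def by blast
  qed
  then show ?thesis using assms(2)
  proof (induction Z rule: wf_induct_rule)
    case (less Z)
    have Zt: "Z \<subseteq> topspace T" using less.prems by (rule closedin_subset)
    show ?case
    proof (cases "Z = {} \<or> irreducible_space (subtopology T Z)")
      case True
      then show ?thesis using less.prems
        by (elim disjE) (rule exI[of _ "{}"], simp, rule exI[of _ "{Z}"], simp)
    next
      case False
      then obtain A B where AB: "closedin T A" "closedin T B" "Z \<subseteq> A \<union> B" "\<not> Z \<subseteq> A" "\<not> Z \<subseteq> B"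
        using irreducible_subtopology_iff[OF Zt] by blast
      have "(A \<inter> Z, Z) \<in> r" "(B \<inter> Z, Z) \<in> r" "closedin T (A \<inter> Z)" "closedin T (B \<inter> Z)"
        using AB less.prems by (auto simp: r_def)
      then obtain \<C> \<D> where "finite \<C>" "\<forall>C\<in>\<C>. closedin T C \<and> irreducible_space (subtopology T C)" "\<Union>\<C> = A \<inter> Z"
        "finite \<D>" "\<forall>C\<in>\<D>. closedin T C \<and> irreducible_space (subtopology T C)" "\<Union>\<D> = B \<inter> Z"
        using less.IH by metis
      then show ?thesis using AB(3) by (intro exI[of _ "\<C> \<union> \<D>"]) auto
    qed
  qed
qed

text \<open>Zorn's lemma applies because a point outside \<open>A\<close> and a point outside
  \<open>B\<close> in the union of a chain already lie in a common irreducible member.\<close>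

lemma irreducible_component_superset:
  assumes C: "irreducible_space (subtopology T C)" "C \<subseteq> Y" and Y: "Y \<subseteq> topspace T"
  shows "\<exists>Z\<in>irreducible_components (subtopology T Y). C \<subseteq> Z"
proof -
  define \<A> where "\<A> = {Z. C \<subseteq> Z \<and> Z \<subseteq> Y \<and> irreducible_space (subtopology T Z)}"
  have "C \<in> \<A>" using C by (simp add: \<A>_def)
  moreover have "\<Union>\<D> \<in> \<A>" if D: "\<D> \<noteq> {}" "subset.chain \<A> \<D>" for \<D>
  proof -
    have sub: "\<D> \<subseteq> \<A>" and ch: "\<And>X Y. X \<in> \<D> \<Longrightarrow> Y \<in> \<D> \<Longrightarrow> X \<subseteq> Y \<or> Y \<subseteq> X"
      using D(2) by (auto simp: subset.chain_def)
    have UY: "\<Union>\<D> \<subseteq> Y" "C \<subseteq> \<Union>\<D>" using sub D(1) by (auto simp: \<A>_def)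
    have "irreducible_space (subtopology T (\<Union>\<D>))"
    proof (subst irreducible_subtopology_iff, use UY Y in blast, intro conjI allI impI)
      show "\<Union>\<D> \<noteq> {}"
      proof -
        have "C \<noteq> {}" using C(1) irreducible_subtopology_iff[OF order_trans[OF C(2) Y]] by blast
        then show ?thesis using UY(2) by blast
      qed
      fix A B assume AB: "closedin T A" "closedin T B" "\<Union>\<D> \<subseteq> A \<union> B"
      show "\<Union>\<D> \<subseteq> A \<or> \<Union>\<D> \<subseteq> B"
      proof (rule ccontr)
        assume "\<not> ?thesis"
        then obtain a b X X' where "a \<notin> A" "b \<notin> B" "a \<in> X" "b \<in> X'" "X \<in> \<D>" "X' \<in> \<D>" by blast
        then obtain X'' where X: "X'' \<in> \<D>" "a \<in> X''" "b \<in> X''" "a \<notin> A" "b \<notin> B" using ch[of X X'] by blast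
        then have "irreducible_space (subtopology T X'')" "X'' \<subseteq> topspace T" "X'' \<subseteq> A \<union> B"
          using sub Y AB(3) by (auto simp: \<A>_def)
        then have "X'' \<subseteq> A \<or> X'' \<subseteq> B" using irreducible_subtopology_iff[of X'' T] AB by blast
        then show False using X by blast
      qed
    qed
    then show ?thesis using UY by (simp add: \<A>_def)
  qed
  ultimately obtain Z where Z: "Z \<in> \<A>" "\<And>X. X \<in> \<A> \<Longrightarrow> Z \<subseteq> X \<Longrightarrow> X = Z"
    using subset_Zorn_nonempty[of \<A>] by blast
  have sub: "subtopology (subtopology T Y) X = subtopology T X" if "X \<subseteq> Y" for X
    using that by (simp add: subtopology_subtopology Int_absorb1)
  have "Z \<in> irreducible_components (subtopology T Y)"
    unfolding irreducible_components_def topspace_subtopology_subset[OF Y]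
  proof (intro CollectI conjI allI impI)
    show "Z \<subseteq> Y" "irreducible_space (subtopology (subtopology T Y) Z)"
      using Z(1) sub[of Z] by (simp_all add: \<A>_def)
    fix X assume X: "Z \<subseteq> X \<and> X \<subseteq> Y \<and> irreducible_space (subtopology (subtopology T Y) X)"
    then have "X \<in> \<A>" using Z(1) sub[of X] by (auto simp: \<A>_def)
    then show "X = Z" using Z(2) X by blast
  qed
  then show ?thesis using Z(1) by (auto simp: \<A>_def)
qed

text \<open>For the first inclusion, the pieces of a finite irreducible decomposition not covered by
  the removed sets form a closed set, and each lies in a component contained in none of the removed
  sets. For the second, such a component is covered by the closure and finitely many
  \<open>H\<close>, and irreducibility leaves only the closure.\<close>

lemma closure_of_minus_closed_sets:
  assumes N: "noetherian_space T" and Y: "closedin T Y"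
    and H: "finite \<H>" "\<And>H. H \<in> \<H> \<Longrightarrow> closedin T H"
  shows "T closure_of (Y - \<Union>\<H>) =
    \<Union>{Z \<in> irreducible_components (subtopology T Y). \<not> (\<exists>H\<in>\<H>. Z \<subseteq> H)}"
proof
  have Yt: "Y \<subseteq> topspace T" using Y by (rule closedin_subset)
  obtain \<C> where C: "finite \<C>" "\<forall>C\<in>\<C>. closedin T C \<and> irreducible_space (subtopology T C)" "\<Union>\<C> = Y"
    using irreducible_decomposition[OF N Y] by blast
  define \<D> where "\<D> = {C\<in>\<C>. \<not> C \<subseteq> \<Union>\<H>}"
  have "Y - \<Union>\<H> \<subseteq> \<Union>\<D>" using C(3) by (auto simp: \<D>_def)
  moreover have "closedin T (\<Union>\<D>)" using C(1,2) by (intro closedin_Union) (auto simp: \<D>_def)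
  ultimately have "T closure_of (Y - \<Union>\<H>) \<subseteq> \<Union>\<D>" by (rule closure_of_minimal)
  also have "\<Union>\<D> \<subseteq> \<Union>{Z \<in> irreducible_components (subtopology T Y). \<not> (\<exists>H\<in>\<H>. Z \<subseteq> H)}"
  proof
    fix x assume "x \<in> \<Union>\<D>"
    then obtain D where D: "x \<in> D" "D \<in> \<D>" by blast
    then have "irreducible_space (subtopology T D)" "D \<subseteq> Y" using C by (auto simp: \<D>_def)
    then obtain Z where Z: "Z \<in> irreducible_components (subtopology T Y)" "D \<subseteq> Z"
      using irreducible_component_superset[OF _ _ Yt] by blast
    moreover have "\<not> (\<exists>H\<in>\<H>. Z \<subseteq> H)" using Z(2) D(2) by (auto simp: \<D>_def)
    ultimately show "x \<in> \<Union>{Z \<in> irreducible_components (subtopology T Y). \<not> (\<exists>H\<in>\<H>. Z \<subseteq> H)}"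
      using D(1) by blast
  qed
  finally show "T closure_of (Y - \<Union>\<H>) \<subseteq>
    \<Union>{Z \<in> irreducible_components (subtopology T Y). \<not> (\<exists>H\<in>\<H>. Z \<subseteq> H)}" .
  show "\<Union>{Z \<in> irreducible_components (subtopology T Y). \<not> (\<exists>H\<in>\<H>. Z \<subseteq> H)} \<subseteq> T closure_of (Y - \<Union>\<H>)"
  proof (rule Union_least)
    fix Z assume "Z \<in> {Z \<in> irreducible_components (subtopology T Y). \<not> (\<exists>H\<in>\<H>. Z \<subseteq> H)}"
    then have ZY: "Z \<subseteq> Y" and irr: "irreducible_space (subtopology T Z)" and nH: "\<And>H. H \<in> \<H> \<Longrightarrow> \<not> Z \<subseteq> H"
      unfolding irreducible_components_def topspace_subtopology_subset[OF Yt]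
      by (auto simp: subtopology_subtopology Int_absorb1)
    have "Y - \<Union>\<H> \<subseteq> T closure_of (Y - \<Union>\<H>)" using Yt by (intro closure_of_subset) auto
    then have "Z \<subseteq> \<Union>(insert (T closure_of (Y - \<Union>\<H>)) \<H>)" using ZY by auto
    moreover have "closedin T A" if "A \<in> insert (T closure_of (Y - \<Union>\<H>)) \<H>" for A
      using that H(2) by auto
    moreover have "finite (insert (T closure_of (Y - \<Union>\<H>)) \<H>)" using H(1) by simp
    ultimately obtain A where "A \<in> insert (T closure_of (Y - \<Union>\<H>)) \<H>" "Z \<subseteq> A"
      using irreducible_finite_cover[OF irr order_trans[OF ZY Yt],
          of "insert (T closure_of (Y - \<Union>\<H>)) \<H>"] by blast
    then show "Z \<subseteq> T closure_of (Y - \<Union>\<H>)" using nH by auto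
  qed
qed

text \<open>Translation by \<open>y0\<close> acts on each coordinate separately, so a polynomial in
  the variables \<open>T\<close> remains one.\<close>

lemma local_dimension_bound_at:
  fixes f :: "'j \<Rightarrow> ('i::countable \<Rightarrow> complex) \<Rightarrow> complex"
  assumes fin: "finite I" "finite C" and cardI: "card I = card C + r" and r: "1 \<le> r"
    and f: "\<And>j. j \<in> C \<Longrightarrow> polyf I (f j)" and f0: "\<And>j. j \<in> C \<Longrightarrow> f j y0 = 0"
    and G: "polyf I G" and G0: "G y0 \<noteq> 0"
    and Q: "\<And>T. T \<subseteq> I \<Longrightarrow> card T = r \<Longrightarrow> polyf T (Q T) \<and> (\<exists>y. Q T y \<noteq> 0)"
    and vanish: "\<And>T y. T \<subseteq> I \<Longrightarrow> card T = r \<Longrightarrow> (\<forall>j\<in>C. f j y = 0) \<Longrightarrow> G y \<noteq> 0 \<Longrightarrow> Q T y = 0"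
  shows False
proof -
  have tr: "\<exists>p\<in>mpolys J. \<forall>y. eval_mpoly p y = g (\<lambda>i. y0 i + y i)"
    if "polyf J g" for J and g :: "('i \<Rightarrow> complex) \<Rightarrow> complex"
  proof -
    have "polyf J (\<lambda>y. g (\<lambda>i. y0 i + y i))"
      using that by (rule polyf_compose') (auto intro: polyf_intros)
    then show ?thesis unfolding polyf_def by metis
  qed
  have "\<forall>j\<in>C. \<exists>p. \<forall>y. eval_mpoly p y = f j (\<lambda>i. y0 i + y i)" using tr f by blast
  then obtain f' where f': "\<And>j y. j \<in> C \<Longrightarrow> eval_mpoly (f' j) y = f j (\<lambda>i. y0 i + y i)" by metis
  obtain G' where G': "\<And>y. eval_mpoly G' y = G (\<lambda>i. y0 i + y i)" using tr[OF G] by blast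
  have "\<forall>T. \<exists>p. T \<subseteq> I \<longrightarrow> card T = r \<longrightarrow> p \<in> mpolys T \<and> (\<forall>y. eval_mpoly p y = Q T (\<lambda>i. y0 i + y i))"
  proof (intro allI)
    fix T
    show "\<exists>p. T \<subseteq> I \<longrightarrow> card T = r \<longrightarrow> p \<in> mpolys T \<and> (\<forall>y. eval_mpoly p y = Q T (\<lambda>i. y0 i + y i))"
      using tr[of T "Q T"] Q[of T] by metis
  qed
  then obtain Q' where Q': "\<And>T. T \<subseteq> I \<Longrightarrow> card T = r \<Longrightarrow> Q' T \<in> mpolys T"
    "\<And>T y. T \<subseteq> I \<Longrightarrow> card T = r \<Longrightarrow> eval_mpoly (Q' T) y = Q T (\<lambda>i. y0 i + y i)" by metis
  have Q'0: "Q' T \<noteq> 0" if T: "T \<subseteq> I" "card T = r" for T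
  proof
    assume z: "Q' T = 0"
    obtain y where "Q T y \<noteq> 0" using Q[OF T] by blast
    moreover have "Q T y = 0" using Q'(2)[OF T, of "\<lambda>i. y i - y0 i"] z by simp
    ultimately show False by blast
  qed
  show False
  proof (rule local_dimension_bound[OF fin cardI r, of f' G' Q'])
    show "eval_mpoly (f' j) (\<lambda>_. 0) = 0" if "j \<in> C" for j using f'[OF that] f0[OF that] by simp
    show "eval_mpoly G' (\<lambda>_. 0) \<noteq> 0" using G' G0 by simp
    show "Q' T \<in> mpolys T \<and> Q' T \<noteq> 0" if "T \<subseteq> I" "card T = r" for T using Q' Q'0 that by blast
    show "eval_mpoly (Q' T) y = 0"
      if "T \<subseteq> I" "card T = r" "\<forall>j\<in>C. eval_mpoly (f' j) y = 0" "eval_mpoly G' y \<noteq> 0" for T y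
      using vanish[OF that(1,2), of "\<lambda>i. y0 i + y i"] that f' G' Q'(2) by simp
  qed
qed

text \<open>Games are real while the dependences have complex coefficients; nonvanishing of a
  complex polynomial at a real game becomes a condition on a sum of two squares of real
  polynomials.\<close>

lemma polyf_Re_Im:
  assumes "polyf V f"
  shows "polyf V (\<lambda>x. Re (f (\<lambda>v. of_real (x v))))" "polyf V (\<lambda>x. Im (f (\<lambda>v. of_real (x v))))"
proof -
  obtain p where p: "p \<in> mpolys V" "f = eval_mpoly p" using assms by (auto simp: polyf_def)
  have e: "eval_mpoly p (\<lambda>v. of_real (x v)) = (\<Sum>m\<in>Poly_Mapping.keys p. Poly_Mapping.lookup p m *
      of_real (\<Prod>i\<in>Poly_Mapping.keys m. x i ^ Poly_Mapping.lookup m i))" for x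
    unfolding eval_mpoly_def by simp
  have v: "i \<in> V" if "m \<in> Poly_Mapping.keys p" "i \<in> Poly_Mapping.keys m" for m i
    using p(1) that by (auto simp: mpolys_def)
  show "polyf V (\<lambda>x. Re (f (\<lambda>v. of_real (x v))))" "polyf V (\<lambda>x. Im (f (\<lambda>v. of_real (x v))))"
    unfolding p(2) e Re_sum Im_sum Re_complex_of_real Im_complex_of_real times_complex.simps
    using v by (auto intro!: polyf_intros)
qed

section \<open>Charts of the graphical model and the incidence variety\<close>

locale spohn_setting =
  fixes n :: nat and d :: "nat \<Rightarrow> nat" and E :: "nat set set"
    and h :: "nat set \<times> (nat \<Rightarrow> nat) \<Rightarrow> nat"
  assumes pos: "\<And>k. k \<in> {1..n} \<Longrightarrow> 0 < d k"
begin

abbreviation "R \<equiv> states n d"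

definition "\<Omega> = Sigma (maximal_cliques n E) (\<lambda>C. state_space C d)"
definition "K = Sigma {1..n} (\<lambda>k. {1..d k})"
text \<open>Coordinate 0 is t, followed by the torus parameters. The final
  \<open>\<Sum>k\<in>{1..n}. d k - 1\<close> coordinates do not enter \<open>\<phi>\<close>; there
  is one for each equation, so that dimension minus number of equations is \<open>r\<close>, which
  is positive for all \<open>d\<close> and all graphs.\<close>

definition "I = {..<1 + card \<Omega> + (\<Sum>k\<in>{1..n}. d k - 1)}"
definition "r = 1 + card \<Omega>"

definition mono :: "(nat \<Rightarrow> complex) \<Rightarrow> (nat \<Rightarrow> nat) \<Rightarrow> complex" where
  "mono y j = (\<Prod>C\<in>maximal_cliques n E. y (h (C, restrict j C)))"

text \<open>A curve (for \<open>y 0\<close> near 0) in the graphical model whose limit at \<open>y 0 = 0\<close> is supported on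
  the face \<open>{j. W j = 0}\<close>.\<close>

definition \<phi> :: "((nat \<Rightarrow> nat) \<Rightarrow> nat) \<Rightarrow> (nat \<Rightarrow> complex) \<Rightarrow> (nat \<Rightarrow> nat) \<Rightarrow> complex" where
  "\<phi> W y j = y 0 ^ W j * mono y j"

definition total :: "((nat \<Rightarrow> nat) \<Rightarrow> complex) \<Rightarrow> complex" where
  "total p = (\<Sum>j\<in>R. p j)"

lemma finite_cliques: "finite (maximal_cliques n E)"
  by (rule finite_subset[of _ "Pow {1..n}"]) (auto simp: maximal_cliques_def)

lemma clique_subset: "C \<in> maximal_cliques n E \<Longrightarrow> C \<subseteq> {1..n}"
  by (simp add: maximal_cliques_def)

lemma finite_state_space: "C \<subseteq> {1..n} \<Longrightarrow> finite (state_space C d)"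
  unfolding state_space_def by (intro finite_PiE) (auto intro: finite_subset)

lemma finite_R: "finite R"
  by (rule finite_state_space) simp

lemma finite_\<Omega>: "finite \<Omega>"
  unfolding \<Omega>_def using finite_cliques finite_state_space clique_subset by (intro finite_SigmaI) auto

lemma restrict_state: "j \<in> R \<Longrightarrow> C \<in> maximal_cliques n E \<Longrightarrow> restrict j C \<in> state_space C d"
  using clique_subset[of C] by (auto simp: state_space_def PiE_def Pi_def)

lemma in_\<Omega>: "j \<in> R \<Longrightarrow> C \<in> maximal_cliques n E \<Longrightarrow> (C, restrict j C) \<in> \<Omega>"
  by (simp add: \<Omega>_def restrict_state)

lemma finite_K: "finite K"
  by (simp add: K_def)

lemma slice_nonempty:
  assumes "k \<in> {1..n}" "a \<in> {1..d k}"
  shows "\<exists>j\<in>R. j k = a"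
proof -
  let ?j = "\<lambda>i\<in>{1..n}. if i = k then a else 1"
  have "?j \<in> R" using assms pos unfolding state_space_def by (auto simp: Suc_le_eq)
  moreover have "?j k = a" using assms by simp
  ultimately show ?thesis by blast
qed

lemma R_coord: "j \<in> R \<Longrightarrow> k \<in> {1..n} \<Longrightarrow> j k \<in> {1..d k}"
  unfolding state_space_def by (drule PiE_mem) auto

end

text \<open>Torus parameters are numbered from 1, which reserves 0 for t. Numbers replace pairs of
  clique and state because the Nullstellensatz is applied to variables of a countable type.\<close>

locale spohn_coords = spohn_setting +
  assumes h: "bij_betw h \<Omega> {1..card \<Omega>}"
begin

lemma finite_I: "finite I"
  by (simp add: I_def)

lemma zero_I: "0 \<in> I"
  by (simp add: I_def)

lemma h_I: "\<omega> \<in> \<Omega> \<Longrightarrow> h \<omega> \<in> I"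
  using bij_betwE[OF h] by (fastforce simp: I_def)

lemma polyf_mono_\<phi>:
  assumes "j \<in> R"
  shows "polyf I (\<lambda>y. mono y j)" "polyf I (\<lambda>y. \<phi> W y j)"
  unfolding \<phi>_def mono_def using in_\<Omega>[OF assms] h_I zero_I by (auto intro!: polyf_intros)

lemma polyf_\<phi>_compose:
  assumes "polyf R g"
  shows "polyf I (\<lambda>y. g (\<phi> W y))"
proof -
  have "polyf I (\<lambda>y. g (\<lambda>j. \<phi> W y j))"
    by (rule polyf_compose'[OF assms]) (rule polyf_mono_\<phi>)
  then show ?thesis by simp
qed

lemma mono_nonzero: "(\<forall>\<omega>\<in>\<Omega>. y (h \<omega>) \<noteq> 0) \<Longrightarrow> j \<in> R \<Longrightarrow> mono y j \<noteq> 0"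
  unfolding mono_def using finite_cliques in_\<Omega> by (auto simp: prod_zero_iff)

lemma polyf_marginal: "polyf R (marginal n d k i)"
  unfolding marginal_def by (intro polyf_intros) auto

lemma polyf_payoff_sum: "polyf R (payoff_sum n d X k i)"
  unfolding payoff_sum_def by (intro polyf_intros) auto

lemma polyf_minor: "polyf R (spohn_minor n d X k i l)"
  unfolding spohn_minor_def by (intro polyf_intros polyf_marginal polyf_payoff_sum)

lemma polyf_total: "polyf R total"
  unfolding total_def by (intro polyf_intros) auto

text \<open>The functions that have to be made nonzero when moving away from the given point. As the
  torus parameters are kept nonzero separately, \<open>y 0\<close> accounts for all coordinates at
  once.\<close>

definition forms :: "((nat \<Rightarrow> nat) \<Rightarrow> nat) \<Rightarrow> ((nat \<Rightarrow> complex) \<Rightarrow> complex) set" where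
  "forms W = {\<lambda>y. y 0, \<lambda>y. total (\<phi> W y)} \<union> (\<lambda>(k, a) y. marginal n d k a (\<phi> W y)) ` K"

lemma finite_forms: "finite (forms W)"
  using finite_K by (simp add: forms_def)

lemma forms_polyf:
  assumes "l \<in> forms W"
  shows "polyf I l" "\<exists>y. l y \<noteq> 0"
proof -
  show "polyf I l"
    using assms polyf_\<phi>_compose[OF polyf_total] polyf_\<phi>_compose[OF polyf_marginal] zero_I
    by (auto simp: forms_def intro: polyf_intros)
  have one: "\<phi> W (\<lambda>_. 1) = (\<lambda>_. 1)" by (auto simp: \<phi>_def mono_def)
  have R0: "R \<noteq> {}"
  proof (cases "n = 0")
    case False
    then show ?thesis using slice_nonempty[of 1 1] pos[of 1] by auto
  qed (simp add: state_space_def)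
  have "marginal n d k a (\<lambda>_. 1) \<noteq> 0" if "(k, a) \<in> K" for k a
    using slice_nonempty[of k a] that finite_R by (auto simp: marginal_def K_def)
  moreover have "total (\<lambda>_. 1) \<noteq> 0" using R0 finite_R by (simp add: total_def)
  ultimately have "l (\<lambda>_. 1) \<noteq> 0" using assms one by (auto simp: forms_def)
  then show "\<exists>y. l y \<noteq> 0" by blast
qed

text \<open>The equations say that \<open>\<phi> W y\<close> lies on the Spohn variety of \<open>X\<close> with ratios \<open>lam k\<close> of expected
  payoff to marginal.\<close>

definition spohn_eqs :: "((nat \<Rightarrow> nat) \<Rightarrow> nat) \<Rightarrow> game \<Rightarrow> (nat \<Rightarrow> complex) \<Rightarrow> (nat \<Rightarrow> complex) \<Rightarrow> bool" where
  "spohn_eqs W X y lam \<longleftrightarrow> (\<forall>(k, i)\<in>K. (\<Sum>j | j \<in> R \<and> j k = i. (of_real (X (k, j)) - lam k) * \<phi> W y j) = 0)"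

text \<open>An algebraic relation among the coordinates in \<open>T\<close> alone, valid on the
  torus part of the fibre over \<open>X\<close> where some form in \<open>L\<close> vanishes; the
  ratios \<open>lam\<close> are projected away.\<close>

definition dependence :: "((nat \<Rightarrow> nat) \<Rightarrow> nat) \<Rightarrow> game \<Rightarrow> ((nat \<Rightarrow> complex) \<Rightarrow> complex) set \<Rightarrow>
    nat set \<Rightarrow> ((nat \<Rightarrow> complex) \<Rightarrow> complex) \<Rightarrow> bool" where
  "dependence W X L T Q \<longleftrightarrow> polyf T Q \<and> (\<exists>y. Q y \<noteq> 0) \<and>
    (\<forall>y lam. (\<forall>\<omega>\<in>\<Omega>. y (h \<omega>) \<noteq> 0) \<longrightarrow> (\<exists>l\<in>L. l y = 0) \<longrightarrow> spohn_eqs W X y lam \<longrightarrow> Q y = 0)"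

lemma card_I: "card I = (\<Sum>k\<in>{1..n}. d k - 1) + r"
  by (simp add: I_def r_def)

text \<open>For every pair \<open>(k, i)\<close> the equation of \<open>spohn_eqs\<close> determines the payoff entry at the pivot
  \<open>\<pi> k i\<close>. So the incidence variety is parametrized by \<open>y\<close>, \<open>lam\<close> and the remaining entries, one
  parameter less than the number of entries of \<open>X\<close>, of variables in \<open>T\<close> and the form \<open>l\<close> together.\<close>

lemma generic_dependence:
  assumes \<pi>: "\<And>k i. (k, i) \<in> K \<Longrightarrow> \<pi> k i \<in> R \<and> (\<pi> k i) k = i \<and> W (\<pi> k i) = 0"
    and l: "polyf I l" "\<exists>y. l y \<noteq> 0" and T: "T \<subseteq> I" "card T = r"
  shows "\<exists>q :: game \<Rightarrow> real. polyf ({1..n} \<times> R) q \<and> (\<exists>X. q X \<noteq> 0) \<and>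
    (\<forall>X. q X \<noteq> 0 \<longrightarrow> (\<exists>Q. dependence W X {l} T Q))"
proof -
  let ?A = "{1..n} \<times> R"
  define PV where "PV = (\<lambda>(k, i). (k, \<pi> k i)) ` K"
  define \<Gamma> :: "(nat + nat + nat \<times> (nat \<Rightarrow> nat)) set"
    where "\<Gamma> = I <+> ({1..n} <+> (?A - PV))"
  define V :: "(nat \<times> (nat \<Rightarrow> nat) + nat) set" where "V = ?A <+> T"
  have inj: "inj_on (\<lambda>(k, i). (k, \<pi> k i)) K"
    using \<pi> by (auto simp: inj_on_def) (metis+)
  have PVA: "PV \<subseteq> ?A" using \<pi> by (auto simp: PV_def K_def)
  have finA: "finite ?A" using finite_R by simp
  have finT: "finite T" using T(1) finite_I finite_subset by blast
  have fin: "finite \<Gamma>" "finite V"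
    using finite_I finA finT by (auto simp: \<Gamma>_def V_def)
  have cardK: "card K = (\<Sum>k\<in>{1..n}. d k)" by (simp add: K_def)
  have "card \<Gamma> \<le> card V"
  proof -
    have cPV: "card PV = (\<Sum>k\<in>{1..n}. d k)"
      unfolding PV_def using card_image[OF inj] cardK by simp
    have "card PV \<le> card ?A" using PVA finA by (rule card_mono[rotated])
    moreover have "(\<Sum>k\<in>{1..n}. d k - 1) + n = (\<Sum>k\<in>{1..n}. d k)"
    proof -
      have "(\<Sum>k\<in>{1..n}. d k) = (\<Sum>k\<in>{1..n}. (d k - 1) + 1)"
        using pos by (intro sum.cong refl) (auto simp: Suc_le_eq)
      then show ?thesis by (simp only: sum.distrib) simp
    qed
    moreover have "card \<Gamma> = card I + (n + (card ?A - card PV))"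
      unfolding \<Gamma>_def using finite_I finA PVA
      by (simp add: card_Plus card_Diff_subset finite_subset del: card_cartesian_product)
    moreover have "card V = card ?A + r"
      unfolding V_def using finA finT T(2) by (simp add: card_Plus del: card_cartesian_product)
    ultimately show ?thesis using cPV card_I by linarith
  qed
  define yy where "yy z i = z (Inl i)" for z :: "nat + nat + nat \<times> (nat \<Rightarrow> nat) \<Rightarrow> complex" and i
  define ll where "ll z k = z (Inr (Inl k))" for z :: "nat + nat + nat \<times> (nat \<Rightarrow> nat) \<Rightarrow> complex" and k
  define xx where "xx z a = z (Inr (Inr a))" for z :: "nat + nat + nat \<times> (nat \<Rightarrow> nat) \<Rightarrow> complex" and a
  \<comment> \<open>Common denominator of the parametrization. Pivots have weight 0, so the
    coefficients divided by are the monomials \<open>mono\<close>, which remain nonzero at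
    \<open>y 0 = 0\<close>.\<close>
  define D where "D z = (\<Prod>(k, i)\<in>K. mono (yy z) (\<pi> k i))" for z
  define rest where "rest k i = {j. j \<in> R \<and> j k = i} - {\<pi> k i}" for k i
  \<comment> \<open>\<open>N v / D\<close> expresses the coordinate \<open>v\<close> by the
    parameters. For a pivot it is the solution of its equation: \<open>lam k\<close> minus the
    remaining summands divided by the pivot monomial.\<close>
  define N where "N v z = (case v of Inr i \<Rightarrow> D z * yy z i
      | Inl (k, j) \<Rightarrow> if (k, j) \<notin> PV then D z * xx z (k, j)
          else D z * ll z k - (\<Prod>(k', i')\<in>K - {(k, j k)}. mono (yy z) (\<pi> k' i')) *
            (\<Sum>j'\<in>rest k (j k). (xx z (k, j') - ll z k) * \<phi> W (yy z) j'))" for v z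
  have polyf_yy: "polyf \<Gamma> (\<lambda>z. g (yy z))" if "polyf I g" for g :: "(nat \<Rightarrow> complex) \<Rightarrow> complex"
  proof -
    have "polyf \<Gamma> (\<lambda>z. g (\<lambda>i. yy z i))"
      by (rule polyf_compose'[OF that]) (auto simp: yy_def \<Gamma>_def intro!: polyf_intros)
    then show ?thesis by simp
  qed
  have polyf_ll: "polyf \<Gamma> (\<lambda>z. ll z k)" if "k \<in> {1..n}" for k
    unfolding ll_def using that by (intro polyf_intros) (auto simp: \<Gamma>_def)
  have polyf_xx: "polyf \<Gamma> (\<lambda>z. xx z a)" if "a \<in> ?A - PV" for a
    unfolding xx_def using that by (intro polyf_intros) (auto simp: \<Gamma>_def)
  have pm: "polyf \<Gamma> (\<lambda>z. mono (yy z) (\<pi> k i))" if "(k, i) \<in> K" for k i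
    using polyf_yy[OF polyf_mono_\<phi>(1)] \<pi>[OF that] by blast
  have polyf_prod_K: "polyf \<Gamma> (\<lambda>z. \<Prod>(k, i)\<in>K'. mono (yy z) (\<pi> k i))" if "K' \<subseteq> K" for K'
    using that pm by (auto intro!: polyf_prod simp: case_prod_unfold)
  have polyf_D: "polyf \<Gamma> D" unfolding D_def by (rule polyf_prod_K) simp
  have rest_free: "(k, j) \<in> ?A - PV" if "(k, i) \<in> K" "j \<in> rest k i" for k i j
    using that \<pi> by (auto simp: rest_def PV_def K_def)
  have polyf_N: "polyf \<Gamma> (N v)" if v: "v \<in> V" for v
  proof (cases v)
    case (Inr i)
    then have "i \<in> I" using v T(1) by (auto simp: V_def)
    then show ?thesis unfolding N_def Inr
      by (auto intro!: polyf_intros polyf_D polyf_yy)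
  next
    case (Inl a)
    obtain k j where a: "a = (k, j)" by (cases a)
    then have kj: "k \<in> {1..n}" "j \<in> R" using v Inl by (auto simp: V_def)
    show ?thesis
    proof (cases "(k, j) \<in> PV")
      case False
      then show ?thesis unfolding N_def Inl a using kj
        by (auto intro!: polyf_intros polyf_D polyf_xx)
    next
      case True
      have kK: "(k, j k) \<in> K" using kj R_coord by (auto simp: K_def)
      have "polyf \<Gamma> (\<lambda>z. (xx z (k, j') - ll z k) * \<phi> W (yy z) j')" if "j' \<in> rest k (j k)" for j'
        using rest_free[OF kK that] that kj(1)
        by (intro polyf_intros polyf_xx polyf_ll polyf_yy polyf_mono_\<phi>) (auto simp: rest_def)
      then have sm: "polyf \<Gamma> (\<lambda>z. \<Sum>j'\<in>rest k (j k). (xx z (k, j') - ll z k) * \<phi> W (yy z) j')"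
        by (rule polyf_sum)
      have "polyf \<Gamma> (\<lambda>z. D z * ll z k - (\<Prod>(k', i')\<in>K - {(k, j k)}. mono (yy z) (\<pi> k' i')) *
          (\<Sum>j'\<in>rest k (j k). (xx z (k, j') - ll z k) * \<phi> W (yy z) j'))"
        by (rule polyf_diff[OF polyf_mult[OF polyf_D polyf_ll[OF kj(1)]] polyf_mult[OF polyf_prod_K sm]]) simp
      then show ?thesis unfolding N_def Inl a using True by simp
    qed
  qed
  have "\<forall>v. \<exists>p. v \<in> V \<longrightarrow> p \<in> mpolys \<Gamma> \<and> N v = eval_mpoly p" using polyf_N unfolding polyf_def by blast
  then obtain P where P: "\<And>v. v \<in> V \<Longrightarrow> P v \<in> mpolys \<Gamma>" "\<And>v. v \<in> V \<Longrightarrow> N v = eval_mpoly (P v)" by metis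
  obtain P0 where P0: "P0 \<in> mpolys \<Gamma>" "D = eval_mpoly P0" using polyf_D by (auto simp: polyf_def)
  obtain L where L: "L \<in> mpolys \<Gamma>" "(\<lambda>z. l (yy z)) = eval_mpoly L"
    using polyf_yy[OF l(1)] by (auto simp: polyf_def)
  have "L \<noteq> 0"
  proof
    assume "L = 0"
    then have "l (yy z) = 0" for z using fun_cong[OF L(2), of z] by simp
    moreover obtain y where "l y \<noteq> 0" using l(2) by blast
    moreover have "yy (case_sum y (\<lambda>_. 0)) = y" by (rule ext) (simp add: yy_def)
    ultimately show False by metis
  qed
  then obtain Q where Q: "Q \<in> mpolys V" "Q \<noteq> 0"
    "\<And>z. D z \<noteq> 0 \<Longrightarrow> l (yy z) = 0 \<Longrightarrow> eval_mpoly Q (\<lambda>v. eval_mpoly (P v) z / D z) = 0"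
    using algebraic_dependence_on_hypersurface[OF fin \<open>card \<Gamma> \<le> card V\<close> _ P0(1) L(1), of P] P(1)
    unfolding P0(2) fun_cong[OF L(2)] by blast
  obtain x :: "nat \<times> (nat \<Rightarrow> nat) + nat \<Rightarrow> nat" where x: "eval_mpoly Q (\<lambda>i. of_nat (x i)) \<noteq> 0"
    using mpoly_nonzero_point[OF Q(2)] .
  \<comment> \<open>Freezing the coordinates in \<open>T\<close> at a point where \<open>Q\<close>
    is nonzero leaves a nonzero polynomial in the game. Wherever it does not vanish,
    \<open>Q\<close> specialized at the game is still a nonzero polynomial in
    \<open>T\<close>.\<close>
  define b where "b i = (of_nat (x (Inr i)) :: complex)" for i
  define F where "F X = eval_mpoly Q (case_sum X b)" for X
  define q where "q X = (Re (F (\<lambda>a. of_real (X a))))\<^sup>2 + (Im (F (\<lambda>a. of_real (X a))))\<^sup>2" for X :: game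
  have "polyf ?A F"
  proof -
    have "polyf ?A (\<lambda>X. eval_mpoly Q (\<lambda>v. case_sum X b v))"
      by (rule polyf_compose[OF Q(1)]) (auto simp: V_def intro!: polyf_intros)
    then show ?thesis unfolding F_def by simp
  qed
  then have "polyf ?A q"
    unfolding q_def by (intro polyf_add polyf_power polyf_Re_Im)
  moreover have q0: "q X \<noteq> 0 \<longleftrightarrow> F (\<lambda>a. of_real (X a)) \<noteq> 0" for X
    by (auto simp: q_def sum_power2_eq_zero_iff complex_eq_iff)
  have "q (\<lambda>a. of_nat (x (Inl a))) \<noteq> 0"
  proof -
    have "case_sum (\<lambda>a. of_real (of_nat (x (Inl a)))) b = (\<lambda>i. of_nat (x i))"
      by (rule ext) (auto simp: b_def split: sum.split)
    then show ?thesis using x unfolding q0 F_def by simp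
  qed
  moreover have "\<exists>Q'. dependence W X {l} T Q'" if X: "q X \<noteq> 0" for X
    unfolding dependence_def
  proof (intro exI[of _ "\<lambda>y. eval_mpoly Q (case_sum (\<lambda>a. of_real (X a)) y)"] conjI allI impI)
    have "polyf T (\<lambda>y. eval_mpoly Q (\<lambda>v. case_sum (\<lambda>a. of_real (X a)) y v))"
      by (rule polyf_compose[OF Q(1)]) (auto simp: V_def intro!: polyf_intros)
    then show "polyf T (\<lambda>y. eval_mpoly Q (case_sum (\<lambda>a. of_real (X a)) y))" by simp
    show "\<exists>y. eval_mpoly Q (case_sum (\<lambda>a. of_real (X a)) y) \<noteq> 0"
      using X unfolding q0 F_def by blast
    fix y lam assume y: "\<forall>\<omega>\<in>\<Omega>. y (h \<omega>) \<noteq> 0" "\<exists>l'\<in>{l}. l' y = 0" "spohn_eqs W X y lam"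
    define z where "z = case_sum y (case_sum lam (\<lambda>a. of_real (X a)))"
    have zz: "yy z = y" "ll z = lam" "xx z = (\<lambda>a. of_real (X a))"
      by (rule ext, simp add: z_def yy_def ll_def xx_def)+
    have nz: "mono y (\<pi> k i) \<noteq> 0" if "(k, i) \<in> K" for k i
      using mono_nonzero[OF y(1)] \<pi>[OF that] by blast
    have Dz: "D z \<noteq> 0" unfolding D_def zz using finite_K nz by (auto simp: prod_zero_iff)
    have "N v z = D z * case_sum (\<lambda>a. of_real (X a)) y v" if v: "v \<in> V" for v
    proof (cases v)
      case (Inl a)
      obtain k j where a: "a = (k, j)" by (cases a)
      then have kj: "k \<in> {1..n}" "j \<in> R" using v Inl by (auto simp: V_def)
      show ?thesis
      proof (cases "(k, j) \<in> PV")
        case True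
        define i where "i = j k"
        have kK: "(k, i) \<in> K" using kj R_coord by (auto simp: K_def i_def)
        have j: "j = \<pi> k i" using True \<pi> by (auto simp: PV_def i_def)
        have "0 = (\<Sum>j | j \<in> R \<and> j k = i. (of_real (X (k, j)) - lam k) * \<phi> W y j)"
          using y(3) kK unfolding spohn_eqs_def by auto
        also have "\<dots> = (of_real (X (k, j)) - lam k) * \<phi> W y j +
            (\<Sum>j'\<in>rest k i. (of_real (X (k, j')) - lam k) * \<phi> W y j')"
          unfolding rest_def j[symmetric] using finite_R kj i_def by (intro sum.remove) auto
        also have "\<phi> W y j = mono y j" using \<pi>[OF kK] j by (simp add: \<phi>_def)
        finally have S: "(\<Sum>j'\<in>rest k i. (of_real (X (k, j')) - lam k) * \<phi> W y j') =
            - ((of_real (X (k, j)) - lam k) * mono y j)"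
          by (simp add: eq_neg_iff_add_eq_0 add.commute)
        have Dq: "D z = mono y j * (\<Prod>(k', i')\<in>K - {(k, i)}. mono y (\<pi> k' i'))"
          unfolding D_def zz using prod.remove[OF finite_K kK, of "\<lambda>(k', i'). mono y (\<pi> k' i')"] j by simp
        have "N v z = D z * lam k - (\<Prod>(k', i')\<in>K - {(k, i)}. mono y (\<pi> k' i')) *
            (\<Sum>j'\<in>rest k i. (of_real (X (k, j')) - lam k) * \<phi> W y j')"
          unfolding N_def Inl a sum.case prod.case zz i_def using True by (simp only: not_True_eq_False if_False)
        also have "\<dots> = D z * of_real (X (k, j))"
          unfolding S Dq by (simp add: algebra_simps)
        finally show ?thesis by (simp add: Inl a)
      qed (simp add: N_def Inl a zz)
    qed (simp add: N_def zz)
    then have "eval_mpoly (P v) z / D z = case_sum (\<lambda>a. of_real (X a)) y v" if "v \<in> V" for v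
      using that P(2) Dz by (metis nonzero_mult_div_cancel_left)
    then have "eval_mpoly Q (case_sum (\<lambda>a. of_real (X a)) y) = eval_mpoly Q (\<lambda>v. eval_mpoly (P v) z / D z)"
      by (intro eval_mpoly_cong[OF Q(1)]) simp
    also have "\<dots> = 0" using Q(3)[OF Dz] y(2) by (simp add: zz)
    finally show "eval_mpoly Q (case_sum (\<lambda>a. of_real (X a)) y) = 0" .
  qed
  ultimately show ?thesis by blast
qed

end

section \<open>Generic games and good points near a given one\<close>

context spohn_coords
begin

text \<open>There are finitely many forms and sets \<open>T\<close>, so the conditions on the game
  multiply to one. For each \<open>T\<close>, the product of the relations over all forms vanishes
  as soon as one form does.\<close>

lemma generic_dependence_all:
  assumes \<pi>: "\<And>k i. (k, i) \<in> K \<Longrightarrow> \<pi> k i \<in> R \<and> (\<pi> k i) k = i \<and> W (\<pi> k i) = 0"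
  shows "\<exists>q :: game \<Rightarrow> real. polyf ({1..n} \<times> R) q \<and> (\<exists>X. q X \<noteq> 0) \<and>
    (\<forall>X. q X \<noteq> 0 \<longrightarrow> (\<exists>Q. \<forall>T. T \<subseteq> I \<longrightarrow> card T = r \<longrightarrow> dependence W X (forms W) T (Q T)))"
proof -
  define B where "B = forms W \<times> {T. T \<subseteq> I \<and> card T = r}"
  have finB: "finite B" unfolding B_def using finite_forms finite_I by simp
  have "\<forall>b\<in>B. \<exists>q :: game \<Rightarrow> real. polyf ({1..n} \<times> R) q \<and> (\<exists>X. q X \<noteq> 0) \<and>
      (\<forall>X. q X \<noteq> 0 \<longrightarrow> (\<exists>Q. dependence W X {fst b} (snd b) Q))"
  proof
    fix b assume "b \<in> B"
    then have b: "fst b \<in> forms W" "snd b \<subseteq> I" "card (snd b) = r" by (auto simp: B_def)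
    show "\<exists>q :: game \<Rightarrow> real. polyf ({1..n} \<times> R) q \<and> (\<exists>X. q X \<noteq> 0) \<and>
        (\<forall>X. q X \<noteq> 0 \<longrightarrow> (\<exists>Q. dependence W X {fst b} (snd b) Q))"
      by (rule generic_dependence[OF \<pi> forms_polyf[OF b(1)] b(2,3)])
  qed
  from bchoice[OF this] obtain q :: "_ \<Rightarrow> game \<Rightarrow> real"
    where q: "\<forall>b\<in>B. polyf ({1..n} \<times> R) (q b) \<and> (\<exists>X. q b X \<noteq> 0) \<and>
      (\<forall>X. q b X \<noteq> 0 \<longrightarrow> (\<exists>Q. dependence W X {fst b} (snd b) Q))" ..
  have pq: "polyf ({1..n} \<times> R) (q b)" "\<exists>X. q b X \<noteq> 0" if "b \<in> B" for b
    by (rule conjunct1[OF bspec[OF q that]], rule conjunct1[OF conjunct2[OF bspec[OF q that]]])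
  have dep: "\<exists>Q. dependence W X {fst b} (snd b) Q" if "b \<in> B" "q b X \<noteq> 0" for b X
    using bspec[OF q that(1)] that(2) by (elim conjE allE[of _ X] impE)
  define q' where "q' X = (\<Prod>b\<in>B. q b X)" for X
  have "polyf ({1..n} \<times> R) q'" unfolding q'_def using pq by (intro polyf_prod)
  moreover have "\<exists>X. q' X \<noteq> 0"
    unfolding q'_def using pq by (rule polyf_common_nonzero_finite[OF finB])
  moreover have "\<exists>Q. \<forall>T. T \<subseteq> I \<longrightarrow> card T = r \<longrightarrow> dependence W X (forms W) T (Q T)"
    if X: "q' X \<noteq> 0" for X
  proof -
    have "q b X \<noteq> 0" if "b \<in> B" for b using X finB that by (auto simp: q'_def prod_zero_iff)
    then have "\<forall>b\<in>B. \<exists>Q. dependence W X {fst b} (snd b) Q" by (intro ballI dep)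
    from bchoice[OF this] obtain Q where Q: "\<And>b. b \<in> B \<Longrightarrow> dependence W X {fst b} (snd b) (Q b)"
      by blast
    show ?thesis
    proof (intro exI[of _ "\<lambda>T y. \<Prod>l\<in>forms W. Q (l, T) y"] allI impI)
      fix T assume T: "T \<subseteq> I" "card T = r"
      have QT: "dependence W X {l} T (Q (l, T))" if "l \<in> forms W" for l
        using Q[of "(l, T)"] T that by (simp add: B_def)
      show "dependence W X (forms W) T (\<lambda>y. \<Prod>l\<in>forms W. Q (l, T) y)"
        unfolding dependence_def
      proof (intro conjI allI impI)
        have p: "polyf T (Q (l, T))" "\<exists>y. Q (l, T) y \<noteq> 0" if "l \<in> forms W" for l
          using QT[OF that] by (auto simp: dependence_def)
        show "polyf T (\<lambda>y. \<Prod>l\<in>forms W. Q (l, T) y)" using p by (intro polyf_prod)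
        show "\<exists>y. (\<Prod>l\<in>forms W. Q (l, T) y) \<noteq> 0"
          using p by (rule polyf_common_nonzero_finite[OF finite_forms])
        fix y lam assume y: "\<forall>\<omega>\<in>\<Omega>. y (h \<omega>) \<noteq> 0" "\<exists>l\<in>forms W. l y = 0" "spohn_eqs W X y lam"
        then obtain l where l: "l \<in> forms W" "l y = 0" by blast
        then have "Q (l, T) y = 0" using QT[OF l(1)] y unfolding dependence_def by blast
        then show "(\<Prod>l\<in>forms W. Q (l, T) y) = 0" using l(1) finite_forms by (intro prod_zero) auto
      qed
    qed
  qed
  ultimately show ?thesis by blast
qed

text \<open>\<open>g\<close> describes the neighbourhood in which a point is sought. Without such a
  point, the locus cut out near \<open>y0\<close> by the chosen minors lies entirely in the zero
  sets of the forms, where every \<open>r\<close> coordinates are dependent; this contradicts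
  \<open>local_dimension_bound_at\<close>.\<close>

lemma good_point:
  assumes Q: "\<And>T. T \<subseteq> I \<Longrightarrow> card T = r \<Longrightarrow> dependence W X (forms W) T (Q T)"
    and y0: "\<forall>\<omega>\<in>\<Omega>. y0 (h \<omega>) \<noteq> 0"
    and i: "\<And>k. k \<in> {1..n} \<Longrightarrow> i k \<in> {1..d k} \<and> marginal n d k (i k) (\<phi> W y0) \<noteq> 0"
    and minors: "\<And>k a b. (k, a) \<in> K \<Longrightarrow> (k, b) \<in> K \<Longrightarrow> spohn_minor n d X k a b (\<phi> W y0) = 0"
    and g: "polyf R g" "g (\<phi> W y0) \<noteq> 0"
  shows "\<exists>y. (\<forall>\<omega>\<in>\<Omega>. y (h \<omega>) \<noteq> 0) \<and> (\<forall>l\<in>forms W. l y \<noteq> 0) \<and>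
    (\<forall>k a b. (k, a) \<in> K \<longrightarrow> (k, b) \<in> K \<longrightarrow> spohn_minor n d X k a b (\<phi> W y) = 0) \<and> g (\<phi> W y) \<noteq> 0"
proof (rule ccontr)
  assume neg: "\<not> ?thesis"
  \<comment> \<open>One row \<open>i k\<close> per player, with nonzero marginal, serves as
    reference. The minors of the other rows against it suffice, \<open>d k - 1\<close> for each
    player.\<close>
  define C where "C = K - (\<lambda>k. (k, i k)) ` {1..n}"
  have finC: "finite C" by (simp add: C_def finite_K)
  have "card C = (\<Sum>k\<in>{1..n}. d k - 1)"
  proof -
    have sub: "(\<lambda>k. (k, i k)) ` {1..n} \<subseteq> K" using i by (auto simp: K_def)
    have "card ((\<lambda>k. (k, i k)) ` {1..n}) = n" by (subst card_image) (auto simp: inj_on_def)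
    then have "card C = (\<Sum>k\<in>{1..n}. d k) - n"
      unfolding C_def using card_Diff_subset[OF _ sub] by (simp add: K_def)
    moreover have "(\<Sum>k\<in>{1..n}. d k) = (\<Sum>k\<in>{1..n}. (d k - 1) + 1)"
      using pos by (intro sum.cong refl) (auto simp: Suc_le_eq)
    ultimately show ?thesis by (simp only: sum.distrib) simp
  qed
  then have cardI: "card I = card C + r" by (simp add: card_I)
  define f where "f = (\<lambda>(k, a) y. spohn_minor n d X k (i k) a (\<phi> W y))"
  \<comment> \<open>Localization at \<open>y0\<close>: where \<open>G\<close> is nonzero, the torus
    parameters are nonzero, the ratios \<open>lam k\<close> are defined, and the neighbourhood
    condition holds.\<close>
  define G where "G y = (\<Prod>\<omega>\<in>\<Omega>. y (h \<omega>)) * (\<Prod>k\<in>{1..n}. marginal n d k (i k) (\<phi> W y)) * g (\<phi> W y)" for y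
  show False
  proof (rule local_dimension_bound_at[OF finite_I finC cardI, of f y0 G Q])
    show "1 \<le> r" by (simp add: r_def)
    show "polyf I (f c)" for c
      unfolding f_def by (cases c) (auto intro: polyf_\<phi>_compose polyf_minor)
    show "f c y0 = 0" if "c \<in> C" for c
      using that minors i by (auto simp: f_def C_def K_def)
    have "polyf I (\<lambda>y. \<Prod>\<omega>\<in>\<Omega>. y (h \<omega>))" using h_I by (intro polyf_intros)
    moreover have "polyf I (\<lambda>y. \<Prod>k\<in>{1..n}. marginal n d k (i k) (\<phi> W y))"
      by (intro polyf_prod polyf_\<phi>_compose polyf_marginal)
    ultimately show "polyf I G"
      unfolding G_def by (intro polyf_mult polyf_\<phi>_compose[OF g(1)])
    show "G y0 \<noteq> 0"
      using y0 i g(2) finite_\<Omega> by (auto simp: G_def prod_zero_iff)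
    show "polyf T (Q T) \<and> (\<exists>y. Q T y \<noteq> 0)" if "T \<subseteq> I" "card T = r" for T
      using Q[OF that] by (simp add: dependence_def)
    show "Q T y = 0" if T: "T \<subseteq> I" "card T = r" and fy: "\<forall>c\<in>C. f c y = 0" and Gy: "G y \<noteq> 0" for T y
    proof -
      have y: "\<forall>\<omega>\<in>\<Omega>. y (h \<omega>) \<noteq> 0" "g (\<phi> W y) \<noteq> 0"
        and m: "\<And>k. k \<in> {1..n} \<Longrightarrow> marginal n d k (i k) (\<phi> W y) \<noteq> 0"
        using Gy finite_\<Omega> by (auto simp: G_def prod_zero_iff)
      define lam where "lam k = payoff_sum n d X k (i k) (\<phi> W y) / marginal n d k (i k) (\<phi> W y)" for k
      have ratio: "payoff_sum n d X k a (\<phi> W y) = lam k * marginal n d k a (\<phi> W y)" if "(k, a) \<in> K" for k a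
      proof (cases "a = i k")
        case True
        then show ?thesis using m[of k] that by (simp add: lam_def K_def)
      next
        case False
        then have "(k, a) \<in> C" using that by (auto simp: C_def)
        then have "spohn_minor n d X k (i k) a (\<phi> W y) = 0" using fy by (auto simp: f_def)
        then show ?thesis using m[of k] that by (simp add: lam_def K_def spohn_minor_def field_simps)
      qed
      have "\<forall>k a b. (k, a) \<in> K \<longrightarrow> (k, b) \<in> K \<longrightarrow> spohn_minor n d X k a b (\<phi> W y) = 0"
        by (simp add: spohn_minor_def ratio)
      then have l: "\<exists>l\<in>forms W. l y = 0" using neg y by blast
      have "spohn_eqs W X y lam"
        unfolding spohn_eqs_def
      proof (intro ballI, clarify)
        fix k a assume "(k, a) \<in> K"
        then have "payoff_sum n d X k a (\<phi> W y) - lam k * marginal n d k a (\<phi> W y) = 0" using ratio by simp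
        then show "(\<Sum>j | j \<in> R \<and> j k = a. (of_real (X (k, j)) - lam k) * \<phi> W y j) = 0"
          by (simp add: payoff_sum_def marginal_def left_diff_distrib sum_subtractf sum_distrib_left)
      qed
      then show ?thesis using Q[OF T] y(1) l unfolding dependence_def by blast
    qed
  qed
qed

section \<open>Supports of points of the graphical model and charts through them\<close>

lemma cliques_nonempty: "maximal_cliques n E \<noteq> {}"
proof -
  let ?A = "{C. C \<subseteq> {1..n} \<and> clique C E}"
  have "finite ?A" by (rule finite_subset[of _ "Pow {1..n}"]) auto
  moreover have "{} \<in> ?A" by (simp add: clique_def)
  ultimately obtain C where "C \<in> ?A" "\<forall>D\<in>?A. C \<subseteq> D \<longrightarrow> C = D"
    using finite_has_maximal2[of ?A "{}"] by blast
  then have "C \<in> maximal_cliques n E" unfolding maximal_cliques_def by blast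
  then show ?thesis by blast
qed

text \<open>The exponent matrix of the monomial parametrization: row \<open>j\<close> contains
  exactly one parameter for each maximal clique.\<close>

definition inc :: "(nat \<Rightarrow> nat) \<Rightarrow> nat set \<times> (nat \<Rightarrow> nat) \<Rightarrow> nat" where
  "inc j \<omega> = (if restrict j (fst \<omega>) = snd \<omega> then 1 else 0)"

lemma sum_inc:
  fixes g :: "_ \<Rightarrow> 'a::comm_semiring_1"
  assumes "j \<in> R"
  shows "(\<Sum>\<omega>\<in>\<Omega>. of_nat (inc j \<omega>) * g \<omega>) = (\<Sum>C\<in>maximal_cliques n E. g (C, restrict j C))"
proof -
  have "(\<Sum>\<omega>\<in>\<Omega>. of_nat (inc j \<omega>) * g \<omega>) =
      (\<Sum>C\<in>maximal_cliques n E. \<Sum>c\<in>state_space C d. of_nat (inc j (C, c)) * g (C, c))"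
    unfolding \<Omega>_def using finite_cliques finite_state_space clique_subset
    by (subst sum.Sigma) (auto intro!: sum.cong)
  also have "\<dots> = (\<Sum>C\<in>maximal_cliques n E. \<Sum>c\<in>state_space C d. if restrict j C = c then g (C, c) else 0)"
    by (intro sum.cong refl) (auto simp: inc_def)
  also have "\<dots> = (\<Sum>C\<in>maximal_cliques n E. g (C, restrict j C))"
    using assms restrict_state finite_state_space[OF clique_subset] by (intro sum.cong refl) simp
  finally show ?thesis .
qed

lemma prod_inc:
  fixes g :: "_ \<Rightarrow> 'a::comm_semiring_1"
  assumes "j \<in> R"
  shows "(\<Prod>\<omega>\<in>\<Omega>. g \<omega> ^ inc j \<omega>) = (\<Prod>C\<in>maximal_cliques n E. g (C, restrict j C))"
proof -
  have "(\<Prod>\<omega>\<in>\<Omega>. g \<omega> ^ inc j \<omega>) =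
      (\<Prod>C\<in>maximal_cliques n E. \<Prod>c\<in>state_space C d. g (C, c) ^ inc j (C, c))"
    unfolding \<Omega>_def using finite_cliques finite_state_space clique_subset
    by (subst prod.Sigma) (auto intro!: prod.cong)
  also have "\<dots> = (\<Prod>C\<in>maximal_cliques n E. \<Prod>c\<in>state_space C d. if restrict j C = c then g (C, c) else 1)"
    by (intro prod.cong refl) (auto simp: inc_def)
  also have "\<dots> = (\<Prod>C\<in>maximal_cliques n E. g (C, restrict j C))"
    using assms restrict_state finite_state_space[OF clique_subset] by (intro prod.cong refl) simp
  finally show ?thesis .
qed

lemma class_in_proj_space:
  assumes "p \<in> nonzero_vectors J"
  shows "proj_rel J `` {p} \<in> proj_space J" "p \<in> proj_rel J `` {p}"
proof -
  show "proj_rel J `` {p} \<in> proj_space J"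
    using assms unfolding proj_space_def by (rule quotientI)
  show "p \<in> proj_rel J `` {p}"
    using assms by (auto simp: proj_rel_def intro!: exI[of _ 1])
qed

text \<open>The binomial vanishes on the image of the parametrization, and vanishing passes to the
  closure because the binomial is homogeneous. Its degree is determined by the column sums, since
  each row of \<open>inc\<close> has exactly one 1 among the parameters of a fixed clique
  \<open>C0\<close>.\<close>

lemma graphical_model_binomial:
  assumes P: "P \<in> graphical_model n d E" "p \<in> P"
    and uv: "\<And>\<omega>. \<omega> \<in> \<Omega> \<Longrightarrow> (\<Sum>j\<in>R. u j * inc j \<omega>) = (\<Sum>j\<in>R. v j * inc j \<omega>)"
  shows "(\<Prod>j\<in>R. p j ^ u j) = (\<Prod>j\<in>R. p j ^ v j)"
proof -
  define U where "U w = (\<Sum>j\<in>R. Poly_Mapping.single j (w j))" for w :: "(nat \<Rightarrow> nat) \<Rightarrow> nat"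
  have lU: "Poly_Mapping.lookup (U w) j = (if j \<in> R then w j else 0)" for w j
    using finite_R by (simp add: U_def lookup_sum lookup_single when_def)
  have kU: "Poly_Mapping.keys (U w) \<subseteq> R" for w
    by (auto simp: in_keys_iff lU split: if_splits)
  have dU: "monom_degree (U w) = (\<Sum>j\<in>R. w j)" for w
  proof -
    have "monom_degree (U w) = (\<Sum>j\<in>R. Poly_Mapping.lookup (U w) j)"
      unfolding monom_degree_def using kU finite_R
      by (intro sum.mono_neutral_left) (auto simp: in_keys_iff)
    then show ?thesis by (simp add: lU)
  qed
  define b where "b = (mmonom (U u) - mmonom (U v) :: (nat \<Rightarrow> nat, complex) mpoly)"
  have evb: "eval_mpoly b x = (\<Prod>j\<in>R. x j ^ u j) - (\<Prod>j\<in>R. x j ^ v j)" for x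
    by (simp add: b_def eval_mmonom[OF finite_R kU] lU)
  obtain C0 where C0: "C0 \<in> maximal_cliques n E" using cliques_nonempty by blast
  have deg: "(\<Sum>j\<in>R. w j) = (\<Sum>c\<in>state_space C0 d. \<Sum>j\<in>R. w j * inc j (C0, c))" for w :: "(nat \<Rightarrow> nat) \<Rightarrow> nat"
  proof -
    have "(\<Sum>c\<in>state_space C0 d. w j * inc j (C0, c)) = w j" if "j \<in> R" for j
    proof -
      have "(\<Sum>c\<in>state_space C0 d. w j * inc j (C0, c)) = (\<Sum>c\<in>state_space C0 d. if restrict j C0 = c then w j else 0)"
        by (intro sum.cong refl) (simp add: inc_def)
      then show ?thesis
        using restrict_state[OF that C0] finite_state_space[OF clique_subset[OF C0]] by simp
    qed
    then show ?thesis by (subst sum.swap) simp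
  qed
  have "(\<Sum>c\<in>state_space C0 d. \<Sum>j\<in>R. u j * inc j (C0, c)) = (\<Sum>c\<in>state_space C0 d. \<Sum>j\<in>R. v j * inc j (C0, c))"
    using C0 by (intro sum.cong refl uv) (auto simp: \<Omega>_def)
  then have "(\<Sum>j\<in>R. u j) = (\<Sum>j\<in>R. v j)"
    using deg[of u] deg[of v] by simp
  moreover have "Poly_Mapping.keys b \<subseteq> {U u, U v}"
    unfolding b_def by (auto simp: in_keys_iff lookup_minus mmonom_def lookup_single when_def split: if_splits)
  ultimately have m: "Poly_Mapping.keys m \<subseteq> R \<and> monom_degree m = (\<Sum>j\<in>R. v j)"
    if "m \<in> Poly_Mapping.keys b" for m
    using that kU[of u] kU[of v] dU[of u] dU[of v] by auto
  then have "b \<in> mpolys R" "\<forall>m\<in>Poly_Mapping.keys b. monom_degree m = (\<Sum>j\<in>R. v j)"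
    unfolding mpolys_def by simp_all
  then have hb: "b \<in> homogeneous_mpolys R"
    unfolding homogeneous_mpolys_def by blast
  have cl: "closedin (proj_zariski R) (proj_zeros R (eval_mpoly ` {b}))"
    unfolding closedin_proj_zariski using hb by blast
  let ?S = "{proj_rel R `` {clique_monomial n d E \<sigma>} | \<sigma>.
        \<sigma> \<in> (\<Pi>\<^sub>E C\<in>maximal_cliques n E. state_space C d \<rightarrow>\<^sub>E UNIV) \<and>
        clique_monomial n d E \<sigma> \<in> nonzero_vectors R}"
  have "?S \<subseteq> proj_zeros R (eval_mpoly ` {b})"
  proof
    fix P' assume "P' \<in> ?S"
    then obtain \<sigma> where \<sigma>: "P' = proj_rel R `` {clique_monomial n d E \<sigma>}"
      "clique_monomial n d E \<sigma> \<in> nonzero_vectors R" by blast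
    have cm: "clique_monomial n d E \<sigma> j = (\<Prod>\<omega>\<in>\<Omega>. \<sigma> (fst \<omega>) (snd \<omega>) ^ inc j \<omega>)" if "j \<in> R" for j
      using that prod_inc[OF that, of "\<lambda>\<omega>. \<sigma> (fst \<omega>) (snd \<omega>)"] by (simp add: clique_monomial_def)
    have "(\<Prod>j\<in>R. clique_monomial n d E \<sigma> j ^ w j) =
        (\<Prod>\<omega>\<in>\<Omega>. \<sigma> (fst \<omega>) (snd \<omega>) ^ (\<Sum>j\<in>R. w j * inc j \<omega>))" for w
    proof -
      have "(\<Prod>j\<in>R. clique_monomial n d E \<sigma> j ^ w j) =
          (\<Prod>j\<in>R. \<Prod>\<omega>\<in>\<Omega>. \<sigma> (fst \<omega>) (snd \<omega>) ^ (w j * inc j \<omega>))"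
        by (intro prod.cong refl) (simp add: cm prod_power_distrib power_mult[symmetric] mult.commute)
      also have "\<dots> = (\<Prod>\<omega>\<in>\<Omega>. \<Prod>j\<in>R. \<sigma> (fst \<omega>) (snd \<omega>) ^ (w j * inc j \<omega>))" by (rule prod.swap)
      finally show ?thesis by (simp add: power_sum)
    qed
    then have b0: "eval_mpoly b (clique_monomial n d E \<sigma>) = 0"
      unfolding evb using uv by simp
    have "eval_mpoly b q = 0" if q: "q \<in> P'" for q
    proof -
      obtain c where "\<forall>i\<in>R. q i = c * clique_monomial n d E \<sigma> i"
        using q \<sigma>(1) by (auto simp: proj_rel_def)
      then show ?thesis using eval_homogeneous_scale[OF hb] b0 by (metis mult_zero_right)
    qed
    then show "P' \<in> proj_zeros R (eval_mpoly ` {b})"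
      using class_in_proj_space(1)[OF \<sigma>(2)] \<sigma>(1) by (simp add: proj_zeros_def)
  qed
  then have "graphical_model n d E \<subseteq> proj_zeros R (eval_mpoly ` {b})"
    unfolding graphical_model_def by (rule closure_of_minimal[OF _ cl])
  then have "eval_mpoly b p = 0" using P by (auto simp: proj_zeros_def)
  then show ?thesis by (simp add: evb)
qed

text \<open>For \<open>F \<subseteq> R\<close>, such a \<open>w\<close> is a one-parameter subgroup
  of the torus whose limit at 0 kills exactly the coordinates outside \<open>F\<close>.\<close>

definition face_weight :: "(nat set \<times> (nat \<Rightarrow> nat) \<Rightarrow> int) \<Rightarrow> (nat \<Rightarrow> nat) set \<Rightarrow> bool" where
  "face_weight w F \<longleftrightarrow> (\<forall>j\<in>F. (\<Sum>\<omega>\<in>\<Omega>. int (inc j \<omega>) * w \<omega>) = 0) \<and>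
    (\<forall>j\<in>R - F. 0 < (\<Sum>\<omega>\<in>\<Omega>. int (inc j \<omega>) * w \<omega>))"

definition weight :: "(nat set \<times> (nat \<Rightarrow> nat) \<Rightarrow> int) \<Rightarrow> (nat \<Rightarrow> nat) \<Rightarrow> nat" where
  "weight w j = nat (\<Sum>\<omega>\<in>\<Omega>. int (inc j \<omega>) * w \<omega>)"

text \<open>If \<open>v\<close> lives on the support of \<open>p\<close>, its monomial is nonzero at
  \<open>p\<close>. Then so is the monomial of any \<open>u\<close> with the same image under
  \<open>inc\<close>, which forces \<open>u\<close> to live on the support as well.\<close>

lemma graphical_model_face_weight:
  assumes P: "P \<in> graphical_model n d E" "p \<in> P"
  shows "\<exists>w. face_weight w {j\<in>R. p j \<noteq> 0}"
  unfolding face_weight_def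
proof (rule supporting_weight[OF finite_\<Omega> finite_R])
  fix u v :: "(nat \<Rightarrow> nat) \<Rightarrow> nat"
  assume e: "\<forall>\<omega>\<in>\<Omega>. (\<Sum>j\<in>R. int (u j) * int (inc j \<omega>)) = (\<Sum>j\<in>R. int (v j) * int (inc j \<omega>))"
    and v: "\<forall>j\<in>R - {j \<in> R. p j \<noteq> 0}. v j = 0"
  have "(\<Sum>j\<in>R. u j * inc j \<omega>) = (\<Sum>j\<in>R. v j * inc j \<omega>)" if "\<omega> \<in> \<Omega>" for \<omega>
  proof -
    have "int (\<Sum>j\<in>R. u j * inc j \<omega>) = int (\<Sum>j\<in>R. v j * inc j \<omega>)" using e that by simp
    then show ?thesis by (simp only: of_nat_eq_iff)
  qed
  then have "(\<Prod>j\<in>R. p j ^ u j) = (\<Prod>j\<in>R. p j ^ v j)" by (rule graphical_model_binomial[OF P])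
  also have "\<dots> \<noteq> 0" using v finite_R by (auto simp: prod_zero_iff)
  finally show "\<forall>j\<in>R - {j \<in> R. p j \<noteq> 0}. u j = 0" using finite_R by (auto simp: prod_zero_iff)
qed auto

text \<open>On their support the coordinates of \<open>p\<close> satisfy every multiplicative
  relation of the rows of \<open>inc\<close>, so \<open>character_extension\<close> writes them with
  nonzero parameters. Setting \<open>y 0 = 0\<close> produces the vanishing coordinates.\<close>

lemma graphical_model_face_point:
  assumes P: "P \<in> graphical_model n d E" "p \<in> P" and w: "face_weight w {j\<in>R. p j \<noteq> 0}"
  shows "\<exists>y. (\<forall>\<omega>\<in>\<Omega>. y (h \<omega>) \<noteq> 0) \<and> (\<forall>j\<in>R. \<phi> (weight w) y j = p j)"
proof -
  define F where "F = {j\<in>R. p j \<noteq> 0}"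
  have FR: "F \<subseteq> R" by (auto simp: F_def)
  have finF: "finite F" using FR finite_R finite_subset by blast
  have "\<exists>s. (\<forall>\<omega>. s \<omega> \<noteq> 0) \<and> (\<forall>j\<in>F. p j = (\<Prod>\<omega>\<in>\<Omega>. s \<omega> powi int (inc j \<omega>)))"
  proof (rule character_extension[OF finite_\<Omega> finF])
    show "p j \<noteq> 0" if "j \<in> F" for j using that by (simp add: F_def)
    fix u assume u: "\<forall>\<omega>\<in>\<Omega>. (\<Sum>j\<in>F. u j * int (inc j \<omega>)) = 0"
    \<comment> \<open>Positive and negative parts turn the Laurent relation into a binomial.\<close>
    define up um where "up j = (if j \<in> F then nat (u j) else 0)" and "um j = (if j \<in> F then nat (- u j) else 0)" for j
    have "(\<Sum>j\<in>R. up j * inc j \<omega>) = (\<Sum>j\<in>R. um j * inc j \<omega>)" if \<omega>: "\<omega> \<in> \<Omega>" for \<omega>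
    proof -
      have "int (\<Sum>j\<in>R. up j * inc j \<omega>) - int (\<Sum>j\<in>R. um j * inc j \<omega>) =
          (\<Sum>j\<in>R. (int (up j) - int (um j)) * int (inc j \<omega>))"
        by (simp add: left_diff_distrib sum_subtractf)
      also have "\<dots> = (\<Sum>j\<in>F. u j * int (inc j \<omega>))"
        using FR finite_R by (intro sum.mono_neutral_cong_right) (auto simp: up_def um_def)
      also have "\<dots> = 0" using u \<omega> by blast
      finally show ?thesis by (simp only: right_minus_eq of_nat_eq_iff)
    qed
    then have "(\<Prod>j\<in>R. p j ^ up j) = (\<Prod>j\<in>R. p j ^ um j)" by (rule graphical_model_binomial[OF P])
    moreover have "(\<Prod>j\<in>R. p j ^ g j) = (\<Prod>j\<in>F. p j ^ g j)" if "\<And>j. j \<notin> F \<Longrightarrow> g j = 0" for g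
      using that FR finite_R by (intro prod.mono_neutral_right) auto
    ultimately have e: "(\<Prod>j\<in>F. p j ^ up j) = (\<Prod>j\<in>F. p j ^ um j)" by (simp add: up_def um_def)
    have "(\<Prod>j\<in>F. p j powi u j) = (\<Prod>j\<in>F. p j ^ up j / p j ^ um j)"
    proof (intro prod.cong refl)
      fix j assume j: "j \<in> F"
      show "p j powi u j = p j ^ up j / p j ^ um j"
        using j by (cases "0 \<le> u j") (auto simp: up_def um_def power_int_def field_simps)
    qed
    also have "\<dots> = 1"
      using e finF by (simp add: prod_dividef prod_zero_iff F_def)
    finally show "(\<Prod>j\<in>F. p j powi u j) = 1" .
  qed
  then obtain s where s: "\<And>\<omega>. s \<omega> \<noteq> 0" "\<And>j. j \<in> F \<Longrightarrow> p j = (\<Prod>\<omega>\<in>\<Omega>. s \<omega> ^ inc j \<omega>)" by auto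
  define y where "y i = (if i = 0 then 0 else s (inv_into \<Omega> h i))" for i
  have yh: "y (h \<omega>) = s \<omega>" if "\<omega> \<in> \<Omega>" for \<omega>
    using that bij_betwE[OF h] inv_into_f_f[OF bij_betw_imp_inj_on[OF h] that] by (fastforce simp: y_def)
  have "\<phi> (weight w) y j = p j" if j: "j \<in> R" for j
  proof (cases "j \<in> F")
    case True
    have "mono y j = (\<Prod>C\<in>maximal_cliques n E. s (C, restrict j C))"
      unfolding mono_def using yh in_\<Omega>[OF j] by (intro prod.cong refl) auto
    also have "\<dots> = p j" using s(2)[OF True] prod_inc[OF j, of s] by simp
    finally show ?thesis using w True by (simp add: \<phi>_def weight_def face_weight_def F_def)
  next
    case False
    then have "0 < weight w j" using w j by (simp add: weight_def face_weight_def F_def)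
    then show ?thesis using False j by (simp add: \<phi>_def y_def F_def)
  qed
  then show ?thesis using s(1) yh by (intro exI[of _ y]) auto
qed

text \<open>For nonzero \<open>y 0\<close> the point lies in the image of the parametrization
  itself: the power of \<open>y 0\<close> is absorbed into the clique parameters, with possibly
  negative exponents \<open>w\<close>.\<close>

lemma \<phi>_in_graphical_model:
  assumes y: "\<forall>\<omega>\<in>\<Omega>. y (h \<omega>) \<noteq> 0" "y 0 \<noteq> 0" and w: "face_weight w F" "F \<subseteq> R"
  shows "restrict (\<phi> (weight w) y) R \<in> nonzero_vectors R"
    "proj_rel R `` {restrict (\<phi> (weight w) y) R} \<in> graphical_model n d E"
proof -
  have nz: "\<phi> (weight w) y j \<noteq> 0" if "j \<in> R" for j
    using mono_nonzero[OF y(1) that] y(2) by (simp add: \<phi>_def)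
  have R0: "R \<noteq> {}"
  proof (cases "n = 0")
    case False
    then show ?thesis using slice_nonempty[of 1 1] pos[of 1] by auto
  qed (simp add: state_space_def)
  show nzv: "restrict (\<phi> (weight w) y) R \<in> nonzero_vectors R"
    using nz R0 by (auto simp: nonzero_vectors_def)
  define \<sigma> where "\<sigma> = (\<lambda>C\<in>maximal_cliques n E. \<lambda>c\<in>state_space C d. y 0 powi w (C, c) * y (h (C, c)))"
  have "clique_monomial n d E \<sigma> = restrict (\<phi> (weight w) y) R"
    unfolding clique_monomial_def
  proof (rule restrict_ext)
    fix j assume j: "j \<in> R"
    have "(\<Prod>C\<in>maximal_cliques n E. \<sigma> C (restrict j C)) =
        (\<Prod>C\<in>maximal_cliques n E. y 0 powi w (C, restrict j C) * y (h (C, restrict j C)))"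
      using restrict_state[OF j] by (intro prod.cong refl) (simp add: \<sigma>_def)
    also have "\<dots> = y 0 powi (\<Sum>C\<in>maximal_cliques n E. w (C, restrict j C)) * mono y j"
      using y(2) by (simp add: prod.distrib power_int_sum mono_def)
    also have "(\<Sum>C\<in>maximal_cliques n E. w (C, restrict j C)) = (\<Sum>\<omega>\<in>\<Omega>. int (inc j \<omega>) * w \<omega>)"
      using sum_inc[OF j, of w] by simp
    also have "\<dots> = int (weight w j)"
      using w j unfolding face_weight_def weight_def by (cases "j \<in> F") (auto simp: less_imp_le)
    finally show "(\<Prod>C\<in>maximal_cliques n E. \<sigma> C (restrict j C)) = \<phi> (weight w) y j"
      by (simp only: \<phi>_def power_int_of_nat)
  qed
  moreover have "\<sigma> \<in> (\<Pi>\<^sub>E C\<in>maximal_cliques n E. state_space C d \<rightarrow>\<^sub>E UNIV)"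
    by (auto simp: \<sigma>_def)
  ultimately have "proj_rel R `` {restrict (\<phi> (weight w) y) R} \<in>
      {proj_rel R `` {clique_monomial n d E \<sigma>} | \<sigma>.
        \<sigma> \<in> (\<Pi>\<^sub>E C\<in>maximal_cliques n E. state_space C d \<rightarrow>\<^sub>E UNIV) \<and>
        clique_monomial n d E \<sigma> \<in> nonzero_vectors R}"
    using nzv by (metis (mono_tags, lifting) mem_Collect_eq)
  moreover have "{proj_rel R `` {clique_monomial n d E \<sigma>} | \<sigma>.
        \<sigma> \<in> (\<Pi>\<^sub>E C\<in>maximal_cliques n E. state_space C d \<rightarrow>\<^sub>E UNIV) \<and>
        clique_monomial n d E \<sigma> \<in> nonzero_vectors R} \<subseteq> topspace (proj_zariski R)"
    unfolding topspace_proj_zariski using class_in_proj_space(1) by blast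
  ultimately show "proj_rel R `` {restrict (\<phi> (weight w) y) R} \<in> graphical_model n d E"
    unfolding graphical_model_def using closure_of_subset by blast
qed

end

section \<open>Generic Spohn conditional independence varieties\<close>

text \<open>Fixing the degree makes homogeneous polynomials closed under addition, which
  \<open>homogeneous_mpolys\<close> is not.\<close>

definition hom_degree :: "'i set \<Rightarrow> nat \<Rightarrow> ('i, 'a::comm_ring_1) mpoly \<Rightarrow> bool" where
  "hom_degree J k f \<longleftrightarrow> f \<in> mpolys J \<and> (\<forall>m\<in>Poly_Mapping.keys f. monom_degree m = k)"

lemma hom_degree_homogeneous: "hom_degree J k f \<Longrightarrow> f \<in> homogeneous_mpolys J"
  by (auto simp: hom_degree_def homogeneous_mpolys_def)

lemma hom_degree_add: "hom_degree J k f \<Longrightarrow> hom_degree J k g \<Longrightarrow> hom_degree J k (f + g)"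
  unfolding hom_degree_def using Poly_Mapping.keys_add[of f g] by (auto simp: mpolys_add)

lemma hom_degree_uminus: "hom_degree J k f \<Longrightarrow> hom_degree J k (- f)"
  unfolding hom_degree_def by (auto simp: mpolys_uminus in_keys_iff)

lemma hom_degree_diff: "hom_degree J k f \<Longrightarrow> hom_degree J k g \<Longrightarrow> hom_degree J k (f - g)"
  using hom_degree_add[of J k f "- g"] hom_degree_uminus[of J k g] by simp

lemma hom_degree_mult: "hom_degree J k f \<Longrightarrow> hom_degree J l g \<Longrightarrow> hom_degree J (k + l) (f * g)"
  unfolding hom_degree_def by (auto simp: mpolys_mult monom_degree_add elim!: keys_mult_mono)

lemma hom_degree_sum: "(\<And>a. a \<in> A \<Longrightarrow> hom_degree J k (f a)) \<Longrightarrow> hom_degree J k (\<Sum>a\<in>A. f a)"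
  by (induction A rule: infinite_finite_induct) (simp_all add: hom_degree_add, simp_all add: hom_degree_def)

lemma hom_degree_scaled_var: "i \<in> J \<Longrightarrow> hom_degree J 1 (mconst c * mvar i)"
  unfolding hom_degree_def mconst_def mvar_def mult_single
  by (auto simp: mpolys_def monom_degree_def)

lemma closedin_proj_zeros:
  assumes "\<And>f. f \<in> F \<Longrightarrow> \<exists>p\<in>homogeneous_mpolys J. f = eval_mpoly p"
  shows "closedin (proj_zariski J) (proj_zeros J F)"
proof -
  have "F = eval_mpoly ` {p\<in>homogeneous_mpolys J. eval_mpoly p \<in> F}" using assms by blast
  then show ?thesis
    unfolding closedin_proj_zariski
    by (intro exI[of _ "{p\<in>homogeneous_mpolys J. eval_mpoly p \<in> F}"]) auto
qed

lemma (in spohn_setting) marginal_hom: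
  "\<exists>p. hom_degree R 1 p \<and> marginal n d k i = eval_mpoly p"
proof (intro exI conjI ext)
  show "hom_degree R 1 (\<Sum>j | j \<in> R \<and> j k = i. mconst 1 * mvar j)"
    by (intro hom_degree_sum hom_degree_scaled_var) auto
qed (simp add: marginal_def)

lemma (in spohn_setting) payoff_sum_hom:
  "\<exists>p. hom_degree R 1 p \<and> payoff_sum n d X k i = eval_mpoly p"
proof (intro exI conjI ext)
  show "hom_degree R 1 (\<Sum>j | j \<in> R \<and> j k = i. mconst (of_real (X (k, j))) * mvar j)"
    by (intro hom_degree_sum hom_degree_scaled_var) auto
qed (simp add: payoff_sum_def)

lemma (in spohn_setting) closedin_spohn_variety: "closedin (proj_zariski R) (spohn_variety n d X)"
  unfolding spohn_variety_def
proof (rule closedin_proj_zeros)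
  fix f assume "f \<in> {spohn_minor n d X k i l | k i l. k \<in> {1..n} \<and> i \<in> {1..d k} \<and> l \<in> {1..d k} \<and> i < l}"
  then obtain k i l where f: "f = spohn_minor n d X k i l" by blast
  obtain p1 p2 p3 p4 where p: "hom_degree R 1 p1" "marginal n d k i = eval_mpoly p1"
    "hom_degree R 1 p2" "payoff_sum n d X k l = eval_mpoly p2"
    "hom_degree R 1 p3" "payoff_sum n d X k i = eval_mpoly p3"
    "hom_degree R 1 p4" "marginal n d k l = eval_mpoly p4"
    using marginal_hom payoff_sum_hom by metis
  have "hom_degree R (1 + 1) (p1 * p2 - p3 * p4)"
    using p by (intro hom_degree_diff hom_degree_mult)
  moreover have "f = eval_mpoly (p1 * p2 - p3 * p4)"
    by (rule ext) (simp add: f spohn_minor_def p)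
  ultimately show "\<exists>p\<in>homogeneous_mpolys R. f = eval_mpoly p"
    using hom_degree_homogeneous by blast
qed

lemma (in spohn_setting) closedin_marginal_hyperplane:
  "closedin (proj_zariski R) (marginal_hyperplane n d k a)"
  unfolding marginal_hyperplane_def
proof (rule closedin_proj_zeros)
  fix f assume f: "f \<in> {marginal n d k a}"
  obtain p where p: "hom_degree R 1 p" "marginal n d k a = eval_mpoly p" using marginal_hom by blast
  show "\<exists>p\<in>homogeneous_mpolys R. f = eval_mpoly p"
    using hom_degree_homogeneous[OF p(1)] f p(2) by (intro bexI[of _ p]) simp_all
qed

lemma (in spohn_setting) linear_scale:
  assumes "\<And>j. j \<in> R \<Longrightarrow> q j = c * p j"
  shows "marginal n d k i q = c * marginal n d k i p"
    "payoff_sum n d X k i q = c * payoff_sum n d X k i p"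
    "spohn_minor n d X k i l q = c\<^sup>2 * spohn_minor n d X k i l p"
    "total q = c * total p"
proof -
  show m: "marginal n d k i q = c * marginal n d k i p" for k i
    unfolding marginal_def sum_distrib_left using assms by (intro sum.cong) auto
  show s: "payoff_sum n d X k i q = c * payoff_sum n d X k i p" for k i
    unfolding payoff_sum_def sum_distrib_left using assms by (intro sum.cong) auto
  show "spohn_minor n d X k i l q = c\<^sup>2 * spohn_minor n d X k i l p"
    by (simp add: spohn_minor_def m s power2_eq_square algebra_simps)
  show "total q = c * total p"
    unfolding total_def sum_distrib_left using assms by (intro sum.cong) auto
qed

lemma (in spohn_setting) total_eq_sum_marginals:
  assumes "k \<in> {1..n}"
  shows "total p = (\<Sum>i\<in>{1..d k}. marginal n d k i p)"
  unfolding total_def marginal_def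
proof (rule sum.group[symmetric, where g = "\<lambda>j. j k", OF finite_R])
  show "(\<lambda>j. j k) ` R \<subseteq> {1..d k}" using R_coord[OF _ assms] by blast
qed simp

section \<open>Density of the general points\<close>

context spohn_coords
begin

text \<open>Both closures to be compared are shown equal to the closure of this set.\<close>

definition general_points :: "game \<Rightarrow> ((nat \<Rightarrow> nat) \<Rightarrow> complex) set set" where
  "general_points X = graphical_model n d E \<inter> spohn_variety n d X - excluded_hyperplanes n d -
    (\<Union>(k, a)\<in>K. marginal_hyperplane n d k a)"

text \<open>Points outside \<open>W\<close> and points outside all marginal hyperplanes are treated
  alike: in both cases the support meets every slice and every player has a nonzero marginal. The
  basic open set given by \<open>g\<close> is pulled back along the chart through the point.\<close>

lemma in_closure_general_points:
  assumes Q: "\<And>w F. face_weight w F \<Longrightarrow> F \<subseteq> R \<Longrightarrow> (\<forall>(k, i)\<in>K. \<exists>j\<in>F. j k = i) \<Longrightarrow>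
      \<exists>w Q. face_weight w F \<and>
        (\<forall>T. T \<subseteq> I \<longrightarrow> card T = r \<longrightarrow> dependence (weight w) X (forms (weight w)) T (Q T))"
    and P: "P \<in> graphical_model n d E" "P \<in> spohn_variety n d X"
    and ex: "P \<notin> excluded_hyperplanes n d \<or> P \<notin> (\<Union>(k, a)\<in>K. marginal_hyperplane n d k a)"
  shows "P \<in> proj_zariski R closure_of general_points X"
  unfolding in_closure_of
proof (intro conjI allI impI)
  have Pp: "P \<in> proj_space R" using P(2) by (simp add: spohn_variety_def proj_zeros_def)
  then show "P \<in> topspace (proj_zariski R)" by (simp add: topspace_proj_zariski)
  fix N assume N: "P \<in> N \<and> openin (proj_zariski R) N"
  then obtain G where G: "G \<subseteq> homogeneous_mpolys R" "N = proj_space R - proj_zeros R (eval_mpoly ` G)"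
    unfolding openin_proj_zariski by blast
  then obtain g p where g: "g \<in> G" "p \<in> P" "eval_mpoly g p \<noteq> 0"
    using N Pp by (auto simp: proj_zeros_def)
  define F where "F = {j\<in>R. p j \<noteq> 0}"
  have FR: "F \<subseteq> R" by (auto simp: F_def)
  have scale: "\<exists>c. c \<noteq> 0 \<and> (\<forall>j\<in>R. p j = c * q j)" if "q \<in> P" for q
    using proj_space_related[OF Pp that g(2)] .
  have cases: "(\<forall>(k, a)\<in>K. marginal n d k a p \<noteq> 0) \<or> (F = R \<and> total p \<noteq> 0)"
  proof (cases "P \<in> excluded_hyperplanes n d")
    case True
    then have nH: "P \<notin> (\<Union>(k, a)\<in>K. marginal_hyperplane n d k a)" using ex by blast
    have "marginal n d k a p \<noteq> 0" if ka: "(k, a) \<in> K" for k a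
    proof -
      have "P \<notin> marginal_hyperplane n d k a" using nH ka by blast
      then obtain q where q: "q \<in> P" "marginal n d k a q \<noteq> 0"
        using Pp by (auto simp: marginal_hyperplane_def proj_zeros_def)
      obtain c where "c \<noteq> 0" "\<And>j. j \<in> R \<Longrightarrow> p j = c * q j" using scale[OF q(1)] by blast
      then show ?thesis using linear_scale(1)[of p c q k a] q(2) by simp
    qed
    then show ?thesis by blast
  next
    case False
    have "p j \<noteq> 0" if j: "j \<in> R" for j
    proof -
      have "P \<notin> proj_zeros R {\<lambda>p. p j}" using False j by (auto simp: excluded_hyperplanes_def)
      then obtain q where q: "q \<in> P" "q j \<noteq> 0" using Pp by (auto simp: proj_zeros_def)
      then show ?thesis using scale[OF q(1)] j by auto
    qed
    moreover have "total p \<noteq> 0"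
    proof -
      have "P \<notin> proj_zeros R {\<lambda>p. \<Sum>j\<in>R. p j}" using False by (auto simp: excluded_hyperplanes_def)
      then obtain q where q: "q \<in> P" "total q \<noteq> 0" using Pp by (auto simp: proj_zeros_def total_def)
      obtain c where "c \<noteq> 0" "\<And>j. j \<in> R \<Longrightarrow> p j = c * q j" using scale[OF q(1)] by blast
      then show ?thesis using linear_scale(4)[of p c q] q(2) by simp
    qed
    ultimately show ?thesis by (auto simp: F_def)
  qed
  have pivot: "\<exists>i. i \<in> {1..d k} \<and> marginal n d k i p \<noteq> 0" if k: "k \<in> {1..n}" for k
    using cases
  proof
    assume "\<forall>(k, a)\<in>K. marginal n d k a p \<noteq> 0"
    moreover have "1 \<in> {1..d k}" using pos[OF k] by auto
    ultimately show ?thesis using k by (auto simp: K_def)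
  next
    assume "F = R \<and> total p \<noteq> 0"
    then show ?thesis using total_eq_sum_marginals[OF k, of p] by (metis sum.neutral)
  qed
  have "\<forall>(k, i)\<in>K. \<exists>j\<in>F. j k = i"
    using cases
  proof
    assume m: "\<forall>(k, a)\<in>K. marginal n d k a p \<noteq> 0"
    show ?thesis
    proof clarify
      fix k i assume "(k, i) \<in> K"
      then have "(\<Sum>j | j \<in> R \<and> j k = i. p j) \<noteq> 0" using m by (auto simp: marginal_def)
      then obtain j where "j \<in> {j. j \<in> R \<and> j k = i}" "p j \<noteq> 0" by (rule sum.not_neutral_contains_not_neutral)
      then show "\<exists>j\<in>F. j k = i" by (auto simp: F_def)
    qed
  next
    assume "F = R \<and> total p \<noteq> 0"
    then show ?thesis using slice_nonempty by (auto simp: K_def)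
  qed
  \<comment> \<open>The weight \<open>w0\<close> only shows that the support is a face. The chart
    uses the weight \<open>w\<close> for which the game is known to be generic; both belong to the
    same \<open>F\<close>.\<close>
  moreover obtain w0 where "face_weight w0 F"
    using graphical_model_face_weight[OF P(1) g(2)] unfolding F_def by blast
  ultimately obtain w Q' where w: "face_weight w F"
    and Q': "\<And>T. T \<subseteq> I \<Longrightarrow> card T = r \<Longrightarrow> dependence (weight w) X (forms (weight w)) T (Q' T)"
    using Q[OF _ FR, of w0] by blast
  obtain y0 where y0: "\<forall>\<omega>\<in>\<Omega>. y0 (h \<omega>) \<noteq> 0" "\<And>j. j \<in> R \<Longrightarrow> \<phi> (weight w) y0 j = 1 * p j"
    using graphical_model_face_point[OF P(1) g(2), folded F_def, OF w] by auto
  note ls = linear_scale[of "\<phi> (weight w) y0" 1 p, OF y0(2)]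
  have "\<forall>k\<in>{1..n}. \<exists>i. i \<in> {1..d k} \<and> marginal n d k i p \<noteq> 0" using pivot by blast
  from bchoice[OF this] obtain i where i:
    "\<And>k. k \<in> {1..n} \<Longrightarrow> i k \<in> {1..d k} \<and> marginal n d k (i k) p \<noteq> 0" by blast
  have gR: "g \<in> mpolys R" using g(1) G(1) homogeneous_mpolysD by blast
  have minor_p: "spohn_minor n d X k a b p = 0" if "(k, a) \<in> K" "(k, b) \<in> K" for k a b
  proof -
    have lt: "spohn_minor n d X k a b p = 0" if "(k, a) \<in> K" "(k, b) \<in> K" "a < b" for a b
    proof -
      have "spohn_minor n d X k a b \<in> {spohn_minor n d X k i l | k i l.
          k \<in> {1..n} \<and> i \<in> {1..d k} \<and> l \<in> {1..d k} \<and> i < l}"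
        using that unfolding K_def by blast
      moreover have "\<forall>f\<in>{spohn_minor n d X k i l | k i l.
          k \<in> {1..n} \<and> i \<in> {1..d k} \<and> l \<in> {1..d k} \<and> i < l}. \<forall>p\<in>P. f p = 0"
        using P(2) unfolding spohn_variety_def proj_zeros_def by (elim CollectE conjE)
      ultimately have "\<forall>p\<in>P. spohn_minor n d X k a b p = 0" by (rule bspec[rotated])
      then show ?thesis using g(2) by (rule bspec)
    qed
    consider "a < b" | "b < a" | "a = b" by linarith
    then show ?thesis
    proof cases
      case 2
      then show ?thesis using lt[of b a] that by (simp add: spohn_minor_def algebra_simps)
    qed (use lt that in \<open>auto simp: spohn_minor_def\<close>)
  qed
  have "\<exists>y. (\<forall>\<omega>\<in>\<Omega>. y (h \<omega>) \<noteq> 0) \<and> (\<forall>l\<in>forms (weight w). l y \<noteq> 0) \<and>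
    (\<forall>k a b. (k, a) \<in> K \<longrightarrow> (k, b) \<in> K \<longrightarrow> spohn_minor n d X k a b (\<phi> (weight w) y) = 0) \<and>
    eval_mpoly g (\<phi> (weight w) y) \<noteq> 0"
  proof (rule good_point[OF Q' y0(1)])
    show "i k \<in> {1..d k} \<and> marginal n d k (i k) (\<phi> (weight w) y0) \<noteq> 0" if "k \<in> {1..n}" for k
      using i[OF that] ls(1) by simp
    show "spohn_minor n d X k a b (\<phi> (weight w) y0) = 0" if "(k, a) \<in> K" "(k, b) \<in> K" for k a b
      using minor_p[OF that] ls(3) by simp
    show "polyf R (eval_mpoly g)" by (rule polyf_eval[OF gR])
    show "eval_mpoly g (\<phi> (weight w) y0) \<noteq> 0"
      using g(3) eval_mpoly_cong[OF gR, of "\<phi> (weight w) y0" p] y0(2) by simp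
  qed
  then obtain y where y: "\<forall>\<omega>\<in>\<Omega>. y (h \<omega>) \<noteq> 0" "\<And>l. l \<in> forms (weight w) \<Longrightarrow> l y \<noteq> 0"
    "\<And>k a b. (k, a) \<in> K \<Longrightarrow> (k, b) \<in> K \<Longrightarrow> spohn_minor n d X k a b (\<phi> (weight w) y) = 0"
    "eval_mpoly g (\<phi> (weight w) y) \<noteq> 0" by blast
  have yf: "y 0 \<noteq> 0" "total (\<phi> (weight w) y) \<noteq> 0"
    "\<And>k a. (k, a) \<in> K \<Longrightarrow> marginal n d k a (\<phi> (weight w) y) \<noteq> 0"
  proof -
    have "(\<lambda>y. y 0) \<in> forms (weight w)" "(\<lambda>y. total (\<phi> (weight w) y)) \<in> forms (weight w)"
      by (simp_all add: forms_def)
    from this[THEN y(2)] show "y 0 \<noteq> 0" "total (\<phi> (weight w) y) \<noteq> 0" by simp_all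
    fix k a assume "(k, a) \<in> K"
    then have "(\<lambda>y. marginal n d k a (\<phi> (weight w) y)) \<in> forms (weight w)"
      unfolding forms_def by (intro UnI2) (rule image_eqI[of _ _ "(k, a)"], simp_all)
    from y(2)[OF this] show "marginal n d k a (\<phi> (weight w) y) \<noteq> 0" by simp
  qed
  define q where "q = restrict (\<phi> (weight w) y) R"
  define P' where "P' = proj_rel R `` {q}"
  have qn: "q \<in> nonzero_vectors R" and P'M: "P' \<in> graphical_model n d E"
    using \<phi>_in_graphical_model[OF y(1) yf(1) w FR] by (simp_all add: q_def P'_def)
  have P': "P' \<in> proj_space R" "q \<in> P'" using class_in_proj_space[OF qn] by (simp_all add: P'_def)
  have q\<phi>: "q j = 1 * \<phi> (weight w) y j" if "j \<in> R" for j using that by (simp add: q_def)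
  note lq = linear_scale[of q 1 "\<phi> (weight w) y", OF q\<phi>]
  have "P' \<in> spohn_variety n d X"
    unfolding spohn_variety_def proj_zeros_def
  proof (intro CollectI conjI ballI P'(1))
    fix f x assume f: "f \<in> {spohn_minor n d X k i l | k i l.
        k \<in> {1..n} \<and> i \<in> {1..d k} \<and> l \<in> {1..d k} \<and> i < l}" and x: "x \<in> P'"
    obtain c where "\<And>j. j \<in> R \<Longrightarrow> x j = c * q j"
      using proj_space_related[OF P' x] by blast
    note lx = linear_scale(3)[of x c q, OF this]
    obtain k a b where "f = spohn_minor n d X k a b" "(k, a) \<in> K" "(k, b) \<in> K"
      using f by (auto simp: K_def)
    then show "f x = 0" using lx lq(3) y(3) by simp
  qed
  moreover have "P' \<notin> excluded_hyperplanes n d"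
  proof -
    have "q j \<noteq> 0" if "j \<in> R" for j
      using q\<phi>[OF that] mono_nonzero[OF y(1) that] yf(1) by (simp add: \<phi>_def)
    moreover have "(\<Sum>j\<in>R. q j) \<noteq> 0" using lq(4) yf(2) by (simp add: total_def)
    ultimately show ?thesis using P'(2) by (auto simp: excluded_hyperplanes_def proj_zeros_def)
  qed
  moreover have "P' \<notin> (\<Union>(k, a)\<in>K. marginal_hyperplane n d k a)"
  proof
    assume "P' \<in> (\<Union>(k, a)\<in>K. marginal_hyperplane n d k a)"
    then obtain k a where ka: "(k, a) \<in> K" "P' \<in> marginal_hyperplane n d k a" by blast
    then have "marginal n d k a q = 0" using P'(2) by (simp add: marginal_hyperplane_def proj_zeros_def)
    then show False using yf(3)[OF ka(1)] lq(1) by simp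
  qed
  ultimately have "P' \<in> general_points X" using P'M by (simp add: general_points_def)
  moreover have "P' \<in> N"
  proof -
    have "eval_mpoly g q \<noteq> 0"
      using y(4) eval_mpoly_cong[OF gR, of q "\<phi> (weight w) y"] q\<phi> by simp
    then have "P' \<notin> proj_zeros R (eval_mpoly ` G)" using P'(2) g(1) by (auto simp: proj_zeros_def)
    then show ?thesis using P'(1) G(2) by blast
  qed
  ultimately show "\<exists>P. P \<in> general_points X \<and> P \<in> N" by blast
qed

text \<open>The general points lie in the complement of \<open>W\<close> and in the complement of
  the marginal hyperplanes, and by \<open>cl\<close> are dense in both. So the two closures agree,
  and the second is the union of the desired components.\<close>

lemma spohn_CI_variety_components:
  assumes cl: "\<And>P. P \<in> graphical_model n d E \<Longrightarrow> P \<in> spohn_variety n d X \<Longrightarrow>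
      P \<notin> excluded_hyperplanes n d \<or> P \<notin> (\<Union>(k, a)\<in>K. marginal_hyperplane n d k a) \<Longrightarrow>
      P \<in> proj_zariski R closure_of general_points X"
  shows "spohn_CI_variety n d E X =
    \<Union> {Z \<in> irreducible_components
              (subtopology (proj_zariski R) (graphical_model n d E \<inter> spohn_variety n d X)).
        \<not> (\<exists>k\<in>{1..n}. \<exists>a\<in>{1..d k}. Z \<subseteq> marginal_hyperplane n d k a)}"
proof -
  define Y where "Y = graphical_model n d E \<inter> spohn_variety n d X"
  define \<H> where "\<H> = (\<lambda>(k, a). marginal_hyperplane n d k a) ` K"
  have H: "\<Union>\<H> = (\<Union>(k, a)\<in>K. marginal_hyperplane n d k a)" by (simp add: \<H>_def)
  have "closedin (proj_zariski R) Y"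
    unfolding Y_def graphical_model_def by (intro closedin_Int closedin_closure_of closedin_spohn_variety)
  moreover have "finite \<H>" using finite_K by (simp add: \<H>_def)
  moreover have "closedin (proj_zariski R) H" if "H \<in> \<H>" for H
    using that closedin_marginal_hyperplane by (auto simp: \<H>_def)
  ultimately have "proj_zariski R closure_of (Y - \<Union>\<H>) =
      \<Union>{Z \<in> irreducible_components (subtopology (proj_zariski R) Y). \<not> (\<exists>H\<in>\<H>. Z \<subseteq> H)}"
    by (rule closure_of_minus_closed_sets[OF noetherian_proj_zariski[OF finite_R]])
  moreover have "(\<exists>H\<in>\<H>. Z \<subseteq> H) \<longleftrightarrow> (\<exists>k\<in>{1..n}. \<exists>a\<in>{1..d k}. Z \<subseteq> marginal_hyperplane n d k a)" for Z
    by (auto simp: \<H>_def K_def)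
  moreover have gp: "general_points X \<subseteq> Y - \<Union>\<H>" "general_points X \<subseteq> Y - excluded_hyperplanes n d"
    unfolding H by (auto simp: general_points_def Y_def)
  have eq: "proj_zariski R closure_of A = proj_zariski R closure_of general_points X"
    if "general_points X \<subseteq> A" "A \<subseteq> proj_zariski R closure_of general_points X" for A
    using that by (intro antisym closure_of_mono closure_of_minimal closedin_closure_of)
  have "Y - \<Union>\<H> \<subseteq> proj_zariski R closure_of general_points X"
    "Y - excluded_hyperplanes n d \<subseteq> proj_zariski R closure_of general_points X"
    unfolding H using cl by (auto simp: Y_def)
  then have "proj_zariski R closure_of (Y - \<Union>\<H>) = proj_zariski R closure_of (Y - excluded_hyperplanes n d)"
    using eq gp by metis
  ultimately show ?thesis
    unfolding spohn_CI_variety_def Y_def by (simp add: Int_commute)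
qed

text \<open>The game is fixed before the point, but a point enters only through its support. As
  there are finitely many faces \<open>F\<close>, one weight is chosen for each and the conditions
  on the game are multiplied.\<close>

lemma generic_spohn_CI_variety_components:
  "generic_game n d (\<lambda>X. spohn_CI_variety n d E X =
    \<Union> {Z \<in> irreducible_components
              (subtopology (proj_zariski R) (graphical_model n d E \<inter> spohn_variety n d X)).
        \<not> (\<exists>k\<in>{1..n}. \<exists>a\<in>{1..d k}. Z \<subseteq> marginal_hyperplane n d k a)})"
proof -
  let ?A = "{1..n} \<times> R"
  define good where "good F X \<longleftrightarrow> (\<exists>w Q. face_weight w F \<and>
      (\<forall>T. T \<subseteq> I \<longrightarrow> card T = r \<longrightarrow> dependence (weight w) X (forms (weight w)) T (Q T)))" for F X
  define \<F> where "\<F> = {F. F \<subseteq> R \<and> (\<exists>w. face_weight w F) \<and> (\<forall>(k, i)\<in>K. \<exists>j\<in>F. j k = i)}"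
  have "\<F> \<subseteq> Pow R" by (auto simp: \<F>_def)
  then have fin: "finite \<F>" using finite_R by (meson finite_Pow_iff finite_subset)
  have "\<exists>q. polyf ?A q \<and> (\<exists>X. q X \<noteq> 0) \<and> (\<forall>X. q X \<noteq> 0 \<longrightarrow> good F X)" if F: "F \<in> \<F>" for F
  proof -
    obtain w where w: "face_weight w F" using F by (auto simp: \<F>_def)
    have "\<forall>a. \<exists>j. a \<in> K \<longrightarrow> j \<in> F \<and> j (fst a) = snd a" using F unfolding \<F>_def by force
    then obtain pv where pv: "\<And>a. a \<in> K \<Longrightarrow> pv a \<in> F \<and> pv a (fst a) = snd a" by metis
    have pvR: "pv (k, i) \<in> R \<and> pv (k, i) k = i \<and> weight w (pv (k, i)) = 0" if "(k, i) \<in> K" for k i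
      using pv[OF that] F w by (auto simp: \<F>_def weight_def face_weight_def)
    have "\<exists>q :: game \<Rightarrow> real. polyf ?A q \<and> (\<exists>X. q X \<noteq> 0) \<and> (\<forall>X. q X \<noteq> 0 \<longrightarrow>
        (\<exists>Q. \<forall>T. T \<subseteq> I \<longrightarrow> card T = r \<longrightarrow> dependence (weight w) X (forms (weight w)) T (Q T)))"
      by (rule generic_dependence_all[of "\<lambda>k i. pv (k, i)"]) (rule pvR)
    then obtain q :: "game \<Rightarrow> real" where q: "polyf ?A q \<and> (\<exists>X. q X \<noteq> 0) \<and> (\<forall>X. q X \<noteq> 0 \<longrightarrow>
        (\<exists>Q. \<forall>T. T \<subseteq> I \<longrightarrow> card T = r \<longrightarrow> dependence (weight w) X (forms (weight w)) T (Q T)))" ..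
    have "good F X" if qX: "q X \<noteq> 0" for X
    proof -
      obtain Q where "\<forall>T. T \<subseteq> I \<longrightarrow> card T = r \<longrightarrow> dependence (weight w) X (forms (weight w)) T (Q T)"
        using q[THEN conjunct2, THEN conjunct2, THEN spec, THEN mp, OF qX] by (elim exE)
      then show ?thesis unfolding good_def using w by (intro exI conjI)
    qed
    then show ?thesis using conjunct1[OF q] conjunct1[OF conjunct2[OF q]]
      by (intro exI[of _ q] conjI allI impI)
  qed
  then have "\<forall>F\<in>\<F>. \<exists>q. polyf ?A q \<and> (\<exists>X. q X \<noteq> 0) \<and> (\<forall>X. q X \<noteq> 0 \<longrightarrow> good F X)" by blast
  from bchoice[OF this] obtain q where q: "\<And>F. F \<in> \<F> \<Longrightarrow> polyf ?A (q F)"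
    "\<And>F. F \<in> \<F> \<Longrightarrow> \<exists>X. q F X \<noteq> 0" "\<And>F X. F \<in> \<F> \<Longrightarrow> q F X \<noteq> 0 \<Longrightarrow> good F X" by blast
  define q' where "q' X = (\<Prod>F\<in>\<F>. q F X)" for X
  have "polyf ?A q'" unfolding q'_def using q(1) by (rule polyf_prod)
  then obtain f where f: "f \<in> mpolys ?A" "q' = eval_mpoly f" by (auto simp: polyf_def)
  have "\<exists>X. q' X \<noteq> 0"
    unfolding q'_def using q(1,2) by (rule polyf_common_nonzero_finite[OF fin])
  then obtain X0 where X0: "q' X0 \<noteq> 0" by blast
  define U where "U = (?A \<rightarrow>\<^sub>E UNIV) - affine_zeros ?A (eval_mpoly ` {f})"
  have "openin (affine_zariski ?A) U"
    unfolding openin_affine_zariski U_def using f(1) by blast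
  \<comment> \<open>The polynomial reads only the entries indexed by \<open>?A\<close>, so the
    nonvanishing point can be cut down to the coordinate space.\<close>
  moreover have "restrict X0 ?A \<in> U"
    using X0 eval_mpoly_cong[OF f(1), of "restrict X0 ?A" X0] by (simp add: U_def affine_zeros_def f(2))
  then have "U \<noteq> {}" by blast
  moreover have "spohn_CI_variety n d E X =
    \<Union> {Z \<in> irreducible_components
              (subtopology (proj_zariski R) (graphical_model n d E \<inter> spohn_variety n d X)).
        \<not> (\<exists>k\<in>{1..n}. \<exists>a\<in>{1..d k}. Z \<subseteq> marginal_hyperplane n d k a)}" if X: "X \<in> U" for X
  proof (rule spohn_CI_variety_components)
    have "q' X \<noteq> 0" using X by (auto simp: U_def affine_zeros_def f(2))
    then have "good F X" if "F \<in> \<F>" for F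
      using q(3)[OF that] that fin by (auto simp: q'_def prod_zero_iff)
    then have g: "good F X" if "face_weight w F" "F \<subseteq> R" "\<forall>(k, i)\<in>K. \<exists>j\<in>F. j k = i" for w F
      using that by (auto simp: \<F>_def)
    show "P \<in> proj_zariski R closure_of general_points X"
      if "P \<in> graphical_model n d E" "P \<in> spohn_variety n d X"
        "P \<notin> excluded_hyperplanes n d \<or> P \<notin> (\<Union>(k, a)\<in>K. marginal_hyperplane n d k a)" for P
      by (rule in_closure_general_points[OF g[unfolded good_def] that])
  qed
  ultimately show ?thesis unfolding generic_game_def by blast
qed

end

theorem theorem3p8:
  fixes n :: nat and d :: "nat \<Rightarrow> nat" and E :: "nat set set"
  assumes graph: "E \<subseteq> [{1..n}]\<^bsup>2\<^esup>"
    and pos: "\<forall>k\<in>{1..n}. 0 < d k"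
  shows "generic_game n d (\<lambda>X. spohn_CI_variety n d E X =
    \<Union> {Z \<in> irreducible_components
              (subtopology (proj_zariski (states n d)) (graphical_model n d E \<inter> spohn_variety n d X)).
        \<not> (\<exists>k\<in>{1..n}. \<exists>a\<in>{1..d k}. Z \<subseteq> marginal_hyperplane n d k a)})"
proof -
  have s: "spohn_setting n d" by unfold_locales (use pos in auto)
  obtain h where h: "bij_betw h (spohn_setting.\<Omega> n d E) {1..card (spohn_setting.\<Omega> n d E)}"
    using ex_bij_betw_nat_finite_1[OF spohn_setting.finite_\<Omega>[OF s]] bij_betw_inv_into by blast
  interpret spohn_coords n d E h
    by (intro spohn_coords.intro spohn_coords_axioms.intro s h)
  show ?thesis by (rule generic_spohn_CI_variety_components)
qed

end
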